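(* Let $E$ be a non-trivial closed arc of the unit circle such that $1\in E$, let $1\le p<\infty$, and let $\Lambda$ be a positive non-increasing continuous function on $(0,1]$. Then the function $S(z)=e^{-\frac{1+z}{1-z}}$ is cyclic in $\mathcal{B}_{\Lambda,E}^p$ if and only if $$\int_0^1\sqrt{\frac{\Lambda(t)}{t}}\,dt=\infty .$$
   Context: $\mathbb{D}$ is the open unit disc. A non-trivial arc is one of positive length. Convention: $\Lambda$ is extended by $\Lambda(t)=\Lambda(1)$ for $t>1$. $\mathcal{B}_{\Lambda,E}^p$ is the space of all analytic functions $f$ on $\mathbb{D}$ with $$\|f\|_{\Lambda,E,p}^p=\int_{\mathbb{D}}|f(z)|^pe^{-p\Lambda(\operatorname{dist}(z,E))}\,dA(z)<+\infty,$$ where $dA$ is area measure. An element $f$ of a space $X$ of analytic functions on $\mathbb{D}$, invariant under multiplication by $z$, is called cyclic in $X$ if the closure in $X$ of $\{pf: p\text{ a polynomial}\}$ equals $X$. *)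

theory Defs
  imports "HOL-Complex_Analysis.Complex_Analysis"
begin

text \<open>The whole circle is admitted as an arc (case \<open>b = a + 2 * pi\<close>).\<close>

definition nontrivial_closed_arc :: "complex set \<Rightarrow> bool" where
  "nontrivial_closed_arc E \<longleftrightarrow> (\<exists>a b. a < b \<and> b \<le> a + 2 * pi \<and> E = cis ` {a..b})"

text \<open>
  The \<open>p\<close>-th power of the norm, as an extended nonnegative real. The cut-off \<open>min _ 1\<close> is the
  convention \<open>\<Lambda> t = \<Lambda> 1\<close> for \<open>t > 1\<close>.
\<close>

definition B_norm_pow ::
  "(real \<Rightarrow> real) \<Rightarrow> complex set \<Rightarrow> real \<Rightarrow> (complex \<Rightarrow> complex) \<Rightarrow> ennreal" where
  "B_norm_pow \<Lambda> E p f =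
     (\<integral>\<^sup>+z\<in>ball 0 1. ennreal (norm (f z) powr p * exp (- p * \<Lambda> (min (infdist z E) 1))) \<partial>lborel)"

definition B_norm ::
  "(real \<Rightarrow> real) \<Rightarrow> complex set \<Rightarrow> real \<Rightarrow> (complex \<Rightarrow> complex) \<Rightarrow> real" where
  "B_norm \<Lambda> E p f = enn2real (B_norm_pow \<Lambda> E p f) powr (1 / p)"

text \<open>
  Functions on the disc are represented by total functions whose values off the disc are
  arbitrary; neither membership in the space nor the norm depends on those values.
\<close>

definition B_space ::
  "(real \<Rightarrow> real) \<Rightarrow> complex set \<Rightarrow> real \<Rightarrow> (complex \<Rightarrow> complex) set" where
  "B_space \<Lambda> E p = {f. f holomorphic_on ball 0 1 \<and> B_norm_pow \<Lambda> E p f < \<infinity>}"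

definition norm_closure ::
  "(complex \<Rightarrow> complex) set \<Rightarrow> ((complex \<Rightarrow> complex) \<Rightarrow> real) \<Rightarrow>
   (complex \<Rightarrow> complex) set \<Rightarrow> (complex \<Rightarrow> complex) set" where
  "norm_closure X N A = {g \<in> X. \<forall>\<epsilon>>0. \<exists>h\<in>A. N (\<lambda>z. g z - h z) < \<epsilon>}"

definition cyclic_in ::
  "(complex \<Rightarrow> complex) set \<Rightarrow> ((complex \<Rightarrow> complex) \<Rightarrow> real) \<Rightarrow> (complex \<Rightarrow> complex) \<Rightarrow> bool" where
  "cyclic_in X N f \<longleftrightarrow>
     f \<in> X \<and> norm_closure X N {h. \<exists>q :: complex poly. h = (\<lambda>z. poly q z * f z)} = X"

definition atomic_inner :: "complex \<Rightarrow> complex" where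
  "atomic_inner z = exp (- ((1 + z) / (1 - z)))"

end

(*
Put u = (1 + z) / (1 - z), so that S = exp (-u) and dist (z, unit circle) is about Re u / |u|^2, and let
L k = Lambda (4^-k), Y k = sqrt (L k) * 2^k. The integral diverges iff the sum of L k / Y k does.

Divergence. Let v equal c * L k on [Y k, 2 * Y k] for k in a finite window, on the half of the boundary of
the half-plane that corresponds to the arc, and 0 elsewhere. Its Poisson integral is bounded; by divergence c can be
kept small while the total mass of v / y^2 is pi * (1 - a), so that, as the window moves to infinity,
the outer functions G with boundary modulus exp v tend to exp ((1 - a) * u). Moreover G * S is dominated by
exp (Lambda (dist (z, E))): far blocks contribute about (1 - a) * Re u, near blocks at most c * L k, which is
absorbed by a * Re u or, if Re u is small compared with L k, by the weight. Hence exp (-a * u) lies in the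
closure of the multiples of S for every a > 0, and so does 1. Polynomials are dense because near E the dilations
towards a suitable point increase the distance to E.

Convergence. If q * S is close to 1, then |q| <= exp (Re u + l (1 - |z|)), where l is Lambda up to a logarithm.
With L k, Y k formed from l, exp (sum of 16 * L k / (1 + Y k * (1 - z))) dominates |q| on the curve
Re u = l (1 - |z|), hence beyond it, and it is exp (o(u)) as z tends to 1 radially; but q is close to exp u there.
*)

theory Submission
  imports Defs
begin

section \<open>Point evaluations are bounded by area integrals\<close>

text \<open>The heights come from a balance. Where Re u is about \<open>L k\<close> and the distance
  to the circle is about 4^-k, the relation dist = Re u / |u|^2 forces |u| to be about
  \<open>Y k\<close>; this is the scale at which the weight can pay for boundary values of size
  \<open>L k\<close>, and also the scale at which the curve of the converse crosses the k-th shell.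
  The mass of v / y^2 matters because u / (y (y + i s u)) is close to u / y^2 once y is large
  against |u|, so that a block far away acts like a multiple of u. Only one half of the boundary
  carries v since 1 may be an end point of the arc, and on the other side points close to the circle
  need not be close to E. The loss of a in the exponent pays twice: for replacing the Poisson kernel
  by its far limit, and for near blocks at points that the weight does not cover. In the converse, E
  enters only through dist (z, E) >= 1 - |z|, so that all bounds are radial. The region beyond the
  curve touches the circle at 1 alone, and passing from the curve to that region is a
  Phragmen-Lindelof argument in which a factor 1 - z absorbs the remaining shells.\<close>

lemma borel_measurable_ennreal_indicator:
  fixes f :: "'a::topological_space \<Rightarrow> real"
  assumes "S \<in> sets borel" "continuous_on S f"
  shows "(\<lambda>x. ennreal (f x) * indicator S x) \<in> borel_measurable borel"
proof -
  have "(\<lambda>x. ennreal (indicator S x * f x)) \<in> borel_measurable borel"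
    using borel_measurable_continuous_on_indicator[OF assms] by simp
  then show ?thesis by (rule measurable_cong[THEN iffD1, rotated]) (auto simp: indicator_def)
qed

lemma measurable_Complex: "(\<lambda>(x, y). Complex x y) \<in> borel_measurable (lborel \<Otimes>\<^sub>M lborel)"
proof -
  have "(\<lambda>p. Complex (fst p) (snd p)) \<in> borel_measurable borel"
    by (intro borel_measurable_continuous_onI continuous_intros)
  then show ?thesis by (simp add: lborel_prod case_prod_beta)
qed

lemma lborel_complex_eq_distr:
  "(lborel :: complex measure) = distr (lborel \<Otimes>\<^sub>M lborel) borel (\<lambda>(x, y). Complex x y)"
proof (rule lborel_eqI)
  note meas = measurable_Complex
  fix l u :: complex
  assume le: "\<And>b. b \<in> Basis \<Longrightarrow> l \<bullet> b \<le> u \<bullet> b"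
  have *: "Re l \<le> Re u" "Im l \<le> Im u" using le[of 1] le[of "\<i>"] by (auto simp: Basis_complex_def)
  have eq: "(\<lambda>(x, y). Complex x y) -` box l u = box (Re l, Im l) (Re u, Im u)"
    by (auto simp: box_def Basis_complex_def Basis_prod_def)
  have "emeasure (distr (lborel \<Otimes>\<^sub>M lborel) borel (\<lambda>(x, y). Complex x y)) (box l u)
      = emeasure (lborel \<Otimes>\<^sub>M lborel) (box (Re l, Im l) (Re u, Im u))"
    by (subst emeasure_distr[OF meas]) (auto simp: eq lborel_prod)
  also have "\<dots> = (\<Prod>b\<in>Basis. (u - l) \<bullet> b)"
    using * by (simp add: lborel_prod emeasure_lborel_box_eq Basis_prod_def Basis_complex_def)
  finally show "emeasure (distr (lborel \<Otimes>\<^sub>M lborel) borel (\<lambda>(x, y). Complex x y)) (box l u) = (\<Prod>b\<in>Basis. (u - l) \<bullet> b)" .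
qed simp

lemma nn_integral_lborel_complex:
  assumes "f \<in> borel_measurable borel"
  shows "(\<integral>\<^sup>+z. f z \<partial>lborel) = (\<integral>\<^sup>+x. \<integral>\<^sup>+y. f (Complex x y) \<partial>lborel \<partial>lborel)"
    and "(\<integral>\<^sup>+z. f z \<partial>lborel) = (\<integral>\<^sup>+y. \<integral>\<^sup>+x. f (Complex x y) \<partial>lborel \<partial>lborel)"
proof -
  note meas = measurable_Complex
  have meas2: "(\<lambda>(x, y). f (Complex x y)) \<in> borel_measurable (lborel \<Otimes>\<^sub>M lborel)"
    using measurable_compose[OF meas assms] by (simp add: case_prod_beta)
  have *: "(\<integral>\<^sup>+z. f z \<partial>lborel) = (\<integral>\<^sup>+p. (case p of (x, y) \<Rightarrow> f (Complex x y)) \<partial>(lborel \<Otimes>\<^sub>M lborel))"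
    by (subst lborel_complex_eq_distr, subst nn_integral_distr[OF meas])
       (simp_all add: assms split_beta')
  show "(\<integral>\<^sup>+z. f z \<partial>lborel) = (\<integral>\<^sup>+x. \<integral>\<^sup>+y. f (Complex x y) \<partial>lborel \<partial>lborel)"
    unfolding * by (subst lborel.nn_integral_fst[OF meas2, symmetric]) simp
  show "(\<integral>\<^sup>+z. f z \<partial>lborel) = (\<integral>\<^sup>+y. \<integral>\<^sup>+x. f (Complex x y) \<partial>lborel \<partial>lborel)"
    unfolding * by (subst lborel_pair.nn_integral_snd[OF meas2, symmetric]) simp
qed

lemma norm_contour_integral_linepath_le:
  assumes "continuous_on (closed_segment a b) f" "\<And>w. w \<in> closed_segment a b \<Longrightarrow> norm (f w) \<le> h w"
    and "continuous_on (closed_segment a b) h"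
  shows "norm (contour_integral (linepath a b) f) \<le> norm (b - a) * integral {0..1} (\<lambda>x. h (linepath a b x))"
proof -
  have im: "linepath a b ` {0..1} = closed_segment a b"
    by (simp flip: path_image_def)
  have c: "continuous_on {0..1} (\<lambda>x. g (linepath a b x))" if "continuous_on (closed_segment a b) g" for g :: "complex \<Rightarrow> 'a::t2_space"
    using continuous_on_compose2[OF that continuous_on_linepath[of "{0..1}" a b]] im by auto
  have "norm (contour_integral (linepath a b) f) = norm (b - a) * norm (integral {0..1} (\<lambda>x. f (linepath a b x)))"
    by (simp add: contour_integral_integral norm_mult mult.commute)
  also have "\<dots> \<le> norm (b - a) * integral {0..1} (\<lambda>x. h (linepath a b x))"
  proof (intro mult_left_mono integral_norm_bound_integral)
    show "(\<lambda>x. f (linepath a b x)) integrable_on {0..1}" "(\<lambda>x. h (linepath a b x)) integrable_on {0..1}"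
      using assms(1,3) by (auto intro!: integrable_continuous_interval c)
    show "norm (f (linepath a b x)) \<le> h (linepath a b x)" if "x \<in> {0..1}" for x
      using assms(2) im that by blast
  qed auto
  finally show ?thesis .
qed

text \<open>Serves one side of a square: \<open>P\<close> runs through the whole line carrying the
  side, and \<open>c + d * x\<close> is the coordinate at parameter \<open>x\<close>. Since |d| is
  both the length of the side and the Jacobian, no factor is left over, and the integral over a full
  line is ready for Tonelli.\<close>

lemma linepath_integral_le_nn_integral:
  fixes g :: "complex \<Rightarrow> complex" and H :: "complex \<Rightarrow> ennreal"
  assumes g: "continuous_on (closed_segment a b) g"
    and H: "H \<in> borel_measurable borel"
    and le: "\<And>w. w \<in> closed_segment a b \<Longrightarrow> ennreal (norm (g w)) \<le> H w"
    and P: "P \<in> borel_measurable borel"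
    and d: "d \<noteq> 0" "norm (b - a) = \<bar>d\<bar>" "\<And>x. linepath a b x = P (c + d * x)"
  shows "ennreal (norm (b - a) * integral {0..1} (\<lambda>x. norm (g (linepath a b x)))) \<le> (\<integral>\<^sup>+t. H (P t) \<partial>lborel)"
proof -
  have im: "linepath a b ` {0..1} = closed_segment a b"
    by (simp flip: path_image_def)
  have cont: "continuous_on {0..1} (\<lambda>x. norm (g (linepath a b x)))"
    using continuous_on_compose2[OF g continuous_on_linepath[of "{0..1}" a b]] im
    by (auto intro!: continuous_intros)
  have "ennreal (integral {0..1} (\<lambda>x. norm (g (linepath a b x))))
      = (\<integral>\<^sup>+x. ennreal (indicator {0..1} x * norm (g (linepath a b x))) \<partial>lborel)"
  proof (rule nn_integral_has_integral_lborel[symmetric])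
    show "(\<lambda>x. indicator {0..1} x * norm (g (linepath a b x))) \<in> borel_measurable borel"
      using borel_measurable_continuous_on_indicator[OF _ cont] by simp
    have "((\<lambda>x. norm (g (linepath a b x))) has_integral integral {0..1} (\<lambda>x. norm (g (linepath a b x)))) {0..1}"
      using integrable_integral[OF integrable_continuous_interval[OF cont]] .
    then show "((\<lambda>x. indicator {0..1} x * norm (g (linepath a b x))) has_integral
          integral {0..1} (\<lambda>x. norm (g (linepath a b x)))) UNIV"
      by (subst (asm) has_integral_restrict_UNIV[symmetric])
         (simp add: indicator_def of_bool_def if_distrib[of "\<lambda>x. x * _"] cong: if_cong)
  qed auto
  also have "\<dots> \<le> (\<integral>\<^sup>+x. H (P (c + d * x)) \<partial>lborel)"
  proof (rule nn_integral_mono)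
    fix x :: real
    show "ennreal (indicator {0..1} x * norm (g (linepath a b x))) \<le> H (P (c + d * x))"
    proof (cases "x \<in> {0..1}")
      case True
      then have "linepath a b x \<in> closed_segment a b" using im by blast
      from le[OF this] show ?thesis using True by (simp add: d(3))
    qed auto
  qed
  finally have "ennreal (norm (b - a) * integral {0..1} (\<lambda>x. norm (g (linepath a b x))))
      \<le> ennreal \<bar>d\<bar> * (\<integral>\<^sup>+x. H (P (c + d * x)) \<partial>lborel)"
    by (simp add: d(2) ennreal_mult' mult_left_mono)
  also have "\<dots> = (\<integral>\<^sup>+t. H (P t) \<partial>lborel)"
    by (rule nn_integral_real_affine[OF measurable_compose[OF P H] d(1), symmetric])
  finally show ?thesis .
qed

text \<open>Cauchy's formula on the concentric squares of half-side \<open>r\<close>, averaged over \<open>r \<in> {\<rho>..2\<rho>}\<close>.\<close>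

lemma norm_le_area_integral_square:
  fixes g :: "complex \<Rightarrow> complex"
  defines "Q \<equiv> \<lambda>z r. cbox (z - Complex r r) (z + Complex r r)"
  assumes hol: "g holomorphic_on Q z (2 * \<rho>)" and "\<rho> > 0"
  shows "ennreal (norm (g z)) \<le> ennreal (1 / \<rho>\<^sup>2) * (\<integral>\<^sup>+w\<in>Q z (2 * \<rho>). ennreal (norm (g w)) \<partial>lborel)"
proof -
  define H where "H w = ennreal (norm (g w)) * indicator (Q z (2 * \<rho>)) w" for w
  have cont: "continuous_on (Q z (2 * \<rho>)) g" using hol holomorphic_on_imp_continuous_on by blast
  have H: "H \<in> borel_measurable borel" unfolding H_def
    by (intro borel_measurable_ennreal_indicator continuous_on_norm cont) (simp add: Q_def)
  define V where "V s = (\<integral>\<^sup>+t. H (Complex s t) \<partial>lborel)" for s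
  define W where "W s = (\<integral>\<^sup>+t. H (Complex t s) \<partial>lborel)" for s
  define I where "I = (\<integral>\<^sup>+w. H w \<partial>lborel)"
  have IV: "(\<integral>\<^sup>+s. V s \<partial>lborel) = I" and IW: "(\<integral>\<^sup>+s. W s \<partial>lborel) = I"
    unfolding V_def W_def I_def using nn_integral_lborel_complex[OF H] by auto
  have HC: "(\<lambda>(x, y). H (Complex x y)) \<in> borel_measurable (lborel \<Otimes>\<^sub>M lborel)"
       and HC': "(\<lambda>(y, x). H (Complex x y)) \<in> borel_measurable (lborel \<Otimes>\<^sub>M lborel)"
    using measurable_compose[OF measurable_Complex H]
      measurable_compose[OF measurable_pair_swap'[of lborel lborel] measurable_compose[OF measurable_Complex H]]
    by (simp_all add: case_prod_beta)
  have [measurable]: "V \<in> borel_measurable borel" "W \<in> borel_measurable borel"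
    using lborel.borel_measurable_nn_integral_fst[OF HC] lborel.borel_measurable_nn_integral_fst[OF HC']
    by (simp_all add: V_def[abs_def] W_def[abs_def])
  have sub: "Q z r \<subseteq> Q z (2 * \<rho>)" if "r \<le> 2 * \<rho>" for r
    using that by (auto simp: Q_def cbox_complex_eq)
  \<comment> \<open>On the boundary of the square the Cauchy kernel is at most 1 / r, hence at most
    1 / \<rho>. Each side is then enlarged to its full line, where \<open>H\<close> vanishes off the
    large square.\<close>
  have est: "ennreal (2 * pi * \<rho> * norm (g z)) \<le> W (Im z - r) + V (Re z + r) + W (Im z + r) + V (Re z - r)"
    if r: "r \<in> {\<rho>..2 * \<rho>}" for r
  proof -
    define a1 where "a1 = z - Complex r r"
    define a2 where "a2 = z + Complex r (-r)"
    define a3 where "a3 = z + Complex r r"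
    define a4 where "a4 = z + Complex (-r) r"
    note a_defs = a1_def a2_def a3_def a4_def
    have r0: "r > 0" using r \<open>\<rho> > 0\<close> by auto
    have rp: "rectpath a1 a3 = linepath a1 a2 +++ linepath a2 a3 +++ linepath a3 a4 +++ linepath a4 a1"
      by (simp add: rectpath_def Let_def a_defs complex_eq_iff)
        (intro conjI arg_cong2[of _ _ _ _ "(+++)"] arg_cong2[of _ _ _ _ linepath]; simp add: complex_eq_iff)
    let ?F = "\<lambda>w. g w / (w - z)"
    have box: "closed_segment a1 a2 \<subseteq> Q z r" "closed_segment a2 a3 \<subseteq> Q z r" 
         "closed_segment a3 a4 \<subseteq> Q z r" "closed_segment a4 a1 \<subseteq> Q z r"
    proof -
      have "a1 \<in> Q z r" "a2 \<in> Q z r" "a3 \<in> Q z r" "a4 \<in> Q z r" "convex (Q z r)"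
        using r0 by (auto simp: Q_def a_defs in_cbox_complex_iff convex_box)
      then show "closed_segment a1 a2 \<subseteq> Q z r" "closed_segment a2 a3 \<subseteq> Q z r" 
         "closed_segment a3 a4 \<subseteq> Q z r" "closed_segment a4 a1 \<subseteq> Q z r"
        by (simp_all only: closed_segment_subset)
    qed
    have dist: "r \<le> norm (w - z)" if "w \<in> closed_segment a1 a2 \<union> closed_segment a2 a3 \<union> closed_segment a3 a4 \<union> closed_segment a4 a1" for w
    proof -
      have "\<bar>Re (w - z)\<bar> = r \<or> \<bar>Im (w - z)\<bar> = r"
        using that r0 closed_segment_same_Im[of a1 a2] closed_segment_same_Re[of a2 a3] 
           closed_segment_same_Im[of a3 a4] closed_segment_same_Re[of a4 a1]
        by (auto simp: a_defs)
      then show ?thesis using abs_Re_le_cmod[of "w - z"] abs_Im_le_cmod[of "w - z"] by linarith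
    qed
    have side: "contour_integral (linepath a b) ?F \<in> UNIV \<and> ?F contour_integrable_on (linepath a b) \<and>
        norm (contour_integral (linepath a b) ?F) \<le> (1/\<rho>) * (norm (b - a) * integral {0..1} (\<lambda>x. norm (g (linepath a b x))))"
      if "(a, b) \<in> {(a1, a2), (a2, a3), (a3, a4), (a4, a1)}" for a b
    proof -
      have s: "closed_segment a b \<subseteq> Q z (2*\<rho>)" using that box sub[of r] r by auto
      have d: "r \<le> norm (w - z)" if "w \<in> closed_segment a b" for w
        using dist that \<open>(a, b) \<in> _\<close> by auto
      have cg: "continuous_on (closed_segment a b) g" using cont s continuous_on_subset by blast
      have "w - z \<noteq> 0" if "w \<in> closed_segment a b" for w using d[OF that] r0 by auto
      then have cF: "continuous_on (closed_segment a b) ?F"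
        by (intro continuous_intros cg) auto
      have "norm (contour_integral (linepath a b) ?F) \<le> norm (b - a) * integral {0..1} (\<lambda>x. (1/\<rho>) * norm (g (linepath a b x)))"
      proof (rule norm_contour_integral_linepath_le[OF cF, where h = "\<lambda>w. (1/\<rho>) * norm (g w)"])
        show "continuous_on (closed_segment a b) (\<lambda>w. 1 / \<rho> * cmod (g w))"
          by (intro continuous_intros cg)
        fix w assume "w \<in> closed_segment a b"
        then have "\<rho> \<le> norm (w - z)" using d r by force
        then show "cmod (g w / (w - z)) \<le> 1 / \<rho> * cmod (g w)"
          using \<open>\<rho> > 0\<close> by (simp add: norm_divide divide_left_mono frac_le)
      qed
      also have "\<dots> = (1/\<rho>) * (norm (b - a) * integral {0..1} (\<lambda>x. norm (g (linepath a b x))))"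
        by (simp only: integral_mult_right) simp
      finally show ?thesis using contour_integrable_continuous_linepath[OF cF] by auto
    qed
    let ?L = "\<lambda>a b. norm (b - a) * integral {0..1} (\<lambda>x. norm (g (linepath a b x)))"
    have Ln0: "0 \<le> ?L a b" for a b
      by (cases "(\<lambda>x. norm (g (linepath a b x))) integrable_on {0..1}")
         (auto intro!: mult_nonneg_nonneg integral_nonneg simp: not_integrable_integral)
    have *: "(?F has_contour_integral (2 * pi * \<i> * winding_number (rectpath a1 a3) z * g z)) (rectpath a1 a3)"
    proof (rule Cauchy_integral_formula_convex_simple[OF _ hol])
      show "convex (Q z (2*\<rho>))" by (simp add: Q_def convex_box)
      show "z \<in> interior (Q z (2*\<rho>))" using \<open>\<rho> > 0\<close> by (simp add: Q_def interior_cbox in_box_complex_iff)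
      show "path_image (rectpath a1 a3) \<subseteq> Q z (2 * \<rho>) - {z}"
      proof -
        have "path_image (rectpath a1 a3) = closed_segment a1 a2 \<union> closed_segment a2 a3 \<union> closed_segment a3 a4 \<union> closed_segment a4 a1"
          unfolding rp by (simp add: path_image_join Un_assoc)
        moreover have "z \<notin> closed_segment a1 a2 \<union> closed_segment a2 a3 \<union> closed_segment a3 a4 \<union> closed_segment a4 a1"
          using dist[of z] r0 by auto
        ultimately show ?thesis using box sub[of r] r by auto
      qed
    qed (auto simp: rectpath_def Let_def)
    have wn: "winding_number (rectpath a1 a3) z = 1"
      by (rule winding_number_rectpath) (use r0 in \<open>auto simp: in_box_complex_iff a_defs\<close>)
    have "2 * pi * \<i> * g z = contour_integral (rectpath a1 a3) ?F"
      using contour_integral_unique[OF *] wn by simp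
    also have "\<dots> = contour_integral (linepath a1 a2) ?F + contour_integral (linepath a2 a3) ?F
        + contour_integral (linepath a3 a4) ?F + contour_integral (linepath a4 a1) ?F"
      unfolding rp using side[of a1 a2] side[of a2 a3] side[of a3 a4] side[of a4 a1]
      by (simp add: contour_integrable_join)
    finally have "norm (2 * pi * \<i> * g z) = norm (contour_integral (linepath a1 a2) ?F + contour_integral (linepath a2 a3) ?F
        + contour_integral (linepath a3 a4) ?F + contour_integral (linepath a4 a1) ?F)" by (rule arg_cong)
    moreover have "norm (2 * pi * \<i> * g z) = 2 * pi * norm (g z)" by (simp add: norm_mult)
    ultimately have "2 * pi * norm (g z) = norm (contour_integral (linepath a1 a2) ?F + contour_integral (linepath a2 a3) ?F
        + contour_integral (linepath a3 a4) ?F + contour_integral (linepath a4 a1) ?F)" by simp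
    also have "\<dots> \<le> (1/\<rho>) * ?L a1 a2 + (1/\<rho>) * ?L a2 a3 + (1/\<rho>) * ?L a3 a4 + (1/\<rho>) * ?L a4 a1"
      using side[of a1 a2] side[of a2 a3] side[of a3 a4] side[of a4 a1]
      by (intro order_trans[OF norm_triangle_ineq] add_mono) simp_all
    finally have "2 * pi * \<rho> * norm (g z) \<le> ?L a1 a2 + ?L a2 a3 + ?L a3 a4 + ?L a4 a1"
      using \<open>\<rho> > 0\<close> by (simp add: field_simps)
    then have "ennreal (2 * pi * \<rho> * norm (g z)) \<le> ennreal (?L a1 a2) + ennreal (?L a2 a3) + ennreal (?L a3 a4) + ennreal (?L a4 a1)"
      using Ln0 by (simp flip: ennreal_plus add: ennreal_leI del: ennreal_plus)
    also have "\<dots> \<le> W (Im z - r) + V (Re z + r) + W (Im z + r) + V (Re z - r)"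
    proof (intro add_mono)
      have P: "(\<lambda>t. Complex s t) \<in> borel_measurable borel" "(\<lambda>t. Complex t s) \<in> borel_measurable borel" for s
        by (intro borel_measurable_continuous_onI continuous_intros)+
      have HH: "ennreal (norm (g w)) \<le> H w" if "w \<in> Q z r" for w
        using that sub[of r] r by (auto simp: H_def indicator_def)
      have cQ: "continuous_on (closed_segment a b) g" if "closed_segment a b \<subseteq> Q z r" for a b
        using that sub[of r] r cont continuous_on_subset by fastforce
      have n: "norm (Complex x 0) = \<bar>x\<bar>" "norm (Complex 0 x) = \<bar>x\<bar>" for x
        by (auto simp: cmod_def)
      show "ennreal (?L a1 a2) \<le> W (Im z - r)" unfolding W_def
      proof (rule linepath_integral_le_nn_integral[OF cQ H HH P(2), where d="2*r" and c = "Re z - r"])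
        have "a2 - a1 = Complex (2 * r) 0" by (simp add: a_defs complex_eq_iff)
        then show "norm (a2 - a1) = \<bar>2 * r\<bar>" by (simp only: n)
      qed (use box r0 in \<open>auto simp: a_defs linepath_def complex_eq_iff algebra_simps\<close>)
      show "ennreal (?L a2 a3) \<le> V (Re z + r)" unfolding V_def
      proof (rule linepath_integral_le_nn_integral[OF cQ H HH P(1), where d="2*r" and c = "Im z - r"])
        have "a3 - a2 = Complex 0 (2 * r)" by (simp add: a_defs complex_eq_iff)
        then show "norm (a3 - a2) = \<bar>2 * r\<bar>" by (simp only: n)
      qed (use box r0 in \<open>auto simp: a_defs linepath_def complex_eq_iff algebra_simps\<close>)
      show "ennreal (?L a3 a4) \<le> W (Im z + r)" unfolding W_def
      proof (rule linepath_integral_le_nn_integral[OF cQ H HH P(2), where d="-2*r" and c = "Re z + r"])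
        have "a4 - a3 = Complex (-2 * r) 0" by (simp add: a_defs complex_eq_iff)
        then show "norm (a4 - a3) = \<bar>-2 * r\<bar>" by (simp only: n)
      qed (use box r0 in \<open>auto simp: a_defs linepath_def complex_eq_iff algebra_simps\<close>)
      show "ennreal (?L a4 a1) \<le> V (Re z - r)" unfolding V_def
      proof (rule linepath_integral_le_nn_integral[OF cQ H HH P(1), where d="-2*r" and c = "Im z + r"])
        have "a1 - a4 = Complex 0 (-2 * r)" by (simp add: a_defs complex_eq_iff)
        then show "norm (a1 - a4) = \<bar>-2 * r\<bar>" by (simp only: n)
      qed (use box r0 in \<open>auto simp: a_defs linepath_def complex_eq_iff algebra_simps\<close>)
    qed
    finally show ?thesis .
  qed
  have shift: "(\<integral>\<^sup>+r. f (c + r) \<partial>lborel) = (\<integral>\<^sup>+r. f r \<partial>lborel)" "(\<integral>\<^sup>+r. f (c - r) \<partial>lborel) = (\<integral>\<^sup>+r. f r \<partial>lborel)"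
    if "f \<in> borel_measurable borel" for f :: "real \<Rightarrow> ennreal" and c
    using nn_integral_real_affine[OF that, of 1 c] nn_integral_real_affine[OF that, of "-1" c] by auto
  \<comment> \<open>The averaging interval has length \<rho>, whence the square. On the right, r is
    released to the whole real line, and each of the four moving lines sweeps out exactly the area
    integral \<open>I\<close>.\<close>
  have "ennreal (2 * pi * \<rho>\<^sup>2 * norm (g z)) = (\<integral>\<^sup>+r\<in>{\<rho>..2 * \<rho>}. ennreal (2 * pi * \<rho> * norm (g z)) \<partial>lborel)"
    using \<open>\<rho> > 0\<close>
    by (subst nn_integral_cmult_indicator) (simp_all add: power2_eq_square mult_ac flip: ennreal_mult'')
  also have "\<dots> \<le> (\<integral>\<^sup>+r. W (Im z - r) + V (Re z + r) + W (Im z + r) + V (Re z - r) \<partial>lborel)"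
    using est by (intro nn_integral_mono) (auto simp: indicator_def)
  also have "\<dots> = I + I + I + I"
    by (simp add: nn_integral_add shift IV IW)
  also have "\<dots> = 4 * I"
    by (metis (no_types, lifting) add.assoc mult_2 numeral_Bit0 distrib_right)
  finally have "ennreal (1 / (2 * pi * \<rho>\<^sup>2)) * ennreal (2 * pi * \<rho>\<^sup>2 * norm (g z)) \<le> ennreal (1 / (2 * pi * \<rho>\<^sup>2)) * (4 * I)"
    by (rule mult_left_mono) simp
  moreover have "ennreal (1 / (2 * pi * \<rho>\<^sup>2)) * ennreal (2 * pi * \<rho>\<^sup>2 * norm (g z)) = ennreal (norm (g z))"
    using \<open>\<rho> > 0\<close> by (simp flip: ennreal_mult')
  moreover have "ennreal (1 / (2 * pi * \<rho>\<^sup>2)) * (4 * I) = ennreal (4 / (2 * pi * \<rho>\<^sup>2)) * I"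
  proof -
    have "ennreal (1 / (2 * pi * \<rho>\<^sup>2)) * ennreal 4 = ennreal (1 / (2 * pi * \<rho>\<^sup>2) * 4)"
      by (rule ennreal_mult''[symmetric]) simp
    then have "ennreal (1 / (2 * pi * \<rho>\<^sup>2)) * 4 = ennreal (4 / (2 * pi * \<rho>\<^sup>2))"
      by (simp only: ennreal_numeral) simp
    then show ?thesis by (simp only: mult.assoc[symmetric])
  qed
  moreover have "ennreal (4 / (2 * pi * \<rho>\<^sup>2)) * I \<le> ennreal (1 / \<rho>\<^sup>2) * I"
    using \<open>\<rho> > 0\<close> pi_gt3 by (intro mult_right_mono ennreal_leI) (auto simp: field_simps)
  ultimately have "ennreal (norm (g z)) \<le> ennreal (1 / \<rho>\<^sup>2) * I" by simp
  then show ?thesis by (simp only: I_def H_def)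
qed

text \<open>Stands in for Hoelder's inequality: above \<delta>, the factor
  \<open>a powr (1 - p)\<close> is at most \<open>\<delta> powr (1 - p)\<close> because 1 - p is not
  positive. The additive error \<delta> is left to the caller.\<close>

lemma le_add_powr:
  fixes a :: real
  assumes "0 \<le> a" "0 < \<delta>" "1 \<le> p"
  shows "a \<le> \<delta> + \<delta> powr (1 - p) * a powr p"
proof (cases "a \<le> \<delta>")
  case True
  then show ?thesis using assms by (simp add: add_increasing2)
next
  case False
  then have "a powr (1 - p) \<le> \<delta> powr (1 - p)" using assms by (intro powr_mono2') auto
  then have "a powr (1 - p) * a powr p \<le> \<delta> powr (1 - p) * a powr p"
    by (intro mult_right_mono) auto
  moreover have "a powr (1 - p) * a powr p = a" using False assms by (simp flip: powr_add)
  ultimately show ?thesis using assms by simp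
qed

text \<open>Comes from \<open>le_add_powr\<close> under the area integral. The square has side 4
  \<rho>, so the constant \<delta> contributes its area divided by \<rho>^2, that is 16
  \<delta>.\<close>

lemma norm_le_area_integral_powr_square:
  fixes g :: "complex \<Rightarrow> complex"
  defines "Q \<equiv> \<lambda>z r. cbox (z - Complex r r) (z + Complex r r)"
  assumes hol: "g holomorphic_on Q z (2 * \<rho>)" and "\<rho> > 0" "1 \<le> p" "\<delta> > 0"
  shows "ennreal (norm (g z)) \<le> ennreal (16 * \<delta>)
      + ennreal (\<delta> powr (1 - p) / \<rho>\<^sup>2) * (\<integral>\<^sup>+w\<in>Q z (2 * \<rho>). ennreal (norm (g w) powr p) \<partial>lborel)"
proof -
  let ?J = "\<integral>\<^sup>+w\<in>Q z (2 * \<rho>). ennreal (norm (g w) powr p) \<partial>lborel"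
  let ?f = "\<lambda>w. ennreal (norm (g w) powr p) * indicator (Q z (2 * \<rho>)) w"
  let ?Q = "Q z (2 * \<rho>)"
  have cont: "continuous_on ?Q g" using hol holomorphic_on_imp_continuous_on by blast
  have meas: "?f \<in> borel_measurable borel"
    using \<open>1 \<le> p\<close>
    by (intro borel_measurable_ennreal_indicator continuous_on_powr' continuous_on_norm cont) (auto simp: Q_def)
  have area: "emeasure lborel ?Q = ennreal (16 * \<rho>\<^sup>2)"
    using \<open>\<rho> > 0\<close>
    by (simp add: Q_def emeasure_lborel_cbox_eq Basis_complex_def power2_eq_square)
  have "ennreal (norm (g z)) \<le> ennreal (1 / \<rho>\<^sup>2) * (\<integral>\<^sup>+w\<in>Q z (2 * \<rho>). ennreal (norm (g w)) \<partial>lborel)"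
    using norm_le_area_integral_square[of g z \<rho>] hol \<open>\<rho> > 0\<close> by (simp add: Q_def)
  also have "\<dots> \<le> ennreal (1 / \<rho>\<^sup>2) * (\<integral>\<^sup>+w. (ennreal \<delta> * indicator ?Q w + 
      ennreal (\<delta> powr (1 - p)) * ?f w) \<partial>lborel)"
  proof (intro mult_left_mono nn_integral_mono)
    fix w
    have "ennreal (norm (g w)) \<le> ennreal \<delta> + ennreal (\<delta> powr (1 - p)) * ennreal (norm (g w) powr p)"
    proof -
      have "ennreal (norm (g w)) \<le> ennreal (\<delta> + \<delta> powr (1 - p) * norm (g w) powr p)"
        using le_add_powr[of "norm (g w)" \<delta> p] assms by (intro ennreal_leI) auto
      also have "\<dots> = ennreal \<delta> + ennreal (\<delta> powr (1 - p) * norm (g w) powr p)"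
        using assms by (intro ennreal_plus) auto
      also have "ennreal (\<delta> powr (1 - p) * norm (g w) powr p) = ennreal (\<delta> powr (1 - p)) * ennreal (norm (g w) powr p)"
        by (rule ennreal_mult'') simp
      finally show ?thesis .
    qed
    then show "ennreal (norm (g w)) * indicator ?Q w \<le> ennreal \<delta> * indicator ?Q w + 
      ennreal (\<delta> powr (1 - p)) * ?f w"
      by (auto simp: indicator_def)
  qed auto
  also have "\<dots> = ennreal (1 / \<rho>\<^sup>2) * (ennreal \<delta> * ennreal (16 * \<rho>\<^sup>2)
      + ennreal (\<delta> powr (1 - p)) * ?J)"
  proof (subst nn_integral_add)
    show "(\<lambda>w. ennreal \<delta> * indicator ?Q w) \<in> borel_measurable lborel"
      by (simp add: Q_def)
    show "(\<lambda>w. ennreal (\<delta> powr (1 - p)) * ?f w) \<in> borel_measurable lborel"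
      using meas by simp
    have "(\<integral>\<^sup>+w. ennreal \<delta> * indicator ?Q w \<partial>lborel) = ennreal \<delta> * ennreal (16 * \<rho>\<^sup>2)"
      unfolding area[symmetric] by (rule nn_integral_cmult_indicator) (simp add: Q_def)
    moreover have "(\<integral>\<^sup>+w. ennreal (\<delta> powr (1 - p)) * ?f w \<partial>lborel)
       = ennreal (\<delta> powr (1 - p)) * ?J"
      using meas by (intro nn_integral_cmult) simp
    ultimately show "ennreal (1 / \<rho>\<^sup>2) * ((\<integral>\<^sup>+w. ennreal \<delta> * indicator ?Q w \<partial>lborel)
       + (\<integral>\<^sup>+w. ennreal (\<delta> powr (1 - p)) * ?f w \<partial>lborel))
       = ennreal (1 / \<rho>\<^sup>2) * (ennreal \<delta> * ennreal (16 * \<rho>\<^sup>2)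
      + ennreal (\<delta> powr (1 - p)) * ?J)" by (simp only:)
  qed
  also have "\<dots> = ennreal (16 * \<delta>)
      + ennreal (\<delta> powr (1 - p) / \<rho>\<^sup>2) * ?J"
  proof -
    have "ennreal (1 / \<rho>\<^sup>2) * (ennreal \<delta> * ennreal (16 * \<rho>\<^sup>2)) = ennreal (16 * \<delta>)"
    proof -
      have "ennreal \<delta> * ennreal (16 * \<rho>\<^sup>2) = ennreal (\<delta> * (16 * \<rho>\<^sup>2))"
        by (rule ennreal_mult''[symmetric]) simp
      moreover have "ennreal (1 / \<rho>\<^sup>2) * ennreal (\<delta> * (16 * \<rho>\<^sup>2)) = ennreal (1 / \<rho>\<^sup>2 * (\<delta> * (16 * \<rho>\<^sup>2)))"
        using assms by (intro ennreal_mult''[symmetric]) simp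
      moreover have "1 / \<rho>\<^sup>2 * (\<delta> * (16 * \<rho>\<^sup>2)) = 16 * \<delta>" using assms by simp
      ultimately show ?thesis by (simp only:)
    qed
    moreover have "ennreal (1 / \<rho>\<^sup>2) * ennreal (\<delta> powr (1 - p)) = ennreal (1 / \<rho>\<^sup>2 * \<delta> powr (1 - p))"
      by (rule ennreal_mult''[symmetric]) simp
    ultimately show ?thesis by (simp only: distrib_left mult.assoc[symmetric]) simp
  qed
  finally show ?thesis .
qed

section \<open>Weighted area norms and closures of multiples\<close>

text \<open>A sum has at most twice the norm of its larger term. This crude substitute for
  Minkowski's inequality allows working with p-th powers throughout.\<close>

lemma norm_add_powr_le:
  fixes a b :: "'a::real_normed_vector"
  assumes "0 \<le> p"
  shows "norm (a + b) powr p \<le> 2 powr p * (norm a powr p + norm b powr p)"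
proof -
  define m where "m = max (norm a) (norm b)"
  have "norm (a + b) powr p \<le> (2 * m) powr p"
    using norm_triangle_ineq[of a b] assms by (intro powr_mono2) (auto simp: m_def)
  also have "\<dots> = 2 powr p * m powr p" by (simp add: powr_mult m_def)
  also have "m powr p \<le> norm a powr p + norm b powr p" by (auto simp: m_def max_def)
  finally show ?thesis by simp
qed

lemma norm_diff_powr_le:
  fixes a b :: "'a::real_normed_vector"
  assumes "0 \<le> p"
  shows "norm (a - b) powr p \<le> 2 powr p * (norm a powr p + norm b powr p)"
  using norm_add_powr_le[OF assms, of a "-b"] by simp

text \<open>The Taylor series at 0 has radius of convergence above 1, hence converges uniformly on
  the closed unit disc.\<close>

lemma holomorphic_approx_poly:
  assumes "f holomorphic_on ball 0 R" "1 < R" "0 < e"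
  obtains q :: "complex poly" where "\<And>z. z \<in> cball 0 1 \<Longrightarrow> norm (f z - poly q z) < e"
proof -
  define a where "a n = (deriv ^^ n) f 0 / fact n" for n
  have sums: "(\<lambda>n. a n * z ^ n) sums f z" if "z \<in> ball 0 R" for z
    using holomorphic_power_series[OF assms(1) that] by (simp add: a_def)
  obtain r where r: "1 < r" "r < R" using \<open>1 < R\<close> dense by blast
  have "ereal r \<le> conv_radius a"
    using sums[of "of_real r"] r conv_radius_geI[of a "of_real r"] by (auto simp: sums_iff)
  then have "ereal 1 < conv_radius a" using r by (metis ereal_less(3) less_ereal.simps(1) one_ereal_def order_less_le_trans)
  from powser_uniform_limit[OF this, of 0]
  have "uniform_limit (cball 0 1) (\<lambda>n x. \<Sum>i<n. a i * x ^ i) (\<lambda>x. \<Sum>i. a i * x ^ i) sequentially" by simp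
  then have "\<forall>\<^sub>F n in sequentially. \<forall>x\<in>cball 0 1. dist (\<Sum>i<n. a i * x ^ i) (\<Sum>i. a i * x ^ i) < e"
    using \<open>0 < e\<close> by (rule uniform_limitD)
  then obtain n where n: "\<And>x. x \<in> cball 0 1 \<Longrightarrow> dist (\<Sum>i<n. a i * x ^ i) (\<Sum>i. a i * x ^ i) < e"
    using eventually_happens'[OF sequentially_bot] by blast
  show ?thesis
  proof (rule that[of "\<Sum>i<n. monom (a i) i"])
    fix z :: complex assume z: "z \<in> cball 0 1"
    have "(\<Sum>i. a i * z ^ i) = f z" using sums[of z] z \<open>1 < R\<close> by (auto simp: sums_iff)
    then show "norm (f z - poly (\<Sum>i<n. monom (a i) i) z) < e"
      using n[OF z] by (simp add: poly_sum poly_monom dist_norm norm_minus_commute)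
  qed
qed

lemma emeasure_unit_disc_finite: "emeasure lborel (ball 0 1 :: complex set) < \<infinity>"
  using emeasure_bounded_finite[of "ball 0 1 :: complex set"] by simp

lemma poly_bounded_on_disc:
  fixes q :: "complex poly"
  obtains B where "\<And>z. z \<in> cball 0 1 \<Longrightarrow> norm (poly q z) \<le> B" "0 < B"
proof -
  have "bounded (poly q ` cball 0 1)"
    by (intro compact_imp_bounded compact_continuous_image continuous_intros) auto
  then obtain b where "b > 0" "\<forall>x\<in>poly q ` cball 0 1. norm x \<le> b" unfolding bounded_pos by blast
  then show ?thesis using that[of b] by blast
qed

text \<open>The bound 1 on the weight lets a supremum bound control the weighted norm, and
  continuity gives measurability. The arc does not enter until the weight is instantiated.\<close>

locale disc_weight =
  fixes w :: "complex \<Rightarrow> real" and p :: real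
  assumes w_cont: "continuous_on (ball 0 1) w"
    and w_pos: "\<And>z. z \<in> ball 0 1 \<Longrightarrow> 0 < w z"
    and w_le_1: "\<And>z. z \<in> ball 0 1 \<Longrightarrow> w z \<le> 1"
    and p_ge_1: "1 \<le> p"
begin

text \<open>The p-th power of the norm, kept in the extended nonnegative reals, so that
  approximation needs neither roots nor separate proofs of finiteness.\<close>

definition N :: "(complex \<Rightarrow> complex) \<Rightarrow> ennreal" where
  "N f = (\<integral>\<^sup>+z\<in>ball 0 1. ennreal (norm (f z) powr p * w z) \<partial>lborel)"

lemma measurable_N:
  assumes "continuous_on (ball 0 1) f"
  shows "(\<lambda>z. ennreal (norm (f z) powr p * w z) * indicator (ball 0 1) z) \<in> borel_measurable borel"
  using p_ge_1
  by (intro borel_measurable_ennreal_indicator continuous_on_mult continuous_on_powr' continuous_on_norm assms w_cont) auto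

lemma N_mono:
  assumes "\<And>z. z \<in> ball 0 1 \<Longrightarrow> norm (f z) \<le> norm (g z)"
  shows "N f \<le> N g"
  unfolding N_def
proof (rule nn_integral_mono)
  fix z
  show "ennreal (norm (f z) powr p * w z) * indicator (ball 0 1) z
      \<le> ennreal (norm (g z) powr p * w z) * indicator (ball 0 1) z"
    using assms[of z] w_pos[of z] p_ge_1
    by (cases "z \<in> ball 0 1") (auto intro!: ennreal_leI mult_right_mono powr_mono2)
qed

lemma N_cong: "(\<And>z. z \<in> ball 0 1 \<Longrightarrow> norm (f z) = norm (g z)) \<Longrightarrow> N f = N g"
  by (intro antisym N_mono) auto

lemma N_mult_le:
  assumes "continuous_on (ball 0 1) f" "\<And>z. z \<in> ball 0 1 \<Longrightarrow> norm (g z) \<le> B"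
  shows "N (\<lambda>z. g z * f z) \<le> ennreal (B powr p) * N f"
proof -
  have "N (\<lambda>z. g z * f z) \<le> (\<integral>\<^sup>+z. ennreal (B powr p) * (ennreal (norm (f z) powr p * w z) * indicator (ball 0 1) z) \<partial>lborel)"
    unfolding N_def
  proof (rule nn_integral_mono)
    fix z :: complex
    show "ennreal (norm (g z * f z) powr p * w z) * indicator (ball 0 1) z
      \<le> ennreal (B powr p) * (ennreal (norm (f z) powr p * w z) * indicator (ball 0 1) z)"
    proof (cases "z \<in> ball 0 1")
      case True
      have "norm (g z * f z) powr p * w z \<le> B powr p * (norm (f z) powr p * w z)"
      proof -
        have "norm (g z) powr p \<le> B powr p" using assms(2)[OF True] p_ge_1 by (intro powr_mono2) auto
        then show ?thesis using w_pos[OF True]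
          by (simp add: norm_mult powr_mult mult.assoc mult_right_mono)
      qed
      then show ?thesis using True by (simp add: ennreal_leI flip: ennreal_mult')
    qed auto
  qed
  also have "\<dots> = ennreal (B powr p) * N f"
    unfolding N_def using measurable_N[OF assms(1)] by (intro nn_integral_cmult) simp
  finally show ?thesis .
qed

lemma N_bounded_le:
  assumes "\<And>z. z \<in> ball 0 1 \<Longrightarrow> norm (f z) \<le> B"
  shows "N f \<le> ennreal (B powr p) * emeasure lborel (ball 0 1 :: complex set)"
proof -
  have "N f \<le> (\<integral>\<^sup>+z. ennreal (B powr p) * indicator (ball 0 1 :: complex set) z \<partial>lborel)"
    unfolding N_def
  proof (rule nn_integral_mono)
    fix z :: complex
    have "norm (f z) powr p * w z \<le> B powr p * 1" if "z \<in> ball 0 1"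
      using assms[OF that] p_ge_1 w_pos[OF that] w_le_1[OF that] by (intro mult_mono powr_mono2) auto
    then show "ennreal (norm (f z) powr p * w z) * indicator (ball 0 1) z \<le> ennreal (B powr p) * indicator (ball 0 1) z"
      by (auto simp: indicator_def intro: ennreal_leI)
  qed
  also have "\<dots> = ennreal (B powr p) * emeasure lborel (ball 0 1 :: complex set)"
    by (rule nn_integral_cmult_indicator) simp
  finally show ?thesis .
qed

lemma N_bounded_finite:
  assumes "\<And>z. z \<in> ball 0 1 \<Longrightarrow> norm (f z) \<le> B"
  shows "N f < \<infinity>"
proof -
  have "N f \<le> ennreal (B powr p) * emeasure lborel (ball 0 1 :: complex set)"
    by (rule N_bounded_le) (rule assms)
  also have "\<dots> < \<infinity>" using emeasure_unit_disc_finite by (simp add: ennreal_mult_less_top)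
  finally show ?thesis .
qed

lemma N_triangle:
  assumes f: "continuous_on (ball 0 1) f" and g: "continuous_on (ball 0 1) g"
  shows "N (\<lambda>z. f z + g z) \<le> ennreal (2 powr p) * (N f + N g)"
proof -
  note mf = measurable_N[OF f] and mg = measurable_N[OF g]
  have "N (\<lambda>z. f z + g z) \<le> (\<integral>\<^sup>+z. ennreal (2 powr p) * (ennreal (norm (f z) powr p * w z) * indicator (ball 0 1) z 
        + ennreal (norm (g z) powr p * w z) * indicator (ball 0 1) z) \<partial>lborel)"
    unfolding N_def
  proof (rule nn_integral_mono)
    fix z :: complex
    show "ennreal (norm (f z + g z) powr p * w z) * indicator (ball 0 1) z
      \<le> ennreal (2 powr p) * (ennreal (norm (f z) powr p * w z) * indicator (ball 0 1) z 
        + ennreal (norm (g z) powr p * w z) * indicator (ball 0 1) z)"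
    proof (cases "z \<in> ball 0 1")
      case True
      have "norm (f z + g z) powr p * w z \<le> 2 powr p * (norm (f z) powr p + norm (g z) powr p) * w z"
        using w_pos[OF True] p_ge_1 by (intro mult_right_mono norm_add_powr_le) auto
      then have "ennreal (norm (f z + g z) powr p * w z) \<le> ennreal (2 powr p * (norm (f z) powr p * w z + norm (g z) powr p * w z))"
        by (intro ennreal_leI) (simp add: algebra_simps)
      also have "\<dots> = ennreal (2 powr p) * (ennreal (norm (f z) powr p * w z) + ennreal (norm (g z) powr p * w z))"
        using w_pos[OF True] by (subst ennreal_mult') (auto simp: ennreal_plus)
      finally show ?thesis using True by simp
    qed auto
  qed
  also have "\<dots> = ennreal (2 powr p) * (N f + N g)"
    unfolding N_def using mf mg by (simp add: nn_integral_cmult nn_integral_add)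
  finally show ?thesis .
qed

text \<open>The bound \<open>C\<close> passes to the limit \<open>g\<close>, so that
  \<open>2 powr p * (C + C)\<close> is a constant majorant of the differences, integrable because
  the disc has finite area.\<close>

lemma N_dominated_convergence:
  assumes f: "\<And>n. continuous_on (ball 0 1) (f n)" and g: "continuous_on (ball 0 1) g"
    and lim: "\<And>z. z \<in> ball 0 1 \<Longrightarrow> (\<lambda>n. f n z) \<longlonglongrightarrow> g z"
    and bd: "\<And>n z. z \<in> ball 0 1 \<Longrightarrow> norm (f n z) powr p * w z \<le> C"
  shows "(\<lambda>n. N (\<lambda>z. f n z - g z)) \<longlonglongrightarrow> 0"
proof -
  have powr_lim: "(\<lambda>n. norm (h n) powr p) \<longlonglongrightarrow> norm l powr p" if "h \<longlonglongrightarrow> l" for h :: "nat \<Rightarrow> complex" and l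
    using p_ge_1 by (intro tendsto_powr' tendsto_norm that tendsto_const) auto
  have bdg: "norm (g z) powr p * w z \<le> C" if z: "z \<in> ball 0 1" for z
    by (rule LIMSEQ_le_const2[OF tendsto_mult_right[OF powr_lim[OF lim[OF z]]]]) (use bd[OF z] in auto)
  have "(\<lambda>n. N (\<lambda>z. f n z - g z)) \<longlonglongrightarrow> (\<integral>\<^sup>+z. 0 \<partial>(lborel :: complex measure))"
    unfolding N_def
  proof (rule nn_integral_dominated_convergence[where w = "\<lambda>z. ennreal (2 powr p * (C + C)) * indicator (ball 0 1) z"])
    show "(\<lambda>z. ennreal (norm (f n z - g z) powr p * w z) * indicator (ball 0 1) z) \<in> borel_measurable lborel" for n
      using measurable_N[of "\<lambda>z. f n z - g z"] f g by (simp add: continuous_on_diff)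
    have "(\<integral>\<^sup>+z. ennreal (2 powr p * (C + C)) * indicator (ball 0 1 :: complex set) z \<partial>lborel) = ennreal (2 powr p * (C + C)) * emeasure lborel (ball 0 1 :: complex set)"
      by (rule nn_integral_cmult_indicator) simp
    then show "(\<integral>\<^sup>+z. ennreal (2 powr p * (C + C)) * indicator (ball 0 1 :: complex set) z \<partial>lborel) < \<infinity>"
      using emeasure_unit_disc_finite by (simp add: ennreal_mult_less_top)
    show "AE z in lborel. ennreal (norm (f n z - g z) powr p * w z) * indicator (ball 0 1) z
        \<le> ennreal (2 powr p * (C + C)) * indicator (ball 0 1) z" for n
    proof (rule AE_I2)
      fix z
      show "ennreal (norm (f n z - g z) powr p * w z) * indicator (ball 0 1) z
        \<le> ennreal (2 powr p * (C + C)) * indicator (ball 0 1) z"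
      proof (cases "z \<in> ball 0 1")
        case True
        have "norm (f n z - g z) powr p * w z \<le> 2 powr p * (norm (f n z) powr p + norm (g z) powr p) * w z"
          using w_pos[OF True] p_ge_1 by (intro mult_right_mono norm_diff_powr_le) auto
        also have "\<dots> = 2 powr p * (norm (f n z) powr p * w z + norm (g z) powr p * w z)" by (simp add: algebra_simps)
        also have "\<dots> \<le> 2 powr p * (C + C)" using bd[OF True] bdg[OF True] by (intro mult_left_mono add_mono) auto
        finally show ?thesis using True by (simp add: ennreal_leI)
      qed auto
    qed
    show "AE z in lborel. (\<lambda>n. ennreal (norm (f n z - g z) powr p * w z) * indicator (ball 0 1) z) \<longlonglongrightarrow> 0"
    proof (rule AE_I2)
      fix z
      show "(\<lambda>n. ennreal (norm (f n z - g z) powr p * w z) * indicator (ball 0 1) z) \<longlonglongrightarrow> 0"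
      proof (cases "z \<in> ball 0 1")
        case True
        have "(\<lambda>n. f n z - g z) \<longlonglongrightarrow> 0" using lim[OF True] by (simp add: LIM_zero)
        from tendsto_mult_right[OF powr_lim[OF this], of "w z"]
        have "(\<lambda>n. norm (f n z - g z) powr p * w z) \<longlonglongrightarrow> 0" using p_ge_1 by simp
        then have "(\<lambda>n. ennreal (norm (f n z - g z) powr p * w z)) \<longlonglongrightarrow> ennreal 0" by (rule tendsto_ennrealI)
        then show ?thesis using True by simp
      qed auto
    qed
  next
    show "(\<lambda>z. ennreal (2 powr p * (C + C)) * indicator (ball 0 1 :: complex set) z) \<in> borel_measurable lborel"
      by (intro borel_measurable_times_ennreal borel_measurable_indicator borel_measurable_const) simp
  qed (rule borel_measurable_const)
  then show ?thesis by simp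
qed

text \<open>The closure of the polynomial multiples of \<open>F\<close>, taken among continuous
  functions and with \<open>N\<close> in place of the norm. Holomorphy and finite norm are not part
  of it; they come back with membership in \<open>B_space\<close>.\<close>

definition cyc_hull :: "(complex \<Rightarrow> complex) \<Rightarrow> (complex \<Rightarrow> complex) set" where
  "cyc_hull F = {g. continuous_on (ball 0 1) g \<and>
     (\<forall>e>0. \<exists>q :: complex poly. N (\<lambda>z. g z - poly q z * F z) < ennreal e)}"

lemma cyc_hull_closed:
  assumes F: "continuous_on (ball 0 1) F" and f: "\<And>n. f n \<in> cyc_hull F" and g: "continuous_on (ball 0 1) g"
    and lim: "(\<lambda>n. N (\<lambda>z. f n z - g z)) \<longlonglongrightarrow> 0"
  shows "g \<in> cyc_hull F"
proof -
  have "\<exists>q :: complex poly. N (\<lambda>z. g z - poly q z * F z) < ennreal e" if "e > 0" for e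
  proof -
    \<comment> \<open>The factor 3 keeps the final estimate strict: the two errors add up to 2/3 of
      \<open>e\<close>.\<close>
    define d where "d = e / (2 powr p * 3)"
    have d: "d > 0" using that by (simp add: d_def)
    then have "eventually (\<lambda>n. N (\<lambda>z. f n z - g z) < ennreal d) sequentially"
      using lim by (intro order_tendstoD) auto
    then obtain n where n: "N (\<lambda>z. f n z - g z) < ennreal d" by (auto simp: eventually_sequentially)
    obtain q :: "complex poly" where q: "N (\<lambda>z. f n z - poly q z * F z) < ennreal d" 
      using f[of n] d by (auto simp: cyc_hull_def)
    have cf: "continuous_on (ball 0 1) (f n)" using f by (auto simp: cyc_hull_def)
    have "N (\<lambda>z. g z - poly q z * F z) = N (\<lambda>z. (g z - f n z) + (f n z - poly q z * F z))" by simp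
    also have "\<dots> \<le> ennreal (2 powr p) * (N (\<lambda>z. g z - f n z) + N (\<lambda>z. f n z - poly q z * F z))"
      by (intro N_triangle continuous_intros g cf F)
    also have "N (\<lambda>z. g z - f n z) = N (\<lambda>z. f n z - g z)" by (rule N_cong) (simp add: norm_minus_commute)
    also have "ennreal (2 powr p) * (\<dots> + N (\<lambda>z. f n z - poly q z * F z)) \<le> ennreal (2 powr p) * (ennreal d + ennreal d)"
      using n q by (intro mult_left_mono add_mono) auto
    also have "\<dots> = ennreal (2 powr p * (d + d))" using d by (subst ennreal_mult') (simp_all only: ennreal_plus powr_ge_zero order_less_imp_le)
    also have "\<dots> < ennreal e" using that by (intro ennreal_lessI) (auto simp: d_def field_simps)
    finally show ?thesis by blast
  qed
  then show ?thesis using g by (auto simp: cyc_hull_def)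
qed

text \<open>Uniform polynomial approximation of \<open>G\<close> on the closed disc suffices, since
  |F| and the weight are at most 1.\<close>

lemma mult_in_cyc_hull_of_holomorphic_larger:
  assumes F: "continuous_on (ball 0 1) F" "\<And>z. z \<in> ball 0 1 \<Longrightarrow> norm (F z) \<le> 1"
    and G: "G holomorphic_on ball 0 R" "R > 1"
  shows "(\<lambda>z. G z * F z) \<in> cyc_hull F"
proof -
  let ?A = "emeasure lborel (ball 0 1 :: complex set)"
  have cG: "continuous_on (ball 0 1) G"
    using holomorphic_on_imp_continuous_on[OF G(1)] by (rule continuous_on_subset) (use G(2) in auto)
  have "\<exists>q :: complex poly. N (\<lambda>z. G z * F z - poly q z * F z) < ennreal e" if "e > 0" for e
  proof -
    define a where "a = measure lborel (ball 0 1 :: complex set)"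
    have a: "?A = ennreal a" unfolding a_def using emeasure_unit_disc_finite
      by (intro emeasure_eq_ennreal_measure) auto
    \<comment> \<open>Makes \<open>d powr p\<close> times the area \<open>a\<close> smaller than
      \<open>e\<close>; with \<open>a + 1\<close> in the denominator the area need not be computed
      or shown to be positive.\<close>
    define d where "d = (e / (2 * (a + 1))) powr (1 / p)"
    have a0: "a \<ge> 0" by (simp add: a_def)
    have d: "d > 0" "d powr p = e / (2 * (a + 1))" using that a0 p_ge_1 by (simp_all add: d_def powr_powr)
    obtain q :: "complex poly" where q: "\<And>z. z \<in> cball 0 1 \<Longrightarrow> norm (G z - poly q z) < d"
      using holomorphic_approx_poly[OF G d(1)] by blast
    have "N (\<lambda>z. G z * F z - poly q z * F z) \<le> ennreal (d powr p) * ?A"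
    proof (rule N_bounded_le)
      fix z :: complex assume z: "z \<in> ball 0 1"
      have "norm (G z * F z - poly q z * F z) = norm (G z - poly q z) * norm (F z)"
        by (simp flip: norm_mult add: algebra_simps)
      also have "\<dots> \<le> d * 1" using q[of z] F(2)[OF z] z d by (intro mult_mono) auto
      finally show "norm (G z * F z - poly q z * F z) \<le> d" by simp
    qed
    also have "\<dots> = ennreal (e / (2 * (a + 1)) * a)" unfolding a d(2) using a0 by (intro ennreal_mult''[symmetric]) auto
    also have "\<dots> < ennreal e"
    proof (rule ennreal_lessI)
      have "e * a < e * (2 * (a + 1))" using that a0 by (intro mult_strict_left_mono) auto
      then show "e / (2 * (a + 1)) * a < e" using a0 by (simp add: field_simps)
    qed (use that in auto)
    finally show ?thesis by blast
  qed
  then show ?thesis using cG F(1) by (auto simp: cyc_hull_def intro!: continuous_intros)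
qed

text \<open>The dilations of \<open>G\<close> extend across the circle, keep the bound
  \<open>B\<close>, and tend to \<open>G\<close>, so dominated convergence applies.\<close>

lemma bounded_mult_in_cyc_hull:
  assumes F: "continuous_on (ball 0 1) F" "\<And>z. z \<in> ball 0 1 \<Longrightarrow> norm (F z) \<le> 1"
    and G: "G holomorphic_on ball 0 1" "\<And>z. z \<in> ball 0 1 \<Longrightarrow> norm (G z) \<le> B"
  shows "(\<lambda>z. G z * F z) \<in> cyc_hull F"
proof (rule cyc_hull_closed[OF F(1), where f = "\<lambda>n z. G (of_real (1 - 1 / (real n + 2)) * z) * F z"])
  define r where "r n = 1 - 1 / (real n + 2)" for n
  have r: "0 < r n" "r n < 1" for n by (auto simp: r_def field_simps)
  have in_ball: "of_real (r n) * z \<in> ball 0 1" if "z \<in> ball 0 (1 / r n)" for n and z :: complex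
    using that r[of n] by (simp add: norm_mult field_simps)
  have hol: "(\<lambda>z. G (of_real (r n) * z)) holomorphic_on ball 0 (1 / r n)" for n
  proof -
    have "(\<lambda>z. of_real (r n) * z) ` ball 0 (1 / r n) \<subseteq> ball (0::complex) 1" using in_ball[of _ n] by blast
    with holomorphic_on_compose_gen[of "\<lambda>z. of_real (r n) * z" "ball 0 (1 / r n)" G "ball 0 1"] G(1)
    show ?thesis by (simp add: o_def holomorphic_intros)
  qed
  have gt: "1 < 1 / r n" for n using r[of n] by (simp add: field_simps)
  have in_ball': "of_real (r n) * z \<in> ball 0 1" if "z \<in> ball 0 1" for n and z :: complex
    using in_ball[of z n] gt[of n] that by auto
  show "(\<lambda>z. G (of_real (1 - 1 / (real n + 2)) * z) * F z) \<in> cyc_hull F" for n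
    using mult_in_cyc_hull_of_holomorphic_larger[OF F hol gt] by (simp add: r_def)
  have cG: "continuous_on (ball 0 1) G" using G(1) holomorphic_on_imp_continuous_on by blast
  then show "continuous_on (ball 0 1) (\<lambda>z. G z * F z)" by (intro continuous_intros F)
  show "(\<lambda>n. N (\<lambda>z. G (of_real (1 - 1 / (real n + 2)) * z) * F z - G z * F z)) \<longlonglongrightarrow> 0"
    unfolding r_def[symmetric]
  proof (rule N_dominated_convergence[where C = "B powr p"])
    show "continuous_on (ball 0 1) (\<lambda>z. G (of_real (r n) * z) * F z)" for n
    proof -
      have "ball 0 1 \<subseteq> ball (0::complex) (1 / r n)" using gt[of n] by (intro subset_ball) simp
      from continuous_on_subset[OF holomorphic_on_imp_continuous_on[OF hol[of n]] this]
      show ?thesis by (intro continuous_on_mult F)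
    qed
    show "continuous_on (ball 0 1) (\<lambda>z. G z * F z)" by (intro continuous_intros F cG)
    show "(\<lambda>n. G (of_real (r n) * z) * F z) \<longlonglongrightarrow> G z * F z" if "z \<in> ball 0 1" for z
    proof -
      have "isCont G z" using cG that by (simp add: continuous_on_eq_continuous_at)
      moreover have "(\<lambda>n. of_real (r n) * z) \<longlonglongrightarrow> of_real 1 * z"
        unfolding r_def by (intro tendsto_intros) real_asymp
      ultimately show ?thesis using isCont_tendsto_compose[of z G] by (intro tendsto_intros) auto
    qed
    fix n and z :: complex assume z: "z \<in> ball 0 1"
    have "norm (G (of_real (r n) * z) * F z) \<le> B * 1"
      unfolding norm_mult using G(2)[OF in_ball'[OF z]] F(2)[OF z] order_trans[OF norm_ge_zero G(2)[OF z]]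
      by (intro mult_mono) auto
    then have "norm (G (of_real (r n) * z) * F z) powr p \<le> B powr p" using p_ge_1 by (intro powr_mono2) auto
    then have "norm (G (of_real (r n) * z) * F z) powr p * w z \<le> B powr p * 1"
      using w_pos[OF z] w_le_1[OF z] by (intro mult_mono) auto
    then show "norm (G (of_real (r n) * z) * F z) powr p * w z \<le> B powr p" by simp
  qed
qed

text \<open>Multiplying an approximation of 1 by \<open>q\<close> costs only the factor
  \<open>B powr p\<close>, because \<open>q\<close> is bounded on the disc.\<close>

lemma poly_in_cyc_hull:
  assumes F: "continuous_on (ball 0 1) F" and one: "(\<lambda>_. 1) \<in> cyc_hull F"
  shows "poly q \<in> cyc_hull F"
proof -
  obtain B where B: "\<And>z. z \<in> cball 0 1 \<Longrightarrow> norm (poly q z) \<le> B" "B > 0"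
    using poly_bounded_on_disc[of q] by blast
  have "\<exists>r :: complex poly. N (\<lambda>z. poly q z - poly r z * F z) < ennreal e" if "e > 0" for e
  proof -
    have "e / B powr p > 0" using that B(2) by simp
    then obtain r :: "complex poly" where r: "N (\<lambda>z. 1 - poly r z * F z) < ennreal (e / B powr p)"
      using one unfolding cyc_hull_def by blast
    have "N (\<lambda>z. poly q z - poly (q * r) z * F z) = N (\<lambda>z. poly q z * (1 - poly r z * F z))"
      by (rule N_cong) (simp add: algebra_simps)
    also have "\<dots> \<le> ennreal (B powr p) * N (\<lambda>z. 1 - poly r z * F z)"
      using B(1) by (intro N_mult_le continuous_intros F) auto
    also have "\<dots> < ennreal (B powr p) * ennreal (e / B powr p)"
      using r B(2) by (intro ennreal_mult_strict_left_mono) auto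
    also have "\<dots> = ennreal e" using B(2) by (simp flip: ennreal_mult')
    finally show ?thesis by blast
  qed
  then show ?thesis by (auto simp: cyc_hull_def intro!: continuous_intros)
qed

end

section \<open>Contractions away from an arc\<close>

lemma infdist_unit_circle_ge:
  assumes "E \<subseteq> sphere (0::complex) 1" "E \<noteq> {}"
  shows "1 - norm z \<le> infdist z E"
proof -
  have "1 - norm z \<le> dist z \<zeta>" if "\<zeta> \<in> E" for \<zeta>
    using that assms norm_triangle_ineq2[of \<zeta> z] by (auto simp: dist_norm norm_minus_commute)
  then show ?thesis using assms by (auto simp: infdist_def intro!: cINF_greatest)
qed

text \<open>The two sign conditions say that a nonzero \<open>w\<close> has its argument between h
  and pi. The distance to \<open>cis t\<close> shrinks as the cosine of the angle between them
  grows, and over the arc that angle is smallest at the end point \<open>cis h\<close>.\<close>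

lemma infdist_symmetric_arc_outside:
  assumes h: "0 < h" "h < pi" and "0 \<le> Im w" "0 \<le> Im (w * cis (-h))"
  shows "infdist w (cis ` {-h..h}) = norm (w - cis h)"
proof (rule antisym)
  show "infdist w (cis ` {-h..h}) \<le> norm (w - cis h)"
    using h by (auto simp flip: dist_norm intro!: infdist_le)
  have "norm (w - cis h) \<le> dist w (cis \<theta>)" if \<theta>: "\<theta> \<in> {-h..h}" for \<theta>
  proof (cases "w = 0")
    case False
    define \<psi> where "\<psi> = Arg w"
    have w: "w = of_real (norm w) * cis \<psi>" using rcis_cmod_Arg[of w] by (simp add: rcis_def \<psi>_def)
    have \<psi>: "0 \<le> \<psi>" "\<psi> \<le> pi" using assms(3) Arg_bounded[of w] Arg_less_0[of w] by (auto simp: \<psi>_def)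
    have "w * cis (-h) = of_real (norm w) * cis (\<psi> - h)" by (subst w) (simp add: cis_mult mult.assoc)
    then have "0 \<le> norm w * sin (\<psi> - h)" using assms(4) by simp
    then have "0 \<le> sin (\<psi> - h)" using False by (simp add: zero_le_mult_iff)
    have "h \<le> \<psi>"
    proof (rule ccontr)
      assume "\<not> h \<le> \<psi>"
      then have "sin (h - \<psi>) > 0" using \<psi> h by (intro sin_gt_zero) auto
      moreover have "sin (h - \<psi>) = - sin (\<psi> - h)" using sin_minus[of "\<psi> - h"] by simp
      ultimately show False using \<open>0 \<le> sin (\<psi> - h)\<close> by auto
    qed
    have "cos (\<psi> - \<theta>) \<le> cos (\<psi> - h)"
    proof (cases "\<psi> - \<theta> \<le> pi")
      case True
      then show ?thesis using \<open>h \<le> \<psi>\<close> \<theta> by (intro cos_monotone_0_pi_le) auto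
    next
      \<comment> \<open>The angle is measured the short way round; it is still at least
        \<open>\<psi> - h\<close>, because \<open>\<psi> \<le> pi\<close> and
        \<open>-h \<le> \<theta>\<close>.\<close>
      case False
      have "cos (\<psi> - \<theta>) = cos (2 * pi - (\<psi> - \<theta>))" by (simp add: cos_diff)
      also have "\<dots> \<le> cos (\<psi> - h)"
        using \<open>h \<le> \<psi>\<close> \<theta> \<psi> False by (intro cos_monotone_0_pi_le) auto
      finally show ?thesis .
    qed
    have sq: "(norm (w - cis t))\<^sup>2 = (norm w)\<^sup>2 + 1 - 2 * norm w * cos (\<psi> - t)" for t
    proof -
      have "(norm (w - cis t))\<^sup>2 = (norm w * cos \<psi> - cos t)\<^sup>2 + (norm w * sin \<psi> - sin t)\<^sup>2"
        by (subst w) (simp add: cmod_power2)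
      also have "\<dots> = (norm w)\<^sup>2 * ((cos \<psi>)\<^sup>2 + (sin \<psi>)\<^sup>2) + ((cos t)\<^sup>2 + (sin t)\<^sup>2) - 2 * norm w * cos (\<psi> - t)"
        unfolding cos_diff by algebra
      finally show ?thesis by simp
    qed
    have "(norm (w - cis h))\<^sup>2 \<le> (norm (w - cis \<theta>))\<^sup>2"
      unfolding sq using \<open>cos (\<psi> - \<theta>) \<le> cos (\<psi> - h)\<close> by (simp add: mult_left_mono)
    then show ?thesis by (simp add: dist_norm power2_le_iff_abs_le)
  qed (simp add: dist_norm)
  then show "norm (w - cis h) \<le> infdist w (cis ` {-h..h})"
    using h by (auto simp: infdist_def intro!: cINF_greatest)
qed

text \<open>Two regimes. In the sector over the arc the distance is 1 - |z|, and moving towards a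
  point of modulus 1/2 cannot raise the modulus while |z| is at least 1/2. Outside the sector the
  nearest point is the end point \<open>cis h\<close>, and the motion does not lead towards it. The
  bound sin h / 2 in \<open>d\<close> serves the second regime, which does not occur for the full
  circle, where sin h = 0.\<close>

lemma symmetric_arc_contraction_upper:
  fixes h s :: real and z :: complex
  defines "E \<equiv> cis ` {-h..h}" and "d \<equiv> if sin h > 0 then min (1/2) (sin h / 2) else 1/2"
  assumes h: "0 < h" "h \<le> pi" and z: "z \<in> ball 0 1" "0 \<le> Im z" "infdist z E \<le> d" and s: "s \<in> {0..1}"
  shows "infdist z E \<le> infdist (of_real (1 - s) * z + of_real s * (- 1/2)) E"
proof -
  define w where "w = of_real (1 - s) * z + of_real s * (- 1/2)"
  have E: "E \<subseteq> sphere 0 1" "E \<noteq> {}" "compact E" using h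
    by (auto simp: E_def cis_conv_exp intro!: compact_continuous_image continuous_intros)
  define \<phi> where "\<phi> = Arg z"
  have zeq: "z = of_real (norm z) * cis \<phi>" using rcis_cmod_Arg[of z] by (simp add: rcis_def \<phi>_def)
  have \<phi>: "0 \<le> \<phi>" "\<phi> \<le> pi" using z(2) Arg_bounded[of z] Arg_less_0[of z] by (auto simp: \<phi>_def)
  show ?thesis
  proof (cases "\<phi> \<le> h")
    case True
    have "1 - norm z \<le> infdist z E" by (rule infdist_unit_circle_ge[OF E(1,2)])
    moreover have "d \<le> 1/2" by (simp add: d_def)
    ultimately have "1/2 \<le> norm z" using z(3) by linarith
    have "infdist z E \<le> dist z (cis \<phi>)" using True \<phi> by (intro infdist_le) (auto simp: E_def)
    also have "\<dots> = norm (of_real (norm z - 1) * cis \<phi>)" 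
      by (subst zeq) (simp add: dist_norm algebra_simps)
    also have "\<dots> = 1 - norm z" using z(1) by (simp only: norm_mult norm_cis norm_of_real) simp
    also have "\<dots> \<le> 1 - norm w"
    proof -
      have "norm w \<le> (1 - s) * norm z + s * (1/2)"
        unfolding w_def using s by (intro order_trans[OF norm_triangle_ineq]) (simp add: norm_mult del: of_real_diff)
      also have "\<dots> \<le> (1 - s) * norm z + s * norm z"
        using s \<open>1/2 \<le> norm z\<close> by (intro add_left_mono mult_left_mono) auto
      finally show ?thesis by (simp add: algebra_simps)
    qed
    also have "\<dots> \<le> infdist w E" by (rule infdist_unit_circle_ge[OF E(1,2)])
    finally show ?thesis by (simp add: w_def)
  next
    case False
    then have h': "0 < h" "h < pi" using h \<phi> by auto
    then have sin: "sin h > 0" by (intro sin_gt_zero)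
    define \<omega> where "\<omega> = z * cis (-h)"
    define x where "x = Re \<omega>"
    define y where "y = Im \<omega>"
    have "\<omega> = of_real (norm z) * cis (\<phi> - h)" unfolding \<omega>_def by (subst zeq) (simp add: cis_mult mult.assoc)
    then have "y = norm z * sin (\<phi> - h)" by (simp add: y_def)
    then have y0: "0 \<le> y" using False \<phi> h by (auto intro!: mult_nonneg_nonneg sin_ge_zero)
    have iz: "infdist z E = norm (z - cis h)"
      unfolding E_def using h' z(2) y0 by (intro infdist_symmetric_arc_outside) (auto simp: y_def \<omega>_def)
    have Imw: "0 \<le> Im w" using z(2) s by (simp add: w_def)
    have "w * cis (-h) = of_real (1 - s) * \<omega> + of_real s * (- cis (-h) / 2)"
      by (simp add: w_def \<omega>_def algebra_simps)
    then have "Im (w * cis (-h)) = (1 - s) * y + s * (sin h / 2)" by (simp add: y_def)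
    then have "0 \<le> Im (w * cis (-h))" using y0 s sin by simp
    then have iw: "infdist w E = norm (w - cis h)"
      unfolding E_def using h' Imw by (intro infdist_symmetric_arc_outside) auto
    have rot: "norm (v - cis h) = norm (v * cis (-h) - 1)" for v
    proof -
      have "v * cis (-h) - 1 = (v - cis h) * cis (-h)" by (simp add: algebra_simps cis_mult)
      then show ?thesis by (simp only: norm_mult norm_cis mult_1_right)
    qed
    have n1: "norm (\<omega> - 1) \<le> 1/2" "norm (\<omega> - 1) \<le> sin h / 2"
    proof -
      have "d \<le> 1/2" "d \<le> sin h / 2" using sin by (simp_all add: d_def)
      then show "norm (\<omega> - 1) \<le> 1/2" "norm (\<omega> - 1) \<le> sin h / 2"
        using z(3) iz rot[of z] unfolding \<omega>_def by linarith+
    qed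
    have "norm \<omega> < 1" using z(1) by (simp add: \<omega>_def norm_mult)
    then have x1: "x \<le> 1" using complex_Re_le_cmod[of \<omega>] by (simp add: x_def)
    have x2: "1/2 \<le> x" using n1(1) abs_Re_le_cmod[of "\<omega> - 1"] by (simp add: x_def)
    have y1: "y \<le> sin h / 2" using n1(2) abs_Im_le_cmod[of "\<omega> - 1"] by (simp add: y_def)
    \<comment> \<open>Inner product of the displacement with the vector from the nearest point to
      \<open>z\<close>, in rotated coordinates where that point is 1 and the centre is (-cos h / 2,
      sin h / 2). A nonnegative value means that the distance cannot decrease along the
      segment.\<close>
    define e where "e = (- cos h / 2 - x) * (x - 1) + (sin h / 2 - y) * y"
    have e: "e \<ge> 0"
    proof -
      have "(x + cos h / 2) * (1 - x) \<ge> 0" 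
      proof (rule mult_nonneg_nonneg)
        have "-1 \<le> cos h" by simp
        then show "x + cos h / 2 \<ge> 0" using x2 by linarith
      qed (use x1 in simp)
      moreover have "(sin h / 2 - y) * y \<ge> 0" using y0 y1 by simp
      moreover have "(- cos h / 2 - x) * (x - 1) = (x + cos h / 2) * (1 - x)" by (simp add: field_simps)
      ultimately show ?thesis by (simp only: e_def add_nonneg_nonneg)
    qed
    define \<nu> where "\<nu> = w * cis (-h)"
    have \<nu>: "Re \<nu> = x + s * (- cos h / 2 - x)" "Im \<nu> = y + s * (sin h / 2 - y)"
      unfolding \<nu>_def \<open>w * cis (-h) = of_real (1 - s) * \<omega> + of_real s * (- cis (-h) / 2)\<close>
      by (simp_all add: x_def y_def algebra_simps)
    have "(norm (\<nu> - 1))\<^sup>2 = (norm (\<omega> - 1))\<^sup>2 + 2 * s * e + s\<^sup>2 * ((- cos h / 2 - x)\<^sup>2 + (sin h / 2 - y)\<^sup>2)"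
    proof -
      have "(x + s * a - 1)\<^sup>2 + (y + s * b)\<^sup>2 = (x - 1)\<^sup>2 + y\<^sup>2 + 2 * s * (a * (x - 1) + b * y) + s\<^sup>2 * (a\<^sup>2 + b\<^sup>2)" for a b
        by algebra
      then show ?thesis unfolding cmod_power2 e_def by (simp add: \<nu> flip: x_def y_def)
    qed
    then have "(norm (\<omega> - 1))\<^sup>2 \<le> (norm (\<nu> - 1))\<^sup>2" using e s by simp
    then have "norm (\<omega> - 1) \<le> norm (\<nu> - 1)" by (simp add: power2_le_iff_abs_le)
    then have "infdist z E \<le> infdist w E" using iz iw rot[of z] rot[of w] by (simp add: \<omega>_def \<nu>_def)
    then show ?thesis by (simp add: w_def)
  qed
qed

lemma infdist_isometry_image:
  assumes "\<And>x y. dist (f x) (f y) = dist x y"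
  shows "infdist (f x) (f ` A) = infdist x A"
  using assms by (simp add: infdist_def image_image)

text \<open>Conjugation preserves the symmetric arc and the centre -1/2, so the lower half of the
  disc reduces to the upper one.\<close>

lemma symmetric_arc_contraction:
  fixes h s :: real and z :: complex
  defines "E \<equiv> cis ` {-h..h}" and "d \<equiv> if sin h > 0 then min (1/2) (sin h / 2) else 1/2"
  assumes h: "0 < h" "h \<le> pi" and z: "z \<in> ball 0 1" "infdist z E \<le> d" and s: "s \<in> {0..1}"
  shows "infdist z E \<le> infdist (of_real (1 - s) * z + of_real s * (- 1/2)) E"
proof (cases "0 \<le> Im z")
  case True
  then show ?thesis using symmetric_arc_contraction_upper[of h z s] assms by simp
next
  case False
  have "cnj ` E = E"
  proof -
    have "cnj ` cis ` {-h..h} = cis ` uminus ` {-h..h}" by (simp only: image_image cis_cnj)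
    also have "uminus ` {-h..h} = {-h..h}" by simp
    finally show ?thesis by (simp only: E_def)
  qed
  moreover have "dist (cnj x) (cnj y) = dist x y" for x y
    by (simp add: dist_norm flip: complex_cnj_diff)
  ultimately have inf: "infdist (cnj x) E = infdist x E" for x
    using infdist_isometry_image[of cnj x E] by simp
  have "infdist (cnj z) E \<le> infdist (of_real (1 - s) * cnj z + of_real s * (- 1/2)) E"
    unfolding E_def by (rule symmetric_arc_contraction_upper) (use assms False inf[of z] in \<open>auto simp: E_def d_def\<close>)
  also have "of_real (1 - s) * cnj z + of_real s * (- 1/2) = cnj (of_real (1 - s) * z + of_real s * (- 1/2))" by simp
  finally show ?thesis by (simp only: inf)
qed

text \<open>The centre \<open>c\<close> is half the antipode of the midpoint of the arc.\<close>

lemma arc_contraction: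
  assumes "nontrivial_closed_arc E"
  obtains c :: complex and d where "norm c \<le> 1/2" "d > 0"
    "\<And>z s. z \<in> ball 0 1 \<Longrightarrow> infdist z E \<le> d \<Longrightarrow> s \<in> {0..1} \<Longrightarrow>
       infdist z E \<le> infdist (of_real (1 - s) * z + of_real s * c) E"
proof -
  obtain a b where ab: "a < b" "b \<le> a + 2 * pi" "E = cis ` {a..b}"
    using assms by (auto simp: nontrivial_closed_arc_def)
  define \<mu> where "\<mu> = (a + b) / 2"
  define h where "h = (b - a) / 2"
  define E0 where "E0 = cis ` {-h..h}"
  define d where "d = (if sin h > 0 then min (1/2) (sin h / 2) else 1/2)"
  have h: "0 < h" "h \<le> pi" using ab by (auto simp: h_def)
  have EE: "E = (\<lambda>z. cis \<mu> * z) ` E0"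
  proof -
    have "- h + \<mu> = a" "h + \<mu> = b" by (simp_all add: \<mu>_def h_def field_simps)
    then have "{a..b} = (\<lambda>t. \<mu> + t) ` {-h..h}" by (simp only: image_add_atLeastAtMost)
    then show ?thesis unfolding ab(3) E0_def by (simp only: image_image cis_mult)
  qed
  have "dist (cis \<mu> * x) (cis \<mu> * y) = dist x y" for x y
    by (simp add: dist_norm norm_mult flip: right_diff_distrib)
  then have inf: "infdist (cis \<mu> * x) E = infdist x E0" for x
    unfolding EE by (intro infdist_isometry_image)
  show ?thesis
  proof (rule that[of "cis \<mu> * (-1/2)" d])
    show "norm (cis \<mu> * (-1/2)) \<le> 1/2" by (simp add: norm_mult)
    show "d > 0" by (simp add: d_def)
    fix z s assume z: "z \<in> ball 0 1" "infdist z E \<le> d" "s \<in> {0..1::real}"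
    define x where "x = cis (-\<mu>) * z"
    have zx: "z = cis \<mu> * x" by (simp add: x_def cis_mult flip: mult.assoc)
    have "infdist x E0 \<le> infdist (of_real (1 - s) * x + of_real s * (- 1/2)) E0"
      unfolding E0_def
    proof (rule symmetric_arc_contraction[OF h])
      show "x \<in> ball 0 1" using z(1) by (simp add: x_def norm_mult)
      have "infdist x E0 = infdist z E" using inf[of x] by (simp only: zx)
      then show "infdist x (cis ` {-h..h}) \<le> (if sin h > 0 then min (1/2) (sin h / 2) else 1/2)"
        using z(2) by (simp only: E0_def d_def)
    qed (rule z(3))
    also have "\<dots> = infdist (cis \<mu> * (of_real (1 - s) * x + of_real s * (- 1/2))) E" by (simp only: inf)
    also have "cis \<mu> * (of_real (1 - s) * x + of_real s * (- 1/2)) = of_real (1 - s) * z + of_real s * (cis \<mu> * (-1/2))"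
      by (simp add: zx algebra_simps)
    finally show "infdist z E \<le> infdist (of_real (1 - s) * z + of_real s * (cis \<mu> * (-1/2))) E"
      using inf[of x] by (simp add: zx)
  qed
qed

section \<open>Density of polynomials\<close>

text \<open>Prepares dominated convergence with a moving majorant \<open>K * H' + H\<close>. What
  exceeds a fixed multiple of \<open>H\<close> is charged to |H' - H|, which will tend to 0 in mean;
  the rest is truncated at an integrable function that does not move.\<close>

lemma le_diff_plus_min:
  fixes D A H H' K :: real
  assumes "D \<le> A * (K * H' + H)" "0 \<le> A" "0 \<le> K" "0 \<le> H" "0 \<le> H'"
  shows "D \<le> A * (K + 1) * \<bar>H' - H\<bar> + min D (A * (K + 1) * H)"
proof -
  have "K * H' + H \<le> (K + 1) * \<bar>H' - H\<bar> + (K + 1) * H"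
  proof -
    have "K * H' \<le> K * (\<bar>H' - H\<bar> + H)" using assms by (intro mult_left_mono) auto
    moreover have "0 \<le> \<bar>H' - H\<bar>" by simp
    ultimately show ?thesis by (simp add: algebra_simps)
  qed
  then have "A * (K * H' + H) \<le> A * ((K + 1) * \<bar>H' - H\<bar> + (K + 1) * H)" using assms by (intro mult_left_mono) auto
  then have "D \<le> A * (K + 1) * \<bar>H' - H\<bar> + A * (K + 1) * H" using assms by (simp add: algebra_simps)
  then show ?thesis using assms by (auto simp: min_def)
qed

context disc_weight
begin

text \<open>Precomposition with the contractions \<open>z \<mapsto> (1 - s) z + s c\<close> converges to the identity: by
  Scheffe's lemma the functions \<open>|f|\<^sup>p w\<close> so transported converge in \<open>L\<^sup>1\<close>, and they dominate.\<close>

lemma N_contraction_tendsto_0: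
  fixes c :: complex and s :: "nat \<Rightarrow> real"
  assumes f: "continuous_on (ball 0 1) f" "N f < \<infinity>"
    and c: "norm c \<le> 1" and s: "\<And>n. 0 < s n" "\<And>n. s n < 1" "s \<longlonglongrightarrow> 0"
    and wK: "\<And>n z. z \<in> ball 0 1 \<Longrightarrow> w z \<le> K * w (of_real (1 - s n) * z + of_real (s n) * c)" and K: "K \<ge> 0"
  shows "(\<lambda>n. N (\<lambda>z. f (of_real (1 - s n) * z + of_real (s n) * c) - f z)) \<longlonglongrightarrow> 0"
proof -
  define \<phi> where "\<phi> n z = of_real (1 - s n) * z + of_real (s n) * c" for n z
  have \<phi>_in: "\<phi> n z \<in> ball 0 1" if "z \<in> ball 0 1" for n z
  proof -
    have "norm (\<phi> n z) \<le> (1 - s n) * norm z + s n * norm c"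
      unfolding \<phi>_def using s(1,2)[of n] by (intro order_trans[OF norm_triangle_ineq]) (simp add: norm_mult del: of_real_diff)
    also have "\<dots> < (1 - s n) * 1 + s n * 1"
      using s(1,2)[of n] that c by (intro add_less_le_mono mult_strict_left_mono mult_left_mono) auto
    finally show ?thesis by simp
  qed
  have c\<phi>: "continuous_on A (\<phi> n)" for A n unfolding \<phi>_def by (intro continuous_intros)
  define H where "H z = indicator (ball 0 1) z * (norm (f z) powr p * w z)" for z
  define H' where "H' n z = indicator (ball 0 1) z * H (\<phi> n z)" for n z
  define D where "D n z = indicator (ball 0 1) z * (norm (f (\<phi> n z) - f z) powr p * w z)" for n z
  have cw: "continuous_on (ball 0 1) (\<lambda>z. norm (g z) powr p * w z)" if "continuous_on (ball 0 1) g" for g :: "complex \<Rightarrow> complex"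
    using p_ge_1 that by (intro continuous_on_mult continuous_on_powr' continuous_on_norm w_cont) auto
  have cf\<phi>: "continuous_on (ball 0 1) (\<lambda>z. f (\<phi> n z))" for n
    by (rule continuous_on_compose2[OF f(1) c\<phi>]) (use \<phi>_in in auto)
  have mH: "H \<in> borel_measurable borel" unfolding H_def
    using borel_measurable_continuous_on_indicator[OF _ cw[OF f(1)]] by simp
  have "\<phi> n \<in> borel_measurable borel" for n by (rule borel_measurable_continuous_onI) (rule c\<phi>)
  then have mH': "H' n \<in> borel_measurable borel" for n unfolding H'_def
    by (intro borel_measurable_times borel_measurable_indicator measurable_compose[OF _ mH]) auto
  have mD: "D n \<in> borel_measurable borel" for n unfolding D_def
    using borel_measurable_continuous_on_indicator[OF _ cw[OF continuous_on_diff[OF cf\<phi> f(1)]]] by simp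
  have H0: "0 \<le> H z" for z using w_pos[of z] by (cases "z \<in> ball 0 1") (auto simp: H_def)
  have H'0: "0 \<le> H' n z" for n z using H0 by (simp add: H'_def)
  have D0: "0 \<le> D n z" for n z using w_pos[of z] by (cases "z \<in> ball 0 1") (auto simp: D_def)
  have NH: "(\<integral>\<^sup>+z. ennreal (H z) \<partial>lborel) = N f"
    unfolding N_def by (intro nn_integral_cong) (auto simp: H_def indicator_def)
  have ND: "(\<integral>\<^sup>+z. ennreal (D n z) \<partial>lborel) = N (\<lambda>z. f (\<phi> n z) - f z)" for n
    unfolding N_def by (intro nn_integral_cong) (auto simp: D_def indicator_def)
  \<comment> \<open>Affine change of variables; the exponent 2 of the Jacobian is the real dimension
    of the plane. The masses thus exceed \<open>N f\<close> at most by a factor tending to 1, as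
    Scheffe's lemma requires.\<close>
  have H'_le: "(\<integral>\<^sup>+z. ennreal (H' n z) \<partial>lborel) \<le> ennreal (1 / (1 - s n)\<^sup>2) * N f" for n
  proof -
    have s1: "1 - s n \<noteq> 0" "0 < 1 - s n" using s(2)[of n] by auto
    have T: "(\<lambda>x. of_real (s n) * c + (1 - s n) *\<^sub>R x) \<in> borel_measurable borel"
      by (intro borel_measurable_continuous_onI continuous_intros)
    have "N f = (\<integral>\<^sup>+z. ennreal (H z) \<partial>density (distr lborel borel (\<lambda>x. of_real (s n) * c + (1 - s n) *\<^sub>R x)) (\<lambda>_. ennreal (\<bar>1 - s n\<bar> ^ 2)))"
      unfolding NH[symmetric] by (subst lborel_affine[OF s1(1), of "of_real (s n) * c"]) simp
    also have "\<dots> = (\<integral>\<^sup>+z. ennreal (\<bar>1 - s n\<bar> ^ 2) * ennreal (H z) \<partial>distr lborel borel (\<lambda>x. of_real (s n) * c + (1 - s n) *\<^sub>R x))"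
      using mH by (subst nn_integral_density) auto
    also have "\<dots> = (\<integral>\<^sup>+z. ennreal (\<bar>1 - s n\<bar> ^ 2) * ennreal (H (of_real (s n) * c + (1 - s n) *\<^sub>R z)) \<partial>lborel)"
      using mH T by (subst nn_integral_distr) auto
    also have "\<dots> \<ge> (\<integral>\<^sup>+z. ennreal ((1 - s n)\<^sup>2) * ennreal (H' n z) \<partial>lborel)"
      using H0 by (intro nn_integral_mono mult_mono ennreal_leI)
        (auto simp: H'_def \<phi>_def scaleR_conv_of_real indicator_def add.commute)
    also have "(\<integral>\<^sup>+z. ennreal ((1 - s n)\<^sup>2) * ennreal (H' n z) \<partial>lborel) = ennreal ((1 - s n)\<^sup>2) * (\<integral>\<^sup>+z. ennreal (H' n z) \<partial>lborel)"
      using mH' by (intro nn_integral_cmult) auto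
    finally have "ennreal (1 / (1 - s n)\<^sup>2) * (ennreal ((1 - s n)\<^sup>2) * (\<integral>\<^sup>+z. ennreal (H' n z) \<partial>lborel)) \<le> ennreal (1 / (1 - s n)\<^sup>2) * N f"
      by (rule mult_left_mono) simp
    moreover have "ennreal (1 / (1 - s n)\<^sup>2) * ennreal ((1 - s n)\<^sup>2) = 1"
    proof -
      have "ennreal (1 / (1 - s n)\<^sup>2) * ennreal ((1 - s n)\<^sup>2) = ennreal (1 / (1 - s n)\<^sup>2 * (1 - s n)\<^sup>2)"
        by (rule ennreal_mult''[symmetric]) simp
      then show ?thesis using s1 by simp
    qed
    ultimately show ?thesis by (simp only: mult.assoc[symmetric]) simp
  qed
  have conv: "(\<lambda>n. \<phi> n z) \<longlonglongrightarrow> z" for z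
  proof -
    have "(\<lambda>n. of_real (1 - s n) * z + of_real (s n) * c) \<longlonglongrightarrow> of_real (1 - 0) * z + of_real 0 * c"
      by (intro tendsto_intros s)
    then show ?thesis by (simp add: \<phi>_def)
  qed
  have conv': "(\<lambda>n. g (\<phi> n z)) \<longlonglongrightarrow> g z" if "continuous_on (ball 0 1) g" "z \<in> ball 0 1" for g :: "complex \<Rightarrow> 'a::topological_space" and z
  proof -
    have "isCont g z" using that by (simp add: continuous_on_eq_continuous_at)
    then show ?thesis using conv isCont_tendsto_compose by blast
  qed
  have H'_lim: "(\<lambda>n. H' n z) \<longlonglongrightarrow> H z" for z
  proof (cases "z \<in> ball 0 1")
    case True
    have "(\<lambda>n. norm (f (\<phi> n z)) powr p * w (\<phi> n z)) \<longlonglongrightarrow> norm (f z) powr p * w z"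
      using conv'[OF cw[OF f(1)] True] by simp
    then show ?thesis using True \<phi>_in by (simp add: H'_def H_def)
  qed (simp add: H'_def H_def)
  have L1: "(\<lambda>n. \<integral>\<^sup>+z. norm (H' n z - H z) \<partial>lborel) \<longlonglongrightarrow> 0"
  proof (rule Scheffe_lemma1)
    show "integrable lborel H" using f(2) mH H0 NH by (intro integrableI_nonneg) auto
    show "integrable lborel (H' n)" for n
    proof (rule integrableI_nonneg)
      have "ennreal (1 / (1 - s n)\<^sup>2) * N f < \<infinity>" using f(2) by (simp add: ennreal_mult_less_top)
      then show "(\<integral>\<^sup>+z. ennreal (H' n z) \<partial>lborel) < \<infinity>" using H'_le[of n] by (rule le_less_trans[rotated])
    qed (use mH' H'0 in auto)
    show "AE z in lborel. (\<lambda>n. H' n z) \<longlonglongrightarrow> H z" using H'_lim by simp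
    have "limsup (\<lambda>n. \<integral>\<^sup>+z. norm (H' n z) \<partial>lborel) \<le> limsup (\<lambda>n. ennreal (1 / (1 - s n)\<^sup>2) * N f)"
      using H'_le H'0 by (intro Limsup_mono always_eventually) simp
    also have "(\<lambda>n. ennreal (1 / (1 - s n)\<^sup>2) * N f) \<longlonglongrightarrow> ennreal (1 / (1 - 0)\<^sup>2) * N f"
    proof (rule tendsto_mult_ennreal)
      show "(\<lambda>n. ennreal (1 / (1 - s n)\<^sup>2)) \<longlonglongrightarrow> ennreal (1 / (1 - 0)\<^sup>2)"
        by (intro tendsto_ennrealI tendsto_intros s(3)) auto
    qed (use f(2) in auto)
    then have "limsup (\<lambda>n. ennreal (1 / (1 - s n)\<^sup>2) * N f) = N f"
      by (intro lim_imp_Limsup) auto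
    also have "N f = (\<integral>\<^sup>+z. norm (H z) \<partial>lborel)" using H0 NH by simp
    finally show "limsup (\<lambda>n. \<integral>\<^sup>+z. norm (H' n z) \<partial>lborel) \<le> (\<integral>\<^sup>+z. norm (H z) \<partial>lborel)" .
  qed
  define A where "A = 2 powr p * (K + 1)"
  have A0: "A \<ge> 0" using K by (simp add: A_def)
  let ?P = "\<lambda>n. \<integral>\<^sup>+z. norm (H' n z - H z) \<partial>lborel" and ?R = "\<lambda>n. \<integral>\<^sup>+z. ennreal (min (D n z) (A * H z)) \<partial>lborel"
  have D_le: "D n z \<le> A * \<bar>H' n z - H z\<bar> + min (D n z) (A * H z)" for n z
    unfolding A_def
  proof (rule le_diff_plus_min)
    show "D n z \<le> 2 powr p * (K * H' n z + H z)"
    proof (cases "z \<in> ball 0 1")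
      case True
      have "norm (f (\<phi> n z) - f z) powr p * w z \<le> 2 powr p * (norm (f (\<phi> n z)) powr p + norm (f z) powr p) * w z"
        using w_pos[OF True] p_ge_1 by (intro mult_right_mono norm_diff_powr_le) auto
      also have "\<dots> = 2 powr p * (norm (f (\<phi> n z)) powr p * w z + norm (f z) powr p * w z)" by (simp add: algebra_simps)
      also have "\<dots> \<le> 2 powr p * (norm (f (\<phi> n z)) powr p * (K * w (\<phi> n z)) + norm (f z) powr p * w z)"
        using wK[OF True, of n] by (intro mult_left_mono add_right_mono) (auto simp: \<phi>_def)
      also have "\<dots> = 2 powr p * (K * H' n z + H z)" using True \<phi>_in[OF True] by (simp add: H'_def H_def)
      finally show ?thesis using True by (simp add: D_def)
    qed (simp add: D_def H'_def H_def)
  qed (use K H0 H'0 in auto)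
  have min_lim: "(\<lambda>n. \<integral>\<^sup>+z. ennreal (min (D n z) (A * H z)) \<partial>lborel) \<longlonglongrightarrow> (\<integral>\<^sup>+z. 0 \<partial>(lborel :: complex measure))"
  proof (rule nn_integral_dominated_convergence[where w = "\<lambda>z. ennreal (A * H z)"])
    show "(\<lambda>z. ennreal (min (D n z) (A * H z))) \<in> borel_measurable lborel" for n using mD mH by measurable
    show "(\<lambda>z. ennreal (A * H z)) \<in> borel_measurable lborel" using mH by measurable
    have "(\<integral>\<^sup>+z. ennreal (A * H z) \<partial>lborel) = (\<integral>\<^sup>+z. ennreal A * ennreal (H z) \<partial>lborel)"
      using A0 by (intro nn_integral_cong) (rule ennreal_mult')
    also have "\<dots> = ennreal A * N f" using mH by (subst nn_integral_cmult) (auto simp: NH)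
    finally show "(\<integral>\<^sup>+z. ennreal (A * H z) \<partial>lborel) < \<infinity>" using f(2) by (simp add: ennreal_mult_less_top)
    show "AE z in lborel. (\<lambda>n. ennreal (min (D n z) (A * H z))) \<longlonglongrightarrow> 0"
    proof (rule AE_I2)
      fix z
      have "(\<lambda>n. min (D n z) (A * H z)) \<longlonglongrightarrow> min 0 (A * H z)"
      proof (rule tendsto_min)
        show "(\<lambda>n. D n z) \<longlonglongrightarrow> 0"
        proof (cases "z \<in> ball 0 1")
          case True
          have "(\<lambda>n. f (\<phi> n z) - f z) \<longlonglongrightarrow> f z - f z" by (intro tendsto_diff conv'[OF f(1) True] tendsto_const)
          then have "(\<lambda>n. norm (f (\<phi> n z) - f z) powr p) \<longlonglongrightarrow> norm (f z - f z) powr p"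
            using p_ge_1 by (intro tendsto_powr' tendsto_norm tendsto_const) auto
          then have "(\<lambda>n. norm (f (\<phi> n z) - f z) powr p * w z) \<longlonglongrightarrow> 0 * w z"
            using p_ge_1 by (intro tendsto_mult_right) simp
          then show ?thesis using True by (simp add: D_def)
        qed (simp add: D_def)
      qed auto
      moreover have "min 0 (A * H z) = 0" using A0 H0 by (simp add: min_def)
      ultimately have "(\<lambda>n. ennreal (min (D n z) (A * H z))) \<longlonglongrightarrow> ennreal 0" by (intro tendsto_ennrealI) simp
      then show "(\<lambda>n. ennreal (min (D n z) (A * H z))) \<longlonglongrightarrow> 0" by simp
    qed
  qed (auto intro!: AE_I2 ennreal_leI)
  have "N (\<lambda>z. f (\<phi> n z) - f z) \<le> ennreal A * ?P n + ?R n" for n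
  proof -
    have "N (\<lambda>z. f (\<phi> n z) - f z) \<le> (\<integral>\<^sup>+z. ennreal A * ennreal (norm (H' n z - H z)) + ennreal (min (D n z) (A * H z)) \<partial>lborel)"
      unfolding ND[symmetric]
    proof (rule nn_integral_mono)
      fix z
      have "ennreal (D n z) \<le> ennreal (A * \<bar>H' n z - H z\<bar> + min (D n z) (A * H z))" by (intro ennreal_leI D_le)
      also have "\<dots> = ennreal (A * \<bar>H' n z - H z\<bar>) + ennreal (min (D n z) (A * H z))"
        using A0 H0 D0 by (intro ennreal_plus) auto
      also have "ennreal (A * \<bar>H' n z - H z\<bar>) = ennreal A * ennreal (norm (H' n z - H z))"
        using A0 by (simp add: ennreal_mult')
      finally show "ennreal (D n z) \<le> ennreal A * ennreal (norm (H' n z - H z)) + ennreal (min (D n z) (A * H z))" .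
    qed
    also have "\<dots> = ennreal A * ?P n + ?R n"
    proof -
      have 1: "(\<lambda>z. ennreal (norm (H' n z - H z))) \<in> borel_measurable lborel" using mH' mH by measurable
      have 2: "(\<lambda>z. ennreal (min (D n z) (A * H z))) \<in> borel_measurable lborel" using mD mH by measurable
      have 3: "(\<lambda>z. ennreal A * ennreal (norm (H' n z - H z))) \<in> borel_measurable lborel" using 1 by measurable
      show ?thesis by (simp only: nn_integral_add[OF 3 2] nn_integral_cmult[OF 1])
    qed
    finally show ?thesis .
  qed
  note upper = this
  have "(\<lambda>n. ennreal A * ?P n + ?R n) \<longlonglongrightarrow> ennreal A * 0 + (\<integral>\<^sup>+z. 0 \<partial>(lborel :: complex measure))"
    by (intro tendsto_add min_lim ennreal_tendsto_cmult L1) simp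
  then have lim: "(\<lambda>n. ennreal A * ?P n + ?R n) \<longlonglongrightarrow> 0"
    by simp
  have "(\<lambda>n. N (\<lambda>z. f (\<phi> n z) - f z)) \<longlonglongrightarrow> 0"
    by (rule tendsto_sandwich[OF always_eventually[OF allI[OF zero_le]]
          always_eventually[OF allI[OF upper]] tendsto_const lim])
  then show ?thesis by (simp only: \<phi>_def)
qed

text \<open>Composed with a contraction, \<open>f\<close> is holomorphic on a disc of radius above
  1, hence uniformly approximable by polynomials on the closed unit disc; the contractions are then
  undone in the limit.\<close>

lemma in_cyc_hull_one_of_contraction:
  fixes c :: complex
  assumes f: "f holomorphic_on ball 0 1" "N f < \<infinity>"
    and c: "norm c \<le> 1/2" and s0: "0 < s0" "s0 < 1"
    and wK: "\<And>s z. z \<in> ball 0 1 \<Longrightarrow> 0 < s \<Longrightarrow> s \<le> s0 \<Longrightarrow> w z \<le> K * w (of_real (1 - s) * z + of_real s * c)" and K: "K \<ge> 0"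
  shows "f \<in> cyc_hull (\<lambda>_. 1)"
proof -
  define s where "s n = s0 / real (Suc n)" for n
  have s: "0 < s n" "s n \<le> s0" "s n < 1" for n
  proof -
    show "0 < s n" using s0 by (simp add: s_def)
    show "s n \<le> s0" using s0 by (simp add: s_def divide_le_eq mult_le_cancel_left1)
    then show "s n < 1" using s0 by simp
  qed
  have slim: "s \<longlonglongrightarrow> 0" unfolding s_def by (rule LIMSEQ_Suc) (rule lim_const_over_n)
  have cf: "continuous_on (ball 0 1) f" using f(1) holomorphic_on_imp_continuous_on by blast
  show ?thesis
  proof (rule cyc_hull_closed[where f = "\<lambda>n z. f (of_real (1 - s n) * z + of_real (s n) * c)"])
    show "continuous_on (ball 0 1) f" by (rule cf)
    show "(\<lambda>n. N (\<lambda>z. f (of_real (1 - s n) * z + of_real (s n) * c) - f z)) \<longlonglongrightarrow> 0"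
      using s c by (intro N_contraction_tendsto_0[where K = K] cf f(2) slim wK K) auto
    fix n
    \<comment> \<open>Solves (1 - s) R + s / 2 = 1: the largest radius for which |c| <= 1/2
      guarantees that the image stays in the unit disc.\<close>
    define R where "R = (1 - s n / 2) / (1 - s n)"
    have R: "1 < R" using s[of n] by (simp add: R_def field_simps)
    have "(\<lambda>z. of_real (1 - s n) * z + of_real (s n) * c) ` ball 0 R \<subseteq> ball 0 1"
    proof (intro image_subsetI)
      fix z :: complex assume z: "z \<in> ball 0 R"
      have "norm (of_real (1 - s n) * z + of_real (s n) * c) \<le> (1 - s n) * norm z + s n * norm c"
        using s[of n] by (intro order_trans[OF norm_triangle_ineq]) (simp add: norm_mult del: of_real_diff)
      also have "\<dots> < (1 - s n) * R + s n * (1/2)"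
        using s[of n] z c by (intro add_less_le_mono mult_strict_left_mono mult_left_mono) auto
      also have "\<dots> = 1" using s[of n] by (simp add: R_def field_simps)
      finally show "of_real (1 - s n) * z + of_real (s n) * c \<in> ball 0 1" by simp
    qed
    from holomorphic_on_compose_gen[OF _ f(1) this]
    have "(\<lambda>z. f (of_real (1 - s n) * z + of_real (s n) * c)) holomorphic_on ball 0 R"
      by (simp add: o_def holomorphic_intros)
    from mult_in_cyc_hull_of_holomorphic_larger[OF _ _ this R, of "\<lambda>_. 1"]
    show "(\<lambda>z. f (of_real (1 - s n) * z + of_real (s n) * c)) \<in> cyc_hull (\<lambda>_. 1)" by simp
  qed auto
qed

text \<open>The polynomials approximating \<open>f\<close> lie themselves in the closure belonging
  to \<open>F\<close>, and that closure contains its limits.\<close>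

lemma cyc_hull_trans:
  assumes F: "continuous_on (ball 0 1) F" and one: "(\<lambda>_. 1) \<in> cyc_hull F" and f: "f \<in> cyc_hull (\<lambda>_. 1)"
  shows "f \<in> cyc_hull F"
proof -
  have "\<exists>q :: complex poly. N (\<lambda>z. f z - poly q z * 1) < ennreal (1 / real (Suc n))" for n
    using f unfolding cyc_hull_def by fastforce
  then obtain q :: "nat \<Rightarrow> complex poly" where q: "\<And>n. N (\<lambda>z. f z - poly (q n) z * 1) < ennreal (1 / real (Suc n))"
    by metis
  show ?thesis
  proof (rule cyc_hull_closed[OF F, where f = "\<lambda>n. poly (q n)"])
    show "continuous_on (ball 0 1) f" using f by (simp add: cyc_hull_def)
    show "poly (q n) \<in> cyc_hull F" for n by (rule poly_in_cyc_hull[OF F one])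
    show "(\<lambda>n. N (\<lambda>z. poly (q n) z - f z)) \<longlonglongrightarrow> 0"
    proof (rule tendsto_sandwich[of "\<lambda>_. 0" _ _ "\<lambda>n. ennreal (1 / real (Suc n))"])
      show "\<forall>\<^sub>F n in sequentially. N (\<lambda>z. poly (q n) z - f z) \<le> ennreal (1 / real (Suc n))"
      proof (rule always_eventually, rule allI)
        fix n
        have "N (\<lambda>z. poly (q n) z - f z) = N (\<lambda>z. f z - poly (q n) z * 1)"
          by (rule N_cong) (simp add: norm_minus_commute)
        then show "N (\<lambda>z. poly (q n) z - f z) \<le> ennreal (1 / real (Suc n))" using q[of n] by simp
      qed
      have "(\<lambda>n. 1 / real (Suc n)) \<longlonglongrightarrow> 0" by (rule LIMSEQ_Suc) (rule lim_1_over_n)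
      then have "(\<lambda>n. ennreal (1 / real (Suc n))) \<longlonglongrightarrow> ennreal 0" by (rule tendsto_ennrealI)
      then show "(\<lambda>n. ennreal (1 / real (Suc n))) \<longlonglongrightarrow> 0" by simp
    qed auto
  qed
qed

end

section \<open>Outer functions approximating exponentials\<close>

text \<open>\<open>block s Y u\<close> is the integral of \<open>u / (y (y + \<i> s u))\<close> over \<open>y \<in> [Y, 2 Y]\<close>: up to the factor
  \<open>1 / pi\<close> and an imaginary constant, the Herglotz integral over the segment from \<open>\<i> s Y\<close> to \<open>2 \<i> s Y\<close>.\<close>

definition block_prim :: "real \<Rightarrow> complex \<Rightarrow> complex \<Rightarrow> complex" where
  "block_prim s u y = - (\<i> * of_real s) * (Ln y - Ln (y + \<i> * of_real s * u))"

definition block :: "real \<Rightarrow> real \<Rightarrow> complex \<Rightarrow> complex" where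
  "block s Y u = block_prim s u (of_real (2 * Y)) - block_prim s u (of_real Y)"

lemma shifted_notin_nonpos_Reals:
  assumes "\<bar>s\<bar> = 1" "0 < Re u"
  shows "of_real y + \<i> * of_real s * u \<notin> \<real>\<^sub>\<le>\<^sub>0" "of_real y + \<i> * of_real s * u \<noteq> 0"
proof -
  have "Im (of_real y + \<i> * of_real s * u) \<noteq> 0" using assms by auto
  then show "of_real y + \<i> * of_real s * u \<notin> \<real>\<^sub>\<le>\<^sub>0" "of_real y + \<i> * of_real s * u \<noteq> 0"
    unfolding complex_nonpos_Reals_iff by (blast, metis zero_complex.sel(2))
qed

lemma block_prim_has_field_derivative:
  assumes s: "\<bar>s\<bar> = 1" and u: "0 < Re u" and y: "0 < y"
  shows "(block_prim s u has_field_derivative u / (of_real y * (of_real y + \<i> * of_real s * u))) (at (of_real y))"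
proof -
  note nz = shifted_notin_nonpos_Reals[OF s u, of y]
  have y': "complex_of_real y \<notin> \<real>\<^sub>\<le>\<^sub>0" "complex_of_real y \<noteq> 0" using y by (auto simp: complex_nonpos_Reals_iff)
  have "(block_prim s u has_field_derivative - (\<i> * of_real s) * (inverse (of_real y) - inverse (of_real y + \<i> * of_real s * u))) (at (of_real y))"
    unfolding block_prim_def using nz y'
    by (auto intro!: derivative_eq_intros simp: divide_inverse)
  also have "- (\<i> * of_real s) * (inverse (of_real y) - inverse (of_real y + \<i> * of_real s * u))
     = u / (of_real y * (of_real y + \<i> * of_real s * u))"
  proof -
    have "s * s = 1" using s by (metis abs_mult_self_eq mult_1)
    then have ss: "complex_of_real s * of_real s = 1" by (metis of_real_mult of_real_1)
    have "inverse (of_real y) - inverse (of_real y + \<i> * of_real s * u)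
      = (\<i> * of_real s * u) / (of_real y * (of_real y + \<i> * of_real s * u))"
      using nz y' by (simp add: field_simps)
    moreover have "- (\<i> * of_real s) * (\<i> * of_real s * u) = u"
    proof -
      have "- (\<i> * of_real s) * (\<i> * of_real s * u) = - (\<i> * \<i>) * (of_real s * of_real s) * u" by (simp only: mult_ac minus_mult_left)
      then show ?thesis by (simp only: ss) simp
    qed
    ultimately show ?thesis by (metis times_divide_eq_right)
  qed
  finally show ?thesis .
qed

lemma arctan_affine_derivative:
  assumes "0 < r"
  shows "((\<lambda>y. arctan ((y - c) / r)) has_real_derivative r / ((y - c)\<^sup>2 + r\<^sup>2)) (at y)"
proof -
  have "1 + ((y - c) / r)\<^sup>2 = ((y - c)\<^sup>2 + r\<^sup>2) / r\<^sup>2"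
    using assms by (simp add: power_divide add_divide_distrib)
  then have "(1 / r) / (1 + ((y - c) / r)\<^sup>2) = r / ((y - c)\<^sup>2 + r\<^sup>2)"
    using assms by (simp add: power2_eq_square)
  moreover have "((\<lambda>y. arctan ((y - c) / r)) has_real_derivative (1 / r) / (1 + ((y - c) / r)\<^sup>2)) (at y)"
    using assms by (auto intro!: derivative_eq_intros simp: divide_inverse)
  ultimately show ?thesis by simp
qed

text \<open>This is the angle under which the segment from i s Y to 2 i s Y is seen from u, that is,
  pi times its harmonic measure. Comparing derivatives in the end point y, where both sides give the
  Poisson kernel, avoids any discussion of branches of the logarithm.\<close>

lemma Re_block:
  assumes s: "\<bar>s\<bar> = 1" and u: "0 < Re u" and Y: "0 < Y"
  shows "Re (block s Y u) = arctan ((2 * Y - s * Im u) / Re u) - arctan ((Y - s * Im u) / Re u)"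
proof -
  let ?g = "\<lambda>y. Re (block_prim s u (of_real y)) - arctan ((y - s * Im u) / Re u)"
  have der: "(?g has_real_derivative 0) (at y)" if y: "0 < y" for y
  proof -
    have "((\<lambda>y. Re (block_prim s u (of_real y))) has_vector_derivative Re (u / (of_real y * (of_real y + \<i> * of_real s * u)))) (at y)"
      using has_vector_derivative_real_field[OF block_prim_has_field_derivative[OF s u y]]
      by (rule bounded_linear.has_vector_derivative[OF bounded_linear_Re])
    then have 1: "((\<lambda>y. Re (block_prim s u (of_real y))) has_real_derivative Re (u / (of_real y * (of_real y + \<i> * of_real s * u)))) (at y)"
      by (simp add: has_real_derivative_iff_has_vector_derivative)
    note 2 = arctan_affine_derivative[OF u, of "s * Im u" y]
    have ss: "s\<^sup>2 = 1" using s by (metis power2_abs one_power2)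
    have "Re (u / (of_real y + \<i> * of_real s * u)) = (Re u * (y - s * Im u) + Im u * (s * Re u)) / ((y - s * Im u)\<^sup>2 + (s * Re u)\<^sup>2)"
      by (simp add: Re_divide)
    also have "(s * Re u)\<^sup>2 = (Re u)\<^sup>2" by (simp add: power_mult_distrib ss)
    also have "Re u * (y - s * Im u) + Im u * (s * Re u) = y * Re u" by (simp add: algebra_simps)
    finally have "Re (u / (of_real y + \<i> * of_real s * u)) / y = Re u / ((y - s * Im u)\<^sup>2 + (Re u)\<^sup>2)" using y by simp
    moreover have "Re (u / (of_real y * (of_real y + \<i> * of_real s * u))) = Re (u / (of_real y + \<i> * of_real s * u)) / y"
      by (metis Re_divide_of_real divide_divide_eq_left mult.commute)
    ultimately have "Re (u / (of_real y * (of_real y + \<i> * of_real s * u))) = Re u / ((y - s * Im u)\<^sup>2 + (Re u)\<^sup>2)"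
      by simp
    with 1 2 show ?thesis using DERIV_diff[OF 1 2] by simp
  qed
  have "?g (2 * Y) = ?g Y"
  proof (rule DERIV_isconst_end[of Y "2*Y" ?g])
    show "continuous_on {Y..2 * Y} ?g"
      using Y DERIV_isCont[OF der] by (intro continuous_at_imp_continuous_on) auto
  qed (use Y der in auto)
  then show ?thesis by (simp add: block_def)
qed

lemma Re_block_nonneg:
  assumes "\<bar>s\<bar> = 1" "0 < Re u" "0 < Y"
  shows "0 \<le> Re (block s Y u)"
  using assms by (simp add: Re_block arctan_le_iff divide_right_mono)

lemma Re_block_le_pi:
  assumes "\<bar>s\<bar> = 1" "0 < Re u" "0 < Y"
  shows "Re (block s Y u) \<le> pi"
  using arctan_lbound[of "(Y - s * Im u) / Re u"] arctan_ubound[of "(2 * Y - s * Im u) / Re u"]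
  unfolding Re_block[OF assms] by linarith

text \<open>If y is at least l times the height of u, then y - s Im u is at least (1 - 1/l) y, so
  the Poisson kernel is at most Re u / y^2 times the stated factor. Integrating 1 / y^2 over
  [Y, 2 Y] gives 1 / (2 Y).\<close>

lemma Re_block_le_far:
  assumes s: "\<bar>s\<bar> = 1" and u: "0 < Re u" and Y: "0 < Y" and l: "1 < l" "l * (s * Im u) \<le> Y"
  shows "Re (block s Y u) \<le> 1 / (1 - 1/l)\<^sup>2 * (Re u / (2 * Y))"
proof -
  define \<kappa> where "\<kappa> = 1 / (1 - 1/l)\<^sup>2"
  let ?g = "\<lambda>y. arctan ((y - s * Im u) / Re u) + \<kappa> * Re u / y"
  have "?g (2 * Y) \<le> ?g Y"
  proof (rule DERIV_nonpos_imp_nonincreasing[where f = ?g])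
    show "Y \<le> 2 * Y" using Y by simp
    fix y assume y: "Y \<le> y" "y \<le> 2 * Y"
    then have y0: "0 < y" using Y by simp
    define D where "D = (y - s * Im u)\<^sup>2 + (Re u)\<^sup>2"
    have D: "D > 0" using u by (simp add: D_def add_nonneg_pos)
    have "((\<lambda>y. \<kappa> * Re u / y) has_real_derivative - (\<kappa> * Re u / y\<^sup>2)) (at y)"
      using y0 by (auto intro!: derivative_eq_intros simp: power2_eq_square)
    from DERIV_add[OF arctan_affine_derivative[OF u] this]
    have "(?g has_real_derivative Re u / D - \<kappa> * Re u / y\<^sup>2) (at y)" by (simp add: D_def)
    moreover have "Re u / D - \<kappa> * Re u / y\<^sup>2 \<le> 0"
    proof -
      have "s * Im u \<le> y / l" using l y by (simp add: field_simps)
      then have "(1 - 1/l) * y \<le> y - s * Im u" by (simp add: algebra_simps)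
      moreover have "0 \<le> (1 - 1/l) * y" using l y0 by simp
      ultimately have "((1 - 1/l) * y)\<^sup>2 \<le> (y - s * Im u)\<^sup>2" by (intro power_mono)
      then have "(1 - 1/l)\<^sup>2 * y\<^sup>2 \<le> D" unfolding D_def power_mult_distrib by (simp add: add_increasing2)
      moreover have pos: "0 < (1 - 1/l)\<^sup>2 * y\<^sup>2" using l y0 by simp
      ultimately have "Re u / D \<le> Re u / ((1 - 1/l)\<^sup>2 * y\<^sup>2)" using u by (intro divide_left_mono mult_pos_pos D) auto
      then show ?thesis by (simp add: \<kappa>_def)
    qed
    ultimately show "\<exists>d. (?g has_real_derivative d) (at y) \<and> d \<le> 0" by metis
  qed
  then have "Re (block s Y u) \<le> \<kappa> * Re u / Y - \<kappa> * Re u / (2 * Y)"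
    unfolding Re_block[OF s u Y] by simp
  also have "\<dots> = \<kappa> * (Re u / (2 * Y))" using Y by (simp add: field_simps)
  finally show ?thesis by (simp add: \<kappa>_def)
qed

text \<open>Here u / (2 Y) is the integral of u / y^2 over [Y, 2 Y]. The two integrands differ by -i
  s u^2 / (y^2 (y + i s u)), and the mean value inequality over an interval of length Y gives the
  bound.\<close>

lemma block_approx:
  assumes s: "\<bar>s\<bar> = 1" and u: "0 < Re u" and Y: "norm u < Y"
  shows "norm (block s Y u - u / of_real (2 * Y)) \<le> (norm u)\<^sup>2 / (Y * (Y - norm u))"
proof -
  have Y0: "Y > 0" using Y norm_ge_zero[of u] by linarith
  let ?D = "\<lambda>y. block_prim s u y + u / y"
  let ?S = "closed_segment (of_real Y) (of_real (2 * Y)) :: complex set"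
  have "norm (?D (of_real (2 * Y)) - ?D (of_real Y)) \<le> ((norm u)\<^sup>2 / (Y\<^sup>2 * (Y - norm u))) * norm (of_real (2 * Y) - complex_of_real Y)"
  proof (rule field_differentiable_bound[of ?S])
    show "convex ?S" by simp
    fix x assume "x \<in> ?S"
    then obtain y where y: "x = of_real y" "Y \<le> y" "y \<le> 2 * Y"
    proof -
      obtain t where t: "0 \<le> t" "t \<le> 1" "x = (1 - t) *\<^sub>R of_real Y + t *\<^sub>R of_real (2 * Y)"
        using \<open>x \<in> ?S\<close> by (auto simp only: in_segment)
      have "x = of_real (Y + t * Y)" using t(3) by (simp add: scaleR_conv_of_real algebra_simps)
      moreover have "0 \<le> t * Y" "t * Y \<le> 1 * Y" using t Y0 by (intro mult_nonneg_nonneg mult_right_mono; simp)+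
      ultimately show ?thesis using that[of "Y + t * Y"] by simp
    qed
    then have y0: "y > 0" using Y0 by simp
    note nz = shifted_notin_nonpos_Reals[OF s u, of y]
    have x0: "x \<noteq> 0" using y y0 by simp
    have "(?D has_field_derivative (u / (x * (x + \<i> * of_real s * u)) - u / x\<^sup>2)) (at x)"
      using x0 block_prim_has_field_derivative[OF s u y0] unfolding y(1)
      by (auto intro!: derivative_eq_intros simp: power2_eq_square)
    then show "(?D has_field_derivative (u / (x * (x + \<i> * of_real s * u)) - u / x\<^sup>2)) (at x within ?S)"
      by (rule has_field_derivative_at_within)
    have "u / (x * (x + \<i> * of_real s * u)) - u / x\<^sup>2 = - (\<i> * of_real s * u\<^sup>2) / (x\<^sup>2 * (x + \<i> * of_real s * u))"
      using x0 nz(2) unfolding y(1)[symmetric] by (simp add: divide_simps power2_eq_square) (simp add: algebra_simps)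
    then have "norm (u / (x * (x + \<i> * of_real s * u)) - u / x\<^sup>2) = (norm u)\<^sup>2 / (y\<^sup>2 * norm (x + \<i> * of_real s * u))"
      using s y0 by (simp add: norm_divide norm_mult norm_power y(1))
    also have "\<dots> \<le> (norm u)\<^sup>2 / (Y\<^sup>2 * (Y - norm u))"
    proof (intro divide_left_mono mult_mono)
      show "Y\<^sup>2 \<le> y\<^sup>2" using y Y0 by (intro power_mono) auto
      have "norm x \<le> norm (x + \<i> * of_real s * u) + norm (\<i> * of_real s * u)"
        using norm_triangle_ineq4[of "x + \<i> * of_real s * u" "\<i> * of_real s * u"] by simp
      then show "Y - norm u \<le> norm (x + \<i> * of_real s * u)"
        using s y y0 by (simp add: norm_mult)
      then have "0 < norm (x + \<i> * of_real s * u)" using Y by linarith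
      then show "0 < y\<^sup>2 * norm (x + \<i> * of_real s * u) * (Y\<^sup>2 * (Y - norm u))" using Y Y0 y0 by simp
    qed (use Y in auto)
    finally show "norm (u / (x * (x + \<i> * of_real s * u)) - u / x\<^sup>2) \<le> (norm u)\<^sup>2 / (Y\<^sup>2 * (Y - norm u))" .
  qed auto
  also have "?D (of_real (2 * Y)) - ?D (of_real Y) = block s Y u - u / of_real (2 * Y)"
    using Y0 by (simp add: block_def field_simps)
  also have "norm (of_real (2 * Y) - complex_of_real Y) = Y"
    using Y0 by (simp flip: of_real_diff)
  also have "(norm u)\<^sup>2 / (Y\<^sup>2 * (Y - norm u)) * Y = (norm u)\<^sup>2 / (Y * (Y - norm u))"
    using Y0 by (simp add: power2_eq_square)
  finally show ?thesis .
qed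

lemma holomorphic_on_block [holomorphic_intros]:
  assumes s: "\<bar>s\<bar> = 1"
  shows "block s Y holomorphic_on {u. 0 < Re u}"
  unfolding block_def block_prim_def
  using shifted_notin_nonpos_Reals(1)[OF s, of _ "2 * Y"] shifted_notin_nonpos_Reals(1)[OF s, of _ Y]
  by (intro holomorphic_intros) auto

text \<open>The Poisson integrals of the functions \<open>C L\<^sub>k\<close> on \<open>[Y\<^sub>k, 2 Y\<^sub>k]\<close>, for \<open>k\<close> in a window going to infinity,
  converge to a multiple of \<open>Re u\<close>. The intervals in the window which are far away contribute at
  most about their limit value, the near ones at most the maximum of the boundary values.\<close>

lemma outer_log_exists:
  fixes L :: "nat \<Rightarrow> real" and a \<epsilon> l M :: real
  defines "Y \<equiv> \<lambda>k. sqrt (L k) * 2 ^ k"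
  assumes s: "\<bar>s\<bar> = 1" and L: "\<And>k. 0 < L k" "mono L"
    and div: "\<not> summable (\<lambda>k. sqrt (L k) / 2 ^ k)"
    and a: "0 < a" "a < 1" and l: "1 < l" "1 / (1 - 1/l)\<^sup>2 * (1 - a) \<le> 1 - a / 2"
    and \<epsilon>: "0 < \<epsilon>" and M: "0 < M"
  obtains \<Psi> B where "\<Psi> holomorphic_on {u. 0 < Re u}"
    "\<And>u. 0 < Re u \<Longrightarrow> Re (\<Psi> u) \<le> B"
    "\<And>u. 0 < Re u \<Longrightarrow> Re (\<Psi> u) \<le> (1 - a / 2) * Re u \<or>
       (\<exists>k. M \<le> Y k \<and> Y k < l * (s * Im u) \<and> Re (\<Psi> u) \<le> (1 - a / 2) * Re u + \<epsilon> * L k)"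
    "\<And>u. 0 < Re u \<Longrightarrow> norm u \<le> M / 2 \<Longrightarrow> norm (\<Psi> u - of_real (1 - a) * u) \<le> 4 * (norm u)\<^sup>2 / M"
proof -
  have Y0: "0 < Y k" for k using L by (simp add: Y_def)
  have Y2: "2 * Y k \<le> Y (Suc k)" for k
  proof -
    have "sqrt (L k) \<le> sqrt (L (Suc k))" using L(2) by (simp add: mono_iff_le_Suc)
    then show ?thesis by (simp add: Y_def)
  qed
  have Ymono: "mono Y" unfolding mono_iff_le_Suc
  proof
    fix n show "Y n \<le> Y (Suc n)" using Y2[of n] Y0[of n] by linarith
  qed
  obtain m where m: "M \<le> Y m"
  proof -
    obtain m where "M / sqrt (L 0) < 2 ^ m" using real_arch_pow[of 2 "M / sqrt (L 0)"] by auto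
    then have "M \<le> sqrt (L 0) * 2 ^ m" using L by (simp add: field_simps less_imp_le)
    also have "\<dots> \<le> Y m" using L by (simp add: Y_def monoD[OF L(2)])
    finally show ?thesis using that by blast
  qed
  have Ym: "M \<le> Y k" if "m \<le> k" for k using m monoD[OF Ymono that] by simp
  define f where "f k = sqrt (L k) / 2 ^ k" for k
  have f0: "0 < f k" for k using L by (simp add: f_def)
  have Lf: "L k / Y k = f k" for k
  proof -
    have "L k = sqrt (L k) * sqrt (L k)" using L(1)[of k] by simp
    moreover have "r * r / (r * 2 ^ k) = r / 2 ^ k" if "0 < r" for r :: real using that by simp
    moreover have "0 < sqrt (L k)" using L(1) by simp
    ultimately show ?thesis unfolding Y_def f_def by metis
  qed
  \<comment> \<open>The only use of divergence: the window is prolonged until the normalising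
    constant \<open>C\<close> is at most \<epsilon>.\<close>
  obtain n where n: "m \<le> n" "2 * pi * (1 - a) / \<epsilon> \<le> sum f {m..n}"
  proof -
    have "\<not> summable (\<lambda>k. f (k + m))" using div by (subst summable_iff_shift) (simp add: f_def[abs_def])
    then have "\<not> (\<forall>n. sum (\<lambda>k. f (k + m)) {..<n} \<le> 2 * pi * (1 - a) / \<epsilon>)"
      using summableI_nonneg_bounded[of "\<lambda>k. f (k + m)"] f0 less_imp_le by blast
    then obtain n where n: "2 * pi * (1 - a) / \<epsilon> < sum (\<lambda>k. f (k + m)) {..<n}" by (auto simp: not_le)
    have "sum (\<lambda>k. f (k + m)) {..<n} = sum f {m..<m + n}"
      using sum.shift_bounds_nat_ivl[of f 0 m n] by (simp add: atLeast0LessThan add.commute)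
    also have "\<dots> \<le> sum f {m..m + n}" using f0 by (intro sum_mono2) (auto intro: less_imp_le)
    finally show ?thesis using n that[of "m + n"] by simp
  qed
  define T where "T = sum f {m..n}"
  have "0 < 2 * pi * (1 - a) / \<epsilon>" using a \<epsilon> by simp
  then have T: "0 < T" using n(2) by (simp only: T_def)
  \<comment> \<open>Normalised so that the coefficients of u in the limits u / (2 * Y k) of the
    blocks add up to 1 - a.\<close>
  define C where "C = 2 * pi * (1 - a) / T"
  have C: "0 < C" "C \<le> \<epsilon>" using a T n(2) \<epsilon> by (simp_all add: C_def T_def[symmetric] field_simps)
  let ?c = "\<lambda>k. C * L k / pi" and ?h = "\<lambda>k. 1 / (2 * Y k)"
    and ?far = "\<lambda>k u. 1 / (1 - 1/l)\<^sup>2 * (Re u / (2 * Y k))"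
  define \<Psi> where "\<Psi> u = (\<Sum>k=m..n. of_real (?c k) * block s (Y k) u)" for u
  have b: "(\<Sum>k=m..n. ?c k * ?h k) = 1 - a"
  proof -
    have "(\<Sum>k=m..n. ?c k * ?h k) = (\<Sum>k=m..n. C / (2 * pi) * f k)"
      by (intro sum.cong) (auto simp flip: Lf)
    also have "\<dots> = C / (2 * pi) * T" by (simp only: T_def sum_distrib_left)
    also have "\<dots> = 1 - a" using T by (simp add: C_def)
    finally show ?thesis .
  qed
  have Re\<Psi>: "Re (\<Psi> u) = (\<Sum>k=m..n. ?c k * Re (block s (Y k) u))" for u
    unfolding \<Psi>_def by (simp only: Re_sum times_complex.sel Re_complex_of_real Im_complex_of_real) simp
  have cL: "0 \<le> ?c k" for k using C L(1)[of k] by simp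
  show ?thesis
  proof (rule that[of \<Psi> "\<Sum>k=m..n. ?c k * pi"])
    show "\<Psi> holomorphic_on {u. 0 < Re u}" unfolding \<Psi>_def by (intro holomorphic_intros s)
    show "Re (\<Psi> u) \<le> (\<Sum>k=m..n. ?c k * pi)" if "0 < Re u" for u
      unfolding Re\<Psi> by (intro sum_mono mult_left_mono Re_block_le_pi s that Y0 cL)
  next
    fix u :: complex assume u: "0 < Re u"
    \<comment> \<open>The near intervals. For all others the Poisson kernel is within the factor 1 /
      (1 - 1/l)^2 of its far limit, for which \<open>l\<close> was chosen to compensate.\<close>
    define J where "J = {k \<in> {m..n}. Y k < l * (s * Im u)}"
    define F where "F = {k \<in> {m..n}. \<not> Y k < l * (s * Im u)}"
    have split: "Re (\<Psi> u) = (\<Sum>k\<in>J. ?c k * Re (block s (Y k) u)) + (\<Sum>k\<in>F. ?c k * Re (block s (Y k) u))"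
      unfolding Re\<Psi> J_def F_def by (subst sum.union_disjoint[symmetric]) (auto intro!: sum.cong)
    have "(\<Sum>k\<in>F. ?c k * Re (block s (Y k) u)) \<le> (\<Sum>k\<in>F. ?c k * ?far k u)"
      by (intro sum_mono mult_left_mono Re_block_le_far s u Y0 l(1) cL) (auto simp: F_def)
    also have "\<dots> \<le> (\<Sum>k=m..n. ?c k * ?far k u)"
    proof (rule sum_mono2)
      fix k
      have "0 \<le> Re u / (2 * Y k)" "0 \<le> 1 / (1 - 1/l)\<^sup>2" using u Y0[of k] by simp_all
      then show "0 \<le> ?c k * ?far k u"
        by (intro mult_nonneg_nonneg cL)
    qed (auto simp: F_def)
    also have "\<dots> = 1 / (1 - 1/l)\<^sup>2 * Re u * (\<Sum>k=m..n. ?c k * ?h k)"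
      unfolding sum_distrib_left by (intro sum.cong) (simp_all add: field_simps)
    also have "\<dots> = (1 / (1 - 1/l)\<^sup>2 * (1 - a)) * Re u" unfolding b by simp
    also have "\<dots> \<le> (1 - a / 2) * Re u" using l(2) u by (intro mult_right_mono) auto
    finally have far: "(\<Sum>k\<in>F. ?c k * Re (block s (Y k) u)) \<le> (1 - a / 2) * Re u" .
    show "Re (\<Psi> u) \<le> (1 - a / 2) * Re u \<or>
       (\<exists>k. M \<le> Y k \<and> Y k < l * (s * Im u) \<and> Re (\<Psi> u) \<le> (1 - a / 2) * Re u + \<epsilon> * L k)"
    proof (cases "J = {}")
      case True
      then show ?thesis using far split by simp
    next
      case False
      define k where "k = Max J"
      have finJ: "finite J" by (simp add: J_def)
      have kJ: "k \<in> J" unfolding k_def using finJ False by (rule Max_in)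
      have kmax: "i \<le> k" if "i \<in> J" for i unfolding k_def using finJ that by (rule Max_ge)
      define A where "A y = arctan ((y - s * Im u) / Re u)" for y
      have A_mono: "A x \<le> A y" if "x \<le> y" for x y using u that by (simp add: A_def arctan_le_iff divide_right_mono)
      \<comment> \<open>Since \<open>2 * Y i \<le> Y (Suc i)\<close>, the segments do not overlap
        and their visual angles telescope to at most pi. As \<open>L\<close> is monotone, the
        largest near index \<open>k\<close> has the largest coefficient, so all near blocks together
        contribute at most \<open>C * L k\<close>.\<close>
      have "(\<Sum>i\<in>J. Re (block s (Y i) u)) \<le> (\<Sum>i=m..n. Re (block s (Y i) u))"
        by (intro sum_mono2) (auto simp: J_def intro!: Re_block_nonneg s u Y0)
      also have "\<dots> \<le> (\<Sum>i=m..n. A (Y (Suc i)) - A (Y i))"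
      proof (rule sum_mono)
        fix i show "Re (block s (Y i) u) \<le> A (Y (Suc i)) - A (Y i)"
          unfolding Re_block[OF s u Y0] A_def[symmetric] using A_mono[OF Y2[of i]] by simp
      qed
      also have "\<dots> = A (Y (Suc n)) - A (Y m)" using n(1) by (intro sum_Suc_diff) simp
      also have "\<dots> \<le> pi" unfolding A_def
        using arctan_lbound[of "(Y m - s * Im u) / Re u"] arctan_ubound[of "(Y (Suc n) - s * Im u) / Re u"] by linarith
      finally have pi: "(\<Sum>i\<in>J. Re (block s (Y i) u)) \<le> pi" .
      have "(\<Sum>i\<in>J. ?c i * Re (block s (Y i) u)) \<le> (\<Sum>i\<in>J. ?c k * Re (block s (Y i) u))"
        using C kmax monoD[OF L(2)]
        by (intro sum_mono mult_right_mono divide_right_mono mult_left_mono Re_block_nonneg s u Y0) auto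
      also have "\<dots> = ?c k * (\<Sum>i\<in>J. Re (block s (Y i) u))" by (simp only: sum_distrib_left)
      also have "\<dots> \<le> ?c k * pi" by (intro mult_left_mono pi cL)
      also have "\<dots> \<le> \<epsilon> * L k" using C L(1)[of k] by simp
      finally have "Re (\<Psi> u) \<le> (1 - a / 2) * Re u + \<epsilon> * L k" using far split by linarith
      moreover have "M \<le> Y k" "Y k < l * (s * Im u)" using kJ Ym by (auto simp: J_def)
      ultimately show ?thesis by blast
    qed
  next
    fix u :: complex assume u: "0 < Re u" "norm u \<le> M / 2"
    have YM: "M / 2 \<le> Y k - norm u" "norm u < Y k" if "k \<in> {m..n}" for k
      using Ym[of k] that u M by auto
    have "\<Psi> u - of_real (1 - a) * u = (\<Sum>k=m..n. of_real (?c k) * (block s (Y k) u - u / of_real (2 * Y k)))"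
      unfolding b[symmetric] \<Psi>_def of_real_sum sum_distrib_right sum_subtractf[symmetric]
      by (intro sum.cong) (simp_all add: algebra_simps)
    also have "norm \<dots> \<le> (\<Sum>k=m..n. ?c k * ?h k * (4 * (norm u)\<^sup>2 / M))"
    proof (rule sum_norm_le)
      fix k assume k: "k \<in> {m..n}"
      have "norm (of_real (?c k) * (block s (Y k) u - u / of_real (2 * Y k)))
         = ?c k * norm (block s (Y k) u - u / of_real (2 * Y k))"
        using cL[of k] by (simp only: norm_mult norm_of_real abs_of_nonneg)
      also have "\<dots> \<le> ?c k * ((norm u)\<^sup>2 / (Y k * (Y k - norm u)))"
        by (intro mult_left_mono cL block_approx s u YM k)
      also have "\<dots> \<le> ?c k * ((norm u)\<^sup>2 / (Y k * (M / 2)))"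
        using YM[OF k] M Y0[of k] by (intro mult_left_mono cL divide_left_mono mult_pos_pos) auto
      also have "\<dots> = ?c k * ?h k * (4 * (norm u)\<^sup>2 / M)"
        by (simp add: field_simps)
      finally show "norm (of_real (?c k) * (block s (Y k) u - u / of_real (2 * Y k)))
        \<le> ?c k * ?h k * (4 * (norm u)\<^sup>2 / M)" .
    qed
    also have "\<dots> = (1 - a) * (4 * (norm u)\<^sup>2 / M)" unfolding sum_distrib_right[symmetric] b ..
    also have "\<dots> \<le> 1 * (4 * (norm u)\<^sup>2 / M)" using a M by (intro mult_right_mono) auto
    finally show "norm (\<Psi> u - of_real (1 - a) * u) \<le> 4 * (norm u)\<^sup>2 / M" by simp
  qed
qed

section \<open>Cyclicity when the integral diverges\<close>

lemma shell_union: "(\<Union>k. {1 / 4 ^ Suc k..<1 / 4 ^ k}) = {0<..<1::real}"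
proof (intro equalityI subsetI)
  fix t :: real assume "t \<in> (\<Union>k. {1 / 4 ^ Suc k..<1 / 4 ^ k})"
  then obtain k where k: "1 / 4 ^ Suc k \<le> t" "t < 1 / 4 ^ k" by auto
  have "0 < (1::real) / 4 ^ Suc k" "1 / 4 ^ k \<le> (1::real)" by simp_all
  then show "t \<in> {0<..<1}" using k by (simp only: greaterThanLessThan_iff) linarith
next
  fix t :: real assume t: "t \<in> {0<..<1}"
  obtain n where "(1/4) ^ n < t" using real_arch_pow_inv[of t "1/4"] t by auto
  then have n: "1 / 4 ^ n \<le> t" by (simp add: power_one_over)
  define k where "k = (LEAST n. 1 / 4 ^ n \<le> t)"
  have k: "1 / 4 ^ k \<le> t" unfolding k_def by (rule LeastI[of "\<lambda>n. 1 / 4 ^ n \<le> t", OF n])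
  then have "k \<noteq> 0" using t by (intro notI) simp
  then obtain j where j: "k = Suc j" using not0_implies_Suc by blast
  have "\<not> 1 / 4 ^ j \<le> t" using not_less_Least[of j "\<lambda>n. 1 / 4 ^ n \<le> t"] j by (simp add: k_def)
  then show "t \<in> (\<Union>k. {1 / 4 ^ Suc k..<1 / 4 ^ k})" using k j by (auto intro!: exI[of _ j])
qed

lemma shell_disjoint: "disjoint_family (\<lambda>k. {1 / 4 ^ Suc k..<1 / 4 ^ k :: real})"
proof -
  have "{1 / 4 ^ Suc j..<1 / 4 ^ j :: real} \<inter> {1 / 4 ^ Suc k..<1 / 4 ^ k} = {}" if "j < k" for j k :: nat
  proof -
    have "1 / 4 ^ k \<le> (1 :: real) / 4 ^ Suc j" using that by (intro divide_left_mono power_increasing) auto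
    then show ?thesis by auto
  qed
  then show ?thesis unfolding disjoint_family_on_def by (metis inf_commute nat_neq_iff)
qed

text \<open>On the shell between 4^-(k+1) and 4^-k the integrand is monotone, hence lies between its
  end values, and the shell has length 3/4 * 4^-k. This gives 3/4 of the k-th term from below and 3
  times the next term from above.\<close>

lemma integral_sqrt_infinite_iff:
  fixes \<Lambda> :: "real \<Rightarrow> real"
  assumes pos: "\<And>t. t \<in> {0<..1} \<Longrightarrow> 0 < \<Lambda> t" and anti: "antimono_on {0<..1} \<Lambda>" and cont: "continuous_on {0<..1} \<Lambda>"
  shows "(\<integral>\<^sup>+t\<in>{0<..<1}. ennreal (sqrt (\<Lambda> t / t)) \<partial>lborel) = \<infinity> \<longleftrightarrow> \<not> summable (\<lambda>k. sqrt (\<Lambda> (1 / 4 ^ k)) / 2 ^ k)"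
proof -
  define a where "a k = sqrt (\<Lambda> (1 / 4 ^ k)) / 2 ^ k" for k
  define I where "I k = {1 / 4 ^ Suc k..<1 / 4 ^ k :: real}" for k
  define f where "f t = ennreal (sqrt (\<Lambda> t / t)) * indicator {0<..<1} t" for t
  have q: "1 / 4 ^ k \<in> {0<..1::real}" for k by simp
  have a0: "0 \<le> a k" for k using pos[OF q, of k] by (simp add: a_def)
  have mf: "f \<in> borel_measurable borel" unfolding f_def
    by (intro borel_measurable_ennreal_indicator continuous_intros continuous_on_subset[OF cont]) auto
  have mem: "t \<in> {0<..<1}" if "t \<in> I k" for t k using that shell_union unfolding I_def by blast
  have emI: "emeasure lborel (I k) = ennreal (3 / 4 / 4 ^ k)" for k by (simp add: I_def field_simps)
  have sq: "sqrt (4 ^ k) = (2 ^ k :: real)" for k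
  proof -
    have "sqrt (4 ^ k) = sqrt 4 ^ k" by (rule real_sqrt_power)
    also have "sqrt 4 = (2::real)" using real_sqrt_abs[of 2] by simp
    finally show ?thesis .
  qed
  have four: "(4::real) ^ k = 2 ^ k * 2 ^ k" for k by (simp flip: power_mult_distrib)
  let ?J = "\<lambda>k. \<integral>\<^sup>+t\<in>I k. f t \<partial>lborel"
  have upper: "?J k \<le> ennreal (3 * a (Suc k))" for k
  proof -
    have "?J k \<le> (\<integral>\<^sup>+t. ennreal (sqrt (\<Lambda> (1 / 4 ^ Suc k)) * 2 ^ Suc k) * indicator (I k) t \<partial>lborel)"
    proof (rule nn_integral_mono)
      fix t
      show "f t * indicator (I k) t \<le> ennreal (sqrt (\<Lambda> (1 / 4 ^ Suc k)) * 2 ^ Suc k) * indicator (I k) t"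
      proof (cases "t \<in> I k")
        case True
        then have t: "1 / 4 ^ Suc k \<le> t" "t \<in> {0<..1}" using mem[OF True] by (auto simp: I_def)
        have "\<Lambda> t \<le> \<Lambda> (1 / 4 ^ Suc k)" using monotone_onD[OF anti q[of "Suc k"] t(2) t(1)] .
        then have "\<Lambda> t / t \<le> \<Lambda> (1 / 4 ^ Suc k) / (1 / 4 ^ Suc k)"
          using t pos[OF t(2)] by (intro frac_le) auto
        then have "sqrt (\<Lambda> t / t) \<le> sqrt (\<Lambda> (1 / 4 ^ Suc k) * 4 ^ Suc k)" by simp
        also have "\<dots> = sqrt (\<Lambda> (1 / 4 ^ Suc k)) * 2 ^ Suc k" by (simp only: real_sqrt_mult sq)
        finally show ?thesis using True mem[OF True] by (simp only: f_def indicator_simps mult_1_right ennreal_leI)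
      qed simp
    qed
    also have "\<dots> = ennreal (sqrt (\<Lambda> (1 / 4 ^ Suc k)) * 2 ^ Suc k) * ennreal (3 / 4 / 4 ^ k)"
      unfolding emI[symmetric] by (rule nn_integral_cmult_indicator) (simp add: I_def)
    also have "\<dots> = ennreal (sqrt (\<Lambda> (1 / 4 ^ Suc k)) * 2 ^ Suc k * (3 / 4 / 4 ^ k))"
      by (rule ennreal_mult''[symmetric]) simp
    also have "sqrt (\<Lambda> (1 / 4 ^ Suc k)) * 2 ^ Suc k * (3 / 4 / 4 ^ k) = 3 * a (Suc k)"
      by (simp add: a_def four)
    finally show ?thesis .
  qed
  have lower: "ennreal (3 / 4 * a k) \<le> ?J k" for k
  proof -
    have "3 / 4 * a k = sqrt (\<Lambda> (1 / 4 ^ k)) * 2 ^ k * (3 / 4 / 4 ^ k)"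
      by (simp add: a_def four)
    then have "ennreal (3 / 4 * a k) = ennreal (sqrt (\<Lambda> (1 / 4 ^ k)) * 2 ^ k) * ennreal (3 / 4 / 4 ^ k)"
      by (simp only:) (rule ennreal_mult'', simp)
    also have "\<dots> = (\<integral>\<^sup>+t. ennreal (sqrt (\<Lambda> (1 / 4 ^ k)) * 2 ^ k) * indicator (I k) t \<partial>lborel)"
      unfolding emI[symmetric] by (rule nn_integral_cmult_indicator[symmetric]) (simp add: I_def)
    also have "\<dots> \<le> ?J k"
    proof (rule nn_integral_mono)
      fix t
      show "ennreal (sqrt (\<Lambda> (1 / 4 ^ k)) * 2 ^ k) * indicator (I k) t \<le> f t * indicator (I k) t"
      proof (cases "t \<in> I k")
        case True
        then have t: "t \<le> 1 / 4 ^ k" "t \<in> {0<..1}" using mem[OF True] by (auto simp: I_def)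
        have "\<Lambda> (1 / 4 ^ k) \<le> \<Lambda> t" using monotone_onD[OF anti t(2) q[of k] t(1)] .
        then have "\<Lambda> (1 / 4 ^ k) / (1 / 4 ^ k) \<le> \<Lambda> t / t"
          using t pos[OF q[of k]] pos[OF t(2)] by (intro frac_le) auto
        then have "sqrt (\<Lambda> (1 / 4 ^ k) * 4 ^ k) \<le> sqrt (\<Lambda> t / t)" by simp
        moreover have "sqrt (\<Lambda> (1 / 4 ^ k) * 4 ^ k) = sqrt (\<Lambda> (1 / 4 ^ k)) * 2 ^ k" by (simp only: real_sqrt_mult sq)
        ultimately show ?thesis using True mem[OF True] by (simp only: f_def indicator_simps mult_1_right ennreal_leI)
      qed simp
    qed
    finally show ?thesis .
  qed
  have "(\<integral>\<^sup>+t\<in>{0<..<1}. ennreal (sqrt (\<Lambda> t / t)) \<partial>lborel) = (\<integral>\<^sup>+t\<in>(\<Union>k. I k). f t \<partial>lborel)"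
    unfolding I_def shell_union by (intro nn_integral_cong) (simp add: f_def indicator_def)
  also have "\<dots> = (\<Sum>k. ?J k)"
    by (rule nn_integral_disjoint_family) (use mf shell_disjoint in \<open>auto simp: I_def\<close>)
  finally have eq: "(\<integral>\<^sup>+t\<in>{0<..<1}. ennreal (sqrt (\<Lambda> t / t)) \<partial>lborel) = (\<Sum>k. ?J k)" .
  show ?thesis
  proof (cases "summable a")
    case True
    have "(\<Sum>k. ?J k) \<le> (\<Sum>k. ennreal (3 * a (Suc k)))"
      by (intro suminf_le upper) auto
    also have "\<dots> = ennreal (\<Sum>k. 3 * a (Suc k))"
      using True a0 by (intro suminf_ennreal2 summable_mult) (auto simp: summable_Suc_iff)
    finally have "(\<Sum>k. ?J k) \<noteq> \<infinity>" by (auto simp: top_unique)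
    then show ?thesis using True eq by (simp add: a_def[abs_def])
  next
    case False
    have "(\<Sum>k. ennreal (3 / 4 * a k)) \<le> (\<Sum>k. ?J k)"
      by (intro suminf_le lower) auto
    moreover have "(\<Sum>k. ennreal (3 / 4 * a k)) = top"
    proof (rule ccontr)
      assume "(\<Sum>k. ennreal (3 / 4 * a k)) \<noteq> top"
      then have "summable (\<lambda>k. 3 / 4 * a k)" using a0 by (intro summable_suminf_not_top) auto
      then have "summable (\<lambda>k. 4 / 3 * (3 / 4 * a k))" by (rule summable_mult)
      then show False using False by simp
    qed
    ultimately show ?thesis using False eq by (simp add: a_def[abs_def] top_unique)
  qed
qed

text \<open>The point 1 may be an end point of the arc, so only one side is guaranteed; \<sigma>
  records which one.\<close>

lemma one_sided_arc:
  assumes "nontrivial_closed_arc E" "1 \<in> E"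
  obtains \<sigma> \<theta>0 :: real where "\<bar>\<sigma>\<bar> = 1" "0 < \<theta>0" "\<And>\<theta>. \<theta> \<in> {0..\<theta>0} \<Longrightarrow> cis (\<sigma> * \<theta>) \<in> E"
proof -
  obtain a b where ab: "a < b" "E = cis ` {a..b}" using assms(1) by (auto simp: nontrivial_closed_arc_def)
  then obtain t where t: "t \<in> {a..b}" "cis t = 1" using assms(2) by auto
  have c: "cis x = cis (t + x)" for x by (simp add: t(2) flip: cis_mult)
  show ?thesis
  proof (cases "t < b")
    case True
    show ?thesis
    proof (rule that[of 1 "b - t"])
      fix \<theta> assume "\<theta> \<in> {0..b - t}"
      then have "t + \<theta> \<in> {a..b}" using t by auto
      then show "cis (1 * \<theta>) \<in> E" using c[of \<theta>] by (simp add: ab(2))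
    qed (use True in auto)
  next
    case False
    show ?thesis
    proof (rule that[of "-1" "t - a"])
      fix \<theta> assume "\<theta> \<in> {0..t - a}"
      then have "t + (-\<theta>) \<in> {a..b}" using t by auto
      then show "cis (-1 * \<theta>) \<in> E" using c[of "-\<theta>"] by (simp add: ab(2))
    qed (use False ab t in auto)
  qed
qed

section \<open>The Cayley transform and the distance to a one-sided arc\<close>

definition cayley :: "complex \<Rightarrow> complex" where "cayley z = (1 + z) / (1 - z)"

lemma Re_cayley: "z \<noteq> 1 \<Longrightarrow> Re (cayley z) = (1 - (norm z)\<^sup>2) / (norm (1 - z))\<^sup>2"
  by (simp add: cayley_def Re_divide cmod_power2) (simp add: power2_eq_square algebra_simps diff_divide_distrib)

lemma Re_cayley_pos:
  assumes "z \<in> ball 0 1"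
  shows "0 < Re (cayley z)"
proof -
  have "z \<noteq> 1" "norm z < 1" using assms by auto
  then show ?thesis by (simp add: Re_cayley abs_square_less_1)
qed

lemma holomorphic_on_cayley: "cayley holomorphic_on ball 0 1"
  unfolding cayley_def[abs_def] by (intro holomorphic_intros) auto

lemma atomic_inner_eq: "atomic_inner z = exp (- cayley z)"
  by (simp add: atomic_inner_def cayley_def)

lemma norm_exp_minus_cayley_le: 
  assumes "z \<in> ball 0 1" "0 \<le> a"
  shows "norm (exp (- (of_real a * cayley z))) \<le> 1"
  using Re_cayley_pos[OF assms(1)] assms(2) by simp

lemma atomic_inner_continuous: "continuous_on (ball 0 1) atomic_inner"
  unfolding atomic_inner_eq[abs_def] by (intro continuous_intros holomorphic_on_imp_continuous_on holomorphic_on_cayley)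

lemma norm_atomic_inner_le: "z \<in> ball 0 1 \<Longrightarrow> norm (atomic_inner z) \<le> 1"
  using norm_exp_minus_cayley_le[of z 1] by (simp add: atomic_inner_eq)

text \<open>The half-angle formulas with tangent 1/h: the circle point that \<open>cayley\<close>
  sends to i \<sigma> h lies at angle 2 arctan (1/h) from 1, on the side \<sigma>.\<close>

lemma cis_cayley:
  assumes \<sigma>: "\<bar>\<sigma>\<bar> = 1" and h: "0 < h"
  shows "cis (\<sigma> * (2 * arctan (1 / h))) = (\<i> * of_real (\<sigma> * h) - 1) / (\<i> * of_real (\<sigma> * h) + 1)"
proof -
  define t where "t = arctan (1 / h)"
  have ss: "\<sigma>\<^sup>2 = 1" using \<sigma> by (metis power2_abs one_power2)
  have r: "sqrt (1 + (1 / h)\<^sup>2) > 0" by (simp add: add_pos_nonneg)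
  have sq: "(sqrt (1 + (1 / h)\<^sup>2))\<^sup>2 = 1 + (1 / h)\<^sup>2" by (intro real_sqrt_pow2) (simp add: add_nonneg_nonneg)
  have h2: "h\<^sup>2 + 1 \<noteq> 0" using h by (simp add: add_nonneg_eq_0_iff)
  have "cos (2 * t) = 2 * (cos t)\<^sup>2 - 1" by (rule cos_double_cos)
  also have "(cos t)\<^sup>2 = 1 / (1 + (1 / h)\<^sup>2)" unfolding t_def cos_arctan power_divide sq by simp
  finally have c: "cos (2 * t) = (h\<^sup>2 - 1) / (h\<^sup>2 + 1)" using h h2 by (simp add: field_simps)
  have "sin (2 * t) = 2 * ((1 / h) / (sqrt (1 + (1 / h)\<^sup>2))\<^sup>2)"
    by (simp only: sin_double t_def sin_arctan cos_arctan) (simp add: power2_eq_square)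
  then have s: "sin (2 * t) = 2 * h / (h\<^sup>2 + 1)" unfolding sq using h h2 by (simp add: field_simps power2_eq_square)
  have "cos (\<sigma> * (2 * t)) = cos (2 * t)" "sin (\<sigma> * (2 * t)) = \<sigma> * sin (2 * t)"
    using \<sigma> by (auto simp: abs_if split: if_splits)
  then have "cis (\<sigma> * (2 * t)) = of_real ((h\<^sup>2 - 1) / (h\<^sup>2 + 1)) + \<i> * of_real (\<sigma> * (2 * h / (h\<^sup>2 + 1)))"
    using c s by (simp add: complex_eq_iff)
  also have "\<dots> = (of_real (h\<^sup>2 - 1) + \<i> * of_real (2 * \<sigma> * h)) / of_real (h\<^sup>2 + 1)"
    by (simp add: add_divide_distrib)
  also have "\<dots> = (\<i> * of_real (\<sigma> * h) - 1) / (\<i> * of_real (\<sigma> * h) + 1)"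
  proof -
    have nz: "\<i> * of_real (\<sigma> * h) + 1 \<noteq> 0" by (simp add: complex_eq_iff)
    have nz2: "complex_of_real (h\<^sup>2 + 1) \<noteq> 0" using h2 by (simp only: of_real_eq_0_iff not_False_eq_True)
    have "(of_real (h\<^sup>2 - 1) + \<i> * of_real (2 * \<sigma> * h)) * (\<i> * of_real (\<sigma> * h) + 1) = (\<i> * of_real (\<sigma> * h) - 1) * complex_of_real (h\<^sup>2 + 1)"
      using ss by (simp add: complex_eq_iff power2_eq_square algebra_simps)
    then show ?thesis using nz nz2 by (simp only: frac_eq_eq not_False_eq_True)
  qed
  finally show ?thesis by (simp add: t_def)
qed

text \<open>The competitor on the arc is the preimage of v = i Im u. Its distance from z is 2 |u -
  v| / (|u + 1| |v + 1|), where u - v is Re u and both factors below are at least |Im u|. The height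
  condition makes its angle 2 arctan (1/h) at most \<open>\<theta>0\<close>.\<close>

lemma infdist_one_sided_arc_le:
  assumes \<sigma>: "\<bar>\<sigma>\<bar> = 1" and \<theta>0: "0 < \<theta>0" and E: "\<And>\<theta>. \<theta> \<in> {0..\<theta>0} \<Longrightarrow> cis (\<sigma> * \<theta>) \<in> E"
    and z: "z \<in> ball 0 1" and u: "u = cayley z" and h: "2 / \<theta>0 \<le> \<sigma> * Im u"
  shows "infdist z E \<le> 2 * Re u / (Im u)\<^sup>2"
proof -
  define h where "h = \<sigma> * Im u"
  have "0 < 2 / \<theta>0" using \<theta>0 by simp
  then have h0: "0 < h" using h unfolding h_def by linarith
  have ss: "\<sigma> * \<sigma> = 1" using \<sigma> by (metis abs_mult_self_eq mult_1)
  have Im: "\<sigma> * h = Im u" by (simp add: h_def ss flip: mult.assoc)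
  have hI: "h = \<bar>Im u\<bar>" using h0 \<sigma> by (metis h_def abs_mult abs_of_pos mult_1)
  define v where "v = \<i> * of_real (Im u)"
  have "arctan (1 / h) \<le> 1 / h" using h0 by (intro arctan_le_self) simp
  also have "2 * (1 / h) \<le> \<theta>0" using h h0 \<theta>0 by (simp add: h_def[symmetric] field_simps)
  finally have "2 * arctan (1 / h) \<in> {0..\<theta>0}" using h0 by simp
  from E[OF this] have "(v - 1) / (v + 1) \<in> E" using cis_cayley[OF \<sigma> h0] by (simp only: Im v_def)
  then have "infdist z E \<le> dist z ((v - 1) / (v + 1))" by (rule infdist_le)
  also have "\<dots> = 2 * norm (u - v) / (norm (u + 1) * norm (v + 1))"
  proof -
    have z1: "1 - z \<noteq> 0" using z by auto
    have u1: "u + 1 = 2 / (1 - z)" using z1 by (simp add: u cayley_def field_simps)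
    then have u1': "u + 1 \<noteq> 0" using z1 by simp
    have "(u - 1) = 2 * z / (1 - z)" using z1 by (simp add: u cayley_def field_simps)
    then have "z = (u - 1) / (u + 1)" using z1 u1 by simp
    moreover have v1: "v + 1 \<noteq> 0" by (simp add: v_def complex_eq_iff)
    ultimately have "z - (v - 1) / (v + 1) = 2 * (u - v) / ((u + 1) * (v + 1))"
      using u1' by (simp add: diff_frac_eq) (simp add: algebra_simps)
    then show ?thesis by (simp only: dist_norm norm_divide norm_mult norm_numeral)
  qed
  also have "u - v = of_real (Re u)" by (simp add: v_def complex_eq_iff)
  also have "2 * norm (complex_of_real (Re u)) / (norm (u + 1) * norm (v + 1)) \<le> 2 * \<bar>Re u\<bar> / (h * h)"
  proof -
    have "h \<le> norm (u + 1)" "h \<le> norm (v + 1)"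
      using abs_Im_le_cmod[of "u + 1"] abs_Im_le_cmod[of "v + 1"] by (simp_all add: hI v_def)
    moreover from this have "u + 1 \<noteq> 0" "v + 1 \<noteq> 0" using h0 by (metis norm_zero not_le)+
    ultimately show ?thesis using h0 by (simp only: norm_of_real) (intro divide_left_mono mult_mono mult_pos_pos; simp)
  qed
  also have "h * h = (Im u)\<^sup>2" by (simp add: hI power2_eq_square)
  also have "\<bar>Re u\<bar> = Re u" using Re_cayley_pos[OF z] by (simp add: u)
  finally show ?thesis .
qed

abbreviation poly_multiples :: "(complex \<Rightarrow> complex) \<Rightarrow> (complex \<Rightarrow> complex) set" where
  "poly_multiples F \<equiv> {h. \<exists>q :: complex poly. h = (\<lambda>z. poly q z * F z)}"

section \<open>The weight attached to the arc\<close>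

locale arc_weight =
  fixes E :: "complex set" and p :: real and \<Lambda> :: "real \<Rightarrow> real"
  assumes arc: "nontrivial_closed_arc E" and one_in_E: "1 \<in> E" and p: "1 \<le> p"
    and \<Lambda>_pos: "\<And>t. t \<in> {0<..1} \<Longrightarrow> 0 < \<Lambda> t"
    and \<Lambda>_antimono: "antimono_on {0<..1} \<Lambda>"
    and \<Lambda>_cont: "continuous_on {0<..1} \<Lambda>"
begin

definition \<delta> :: "complex \<Rightarrow> real" where "\<delta> z = min (infdist z E) 1"

definition wt :: "complex \<Rightarrow> real" where "wt z = exp (- p * \<Lambda> (\<delta> z))"

lemma E_circle: "E \<subseteq> sphere 0 1" "E \<noteq> {}"
  using arc one_in_E by (auto simp: nontrivial_closed_arc_def)

lemma \<Lambda>_antimonoD: "0 < s \<Longrightarrow> s \<le> t \<Longrightarrow> t \<le> 1 \<Longrightarrow> \<Lambda> t \<le> \<Lambda> s"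
  using monotone_onD[OF \<Lambda>_antimono, of s t] by simp

lemma infdist_E_ge: "1 - norm z \<le> infdist z E"
  by (rule infdist_unit_circle_ge[OF E_circle])

lemma \<delta>_in: "z \<in> ball 0 1 \<Longrightarrow> \<delta> z \<in> {0<..1}"
  using infdist_E_ge[of z] by (auto simp: \<delta>_def)

sublocale disc_weight wt p
proof
  have "continuous_on (ball 0 1) (\<lambda>z. \<Lambda> (\<delta> z))"
  proof (rule continuous_on_compose2[OF \<Lambda>_cont])
    show "continuous_on (ball 0 1) \<delta>" unfolding \<delta>_def by (intro continuous_intros)
  qed (use \<delta>_in in auto)
  then show "continuous_on (ball 0 1) wt" unfolding wt_def by (intro continuous_intros)
  fix z :: complex assume "z \<in> ball 0 1"
  then show "wt z \<le> 1" using \<Lambda>_pos[OF \<delta>_in, of z] p by (simp add: wt_def)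
qed (use p in \<open>auto simp: wt_def\<close>)

lemma B_norm_pow_eq_N: "B_norm_pow \<Lambda> E p f = N f"
  by (simp add: B_norm_pow_def N_def wt_def \<delta>_def)

text \<open>Density of the polynomials. Close to E the contractions do not decrease the distance to
  E, so the weight does not drop; elsewhere the weight at the image is at least 1 / K, while the
  weight at \<open>z\<close> is at most 1.\<close>

lemma holomorphic_in_cyc_hull_one:
  assumes "f holomorphic_on ball 0 1" "N f < \<infinity>"
  shows "f \<in> cyc_hull (\<lambda>_. 1)"
proof -
  obtain c d where c: "norm c \<le> 1/2" and d: "d > 0"
    and contr: "\<And>z s. z \<in> ball 0 1 \<Longrightarrow> infdist z E \<le> d \<Longrightarrow> s \<in> {0..1} \<Longrightarrow>
       infdist z E \<le> infdist (of_real (1 - s) * z + of_real s * c) E"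
    using arc_contraction[OF arc] by blast
  \<comment> \<open>Since |c - z| is at most 2, the bound d/4 limits the motion to d/2, and points
    farther than d from E stay at distance at least d/2.\<close>
  define s0 where "s0 = min (1/2) (d/4)"
  define K where "K = exp (p * \<Lambda> (min (d/2) 1))"
  have m: "min (d/2) 1 \<in> {0<..1}" using d by auto
  have K: "1 \<le> K" using \<Lambda>_pos[OF m] p by (simp add: K_def)
  show ?thesis
  proof (rule in_cyc_hull_one_of_contraction[OF assms c, of s0 K])
    fix s :: real and z :: complex assume z: "z \<in> ball 0 1" and s: "0 < s" "s \<le> s0"
    define v where "v = of_real (1 - s) * z + of_real s * c"
    have s1: "s \<le> 1/2" "s \<le> d/4" using s by (auto simp: s0_def)
    have "norm v \<le> (1 - s) * norm z + s * norm c"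
      unfolding v_def using s s1 by (intro order_trans[OF norm_triangle_ineq]) (simp add: norm_mult del: of_real_diff)
    also have "\<dots> < (1 - s) * 1 + s * 1"
      using s s1 z c by (intro add_less_le_mono mult_strict_left_mono mult_left_mono) auto
    finally have v: "v \<in> ball 0 1" by simp
    show "wt z \<le> K * wt v"
    proof (cases "infdist z E \<le> d")
      case True
      then have "infdist z E \<le> infdist v E" using contr[OF z True, of s] s s1 by (simp add: v_def)
      then have "\<delta> z \<le> \<delta> v" by (auto simp: \<delta>_def)
      then have "\<Lambda> (\<delta> v) \<le> \<Lambda> (\<delta> z)" using \<delta>_in[OF z] \<delta>_in[OF v] by (intro \<Lambda>_antimonoD) auto
      then have "wt z \<le> wt v" using p by (simp add: wt_def)
      also have "\<dots> \<le> K * wt v" using K w_pos[OF v] by simp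
      finally show ?thesis .
    next
      case False
      have "v - z = of_real s * (c - z)" by (simp add: v_def algebra_simps)
      then have "dist v z = s * norm (c - z)" using s by (simp add: dist_norm norm_mult)
      also have "\<dots> \<le> s * 2" using s norm_triangle_ineq4[of c z] c z by (intro mult_left_mono) auto
      also have "\<dots> \<le> d / 2" using s1 by simp
      finally have "d / 2 \<le> infdist v E" using False infdist_triangle[of z E v] by (simp add: dist_commute)
      then have "min (d/2) 1 \<le> \<delta> v" by (auto simp: \<delta>_def)
      then have "\<Lambda> (\<delta> v) \<le> \<Lambda> (min (d/2) 1)" using m \<delta>_in[OF v] by (intro \<Lambda>_antimonoD) auto
      then have "p * \<Lambda> (\<delta> v) \<le> p * \<Lambda> (min (d/2) 1)" using p by (intro mult_left_mono) auto
      then have "1 \<le> K * wt v" unfolding K_def wt_def by (simp flip: exp_add)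
      then show ?thesis using w_le_1[OF z] by simp
    qed
  qed (use d K in \<open>auto simp: s0_def\<close>)
qed

end

section \<open>Approximating 1 by polynomial multiples of the atomic inner function\<close>

context arc_weight
begin

lemma exp_cayley_in_cyc_hull:
  assumes div: "\<not> summable (\<lambda>k. sqrt (\<Lambda> (1 / 4 ^ k)) / 2 ^ k)" and a: "0 < a" "a < 1"
  shows "(\<lambda>z. exp (- (of_real a * cayley z))) \<in> cyc_hull atomic_inner"
proof -
  obtain \<sigma> \<theta>0 where \<sigma>: "\<bar>\<sigma>\<bar> = 1" and \<theta>0: "0 < \<theta>0" and arcE: "\<And>\<theta>. \<theta> \<in> {0..\<theta>0} \<Longrightarrow> cis (\<sigma> * \<theta>) \<in> E"
    using one_sided_arc[OF arc one_in_E] by blast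
  define L where "L k = \<Lambda> (1 / 4 ^ k)" for k :: nat
  define Y where "Y k = sqrt (L k) * 2 ^ k" for k
  \<comment> \<open>Then (1 - 1/l)^2 is at least 1 - a/2, and (1 - a) / (1 - a/2) is at most 1 -
    a/2, as the estimate of the far blocks requires.\<close>
  define l where "l = 4 / a"
  \<comment> \<open>Makes \<open>\<epsilon> * L k\<close> equal to a/2 times L k / (2 l^2), the
    value of Re u that separates the two cases of the domination.\<close>
  define \<epsilon> where "\<epsilon> = a / (4 * l\<^sup>2)"
  have L0: "0 < L k" for k unfolding L_def by (rule \<Lambda>_pos) simp
  have Lmono: "mono L" unfolding L_def
  proof (rule monoI)
    fix j k :: nat assume "j \<le> k"
    then have "1 / 4 ^ k \<le> (1::real) / 4 ^ j" by (intro divide_left_mono power_increasing) auto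
    then show "\<Lambda> (1 / 4 ^ j) \<le> \<Lambda> (1 / 4 ^ k)" by (intro \<Lambda>_antimonoD) auto
  qed
  have l: "1 < l" using a by (simp add: l_def)
  have l2: "1 / (1 - 1/l)\<^sup>2 * (1 - a) \<le> 1 - a / 2"
  proof -
    have "1 - a / 2 \<le> (1 - 1/l)\<^sup>2" by (simp add: l_def power2_eq_square algebra_simps)
    moreover have "0 < 1 - a / 2" using a by simp
    ultimately have "1 / (1 - 1/l)\<^sup>2 * (1 - a) \<le> 1 / (1 - a / 2) * (1 - a)"
      using a by (intro mult_right_mono divide_left_mono mult_pos_pos) auto
    also have "\<dots> \<le> 1 - a / 2"
    proof -
      have "1 - a \<le> (1 - a / 2) * (1 - a / 2)" by (simp add: algebra_simps)
      then show ?thesis using \<open>0 < 1 - a / 2\<close> by (simp add: divide_le_eq)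
    qed
    finally show ?thesis .
  qed
  have \<epsilon>: "0 < \<epsilon>" "\<epsilon> \<le> 1"
  proof -
    have "1 \<le> l\<^sup>2" using l by simp
    then have "a \<le> 4 * l\<^sup>2" using a by linarith
    then show "0 < \<epsilon>" "\<epsilon> \<le> 1" using a l by (auto simp: \<epsilon>_def divide_le_eq)
  qed
  \<comment> \<open>The summand with \<open>\<theta>0\<close> ensures that a near block forces
    \<open>\<sigma> * Im u\<close> above \<open>2 / \<theta>0\<close>, where the distance estimate
    for the arc holds; the summand \<open>n\<close> moves the window to infinity.\<close>
  define M where "M n = l * (2 / \<theta>0) + 1 + real n" for n :: nat
  have M0: "0 < M n" for n 
  proof -
    have "0 \<le> l * (2 / \<theta>0)" using l \<theta>0 by simp
    then show ?thesis by (simp add: M_def)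
  qed
  have "\<exists>\<Psi> B. \<Psi> holomorphic_on {u. 0 < Re u} \<and>
    (\<forall>u. 0 < Re u \<longrightarrow> Re (\<Psi> u) \<le> B) \<and>
    (\<forall>u. 0 < Re u \<longrightarrow> Re (\<Psi> u) \<le> (1 - a / 2) * Re u \<or>
       (\<exists>k. M n \<le> Y k \<and> Y k < l * (\<sigma> * Im u) \<and> Re (\<Psi> u) \<le> (1 - a / 2) * Re u + \<epsilon> * L k)) \<and>
    (\<forall>u. 0 < Re u \<longrightarrow> norm u \<le> M n / 2 \<longrightarrow> norm (\<Psi> u - of_real (1 - a) * u) \<le> 4 * (norm u)\<^sup>2 / M n)" for n
  proof -
    have div': "\<not> summable (\<lambda>k. sqrt (L k) / 2 ^ k)" using div by (simp add: L_def)
    show ?thesis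
      by (rule outer_log_exists[OF \<sigma> L0 Lmono div' a l l2 \<epsilon>(1) M0[of n]]) (unfold Y_def, blast)
  qed
  then obtain \<Psi> B where \<Psi>: "\<And>n. \<Psi> n holomorphic_on {u. 0 < Re u}"
    "\<And>n u. 0 < Re u \<Longrightarrow> Re (\<Psi> n u) \<le> B n"
    "\<And>n u. 0 < Re u \<Longrightarrow> Re (\<Psi> n u) \<le> (1 - a / 2) * Re u \<or>
       (\<exists>k. M n \<le> Y k \<and> Y k < l * (\<sigma> * Im u) \<and> Re (\<Psi> n u) \<le> (1 - a / 2) * Re u + \<epsilon> * L k)"
    "\<And>n u. 0 < Re u \<Longrightarrow> norm u \<le> M n / 2 \<Longrightarrow> norm (\<Psi> n u - of_real (1 - a) * u) \<le> 4 * (norm u)\<^sup>2 / M n"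
    by metis
  \<comment> \<open>Uniform domination: the left side is log |G S|, and the bound is exactly what
    the p-th root of the weight cancels.\<close>
  have key: "Re (\<Psi> n (cayley z)) - Re (cayley z) \<le> \<Lambda> (\<delta> z)" if z: "z \<in> ball 0 1" for n z
  proof -
    define u where "u = cayley z"
    have u: "0 < Re u" unfolding u_def by (rule Re_cayley_pos[OF z])
    have \<Lambda>0: "0 < \<Lambda> (\<delta> z)" by (rule \<Lambda>_pos[OF \<delta>_in[OF z]])
    have au: "0 < a / 2 * Re u" using a u by simp
    from \<Psi>(3)[OF u, of n] have "Re (\<Psi> n u) - Re u \<le> \<Lambda> (\<delta> z)"
    proof
      assume "Re (\<Psi> n u) \<le> (1 - a / 2) * Re u"
      then show ?thesis using au \<Lambda>0 by (simp add: algebra_simps)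
    next
      assume "\<exists>k. M n \<le> Y k \<and> Y k < l * (\<sigma> * Im u) \<and> Re (\<Psi> n u) \<le> (1 - a / 2) * Re u + \<epsilon> * L k"
      then obtain k where k: "M n \<le> Y k" "Y k < l * (\<sigma> * Im u)" "Re (\<Psi> n u) \<le> (1 - a / 2) * Re u + \<epsilon> * L k" by blast
      have le: "Re (\<Psi> n u) - Re u \<le> \<epsilon> * L k - a / 2 * Re u" using k(3) by (simp add: algebra_simps)
      show ?thesis
      proof (cases "L k / (2 * l\<^sup>2) \<le> Re u")
        case True
        have "\<epsilon> * L k = a / 2 * (L k / (2 * l\<^sup>2))" by (simp add: \<epsilon>_def)
        also have "\<dots> \<le> a / 2 * Re u" using True a by (intro mult_left_mono) auto
        finally show ?thesis using le \<Lambda>0 by linarith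
      next
        \<comment> \<open>Re u is small and |Im u| is above Y k / l, so \<open>z\<close> lies within
          4^-k of the arc. Hence \<open>\<Lambda> (\<delta> z)\<close> is at least
          \<open>L k\<close> and covers the near blocks by itself.\<close>
        case False
        have "l * (2 / \<theta>0) < l * (\<sigma> * Im u)" using k(1,2) by (simp add: M_def)
        then have h: "2 / \<theta>0 < \<sigma> * Im u" using l by (simp only: mult_less_cancel_left_pos)
        have Y0: "0 < Y k" using L0 by (simp add: Y_def)
        have "(Y k)\<^sup>2 < (l * (\<sigma> * Im u))\<^sup>2" using k(2) Y0 by (intro power_strict_mono) auto
        also have "\<dots> = l\<^sup>2 * (Im u)\<^sup>2"
        proof -
          have "\<sigma>\<^sup>2 = 1" using \<sigma> by (metis power2_abs one_power2)
          then show ?thesis by (simp add: power_mult_distrib)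
        qed
        also have "(Y k)\<^sup>2 = L k * 4 ^ k"
        proof -
          have "(2 ^ k)\<^sup>2 = (4 ^ k :: real)" by (simp add: power2_eq_square flip: power_mult_distrib)
          then show ?thesis using L0[of k] by (simp add: Y_def power_mult_distrib)
        qed
        finally have Y2: "L k * 4 ^ k < l\<^sup>2 * (Im u)\<^sup>2" .
        then have Im0: "0 < l\<^sup>2 * (Im u)\<^sup>2" using L0[of k] by (meson mult_pos_pos order_less_trans zero_less_numeral zero_less_power)
        then have Im0': "0 < (Im u)\<^sup>2" using l by (simp add: zero_less_mult_iff)
        have "2 * Re u \<le> L k / l\<^sup>2" using False by (simp add: not_le)
        then have "2 * Re u / (Im u)\<^sup>2 \<le> L k / l\<^sup>2 / (Im u)\<^sup>2" using Im0' by (intro divide_right_mono) auto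
        also have "\<dots> = L k / (l\<^sup>2 * (Im u)\<^sup>2)" by simp
        also have "\<dots> \<le> L k / (L k * 4 ^ k)" using Y2 Im0 L0[of k] by (intro divide_left_mono mult_pos_pos) auto
        also have "\<dots> = 1 / 4 ^ k" using L0[of k] by simp
        finally have "infdist z E \<le> 1 / 4 ^ k"
          using infdist_one_sided_arc_le[OF \<sigma> \<theta>0 arcE z, of u] h by (simp add: u_def)
        then have "\<delta> z \<le> 1 / 4 ^ k" by (simp add: \<delta>_def)
        then have "L k \<le> \<Lambda> (\<delta> z)" unfolding L_def using \<delta>_in[OF z] by (intro \<Lambda>_antimonoD) auto
        moreover have "\<epsilon> * L k \<le> 1 * L k" using \<epsilon> L0[of k] by (intro mult_right_mono) auto
        ultimately show ?thesis using le au by linarith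
      qed
    qed
    then show ?thesis by (simp add: u_def)
  qed
  have hol: "(\<lambda>z. exp (\<Psi> n (cayley z))) holomorphic_on ball 0 1" for n
  proof -
    have "cayley ` ball 0 1 \<subseteq> {u. 0 < Re u}" using Re_cayley_pos by blast
    from holomorphic_on_compose_gen[OF holomorphic_on_cayley \<Psi>(1)[of n] this]
    have "(\<lambda>z. \<Psi> n (cayley z)) holomorphic_on ball 0 1" by (simp add: o_def)
    then show ?thesis by (intro holomorphic_intros)
  qed
  show ?thesis
  proof (rule cyc_hull_closed[OF atomic_inner_continuous, where f = "\<lambda>n z. exp (\<Psi> n (cayley z)) * atomic_inner z"])
    show "(\<lambda>z. exp (\<Psi> n (cayley z)) * atomic_inner z) \<in> cyc_hull atomic_inner" for n
    proof (rule bounded_mult_in_cyc_hull[OF atomic_inner_continuous norm_atomic_inner_le hol, of n "exp (B n)"])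
      show "norm (exp (\<Psi> n (cayley z))) \<le> exp (B n)" if "z \<in> ball 0 1" for z
        using \<Psi>(2)[OF Re_cayley_pos[OF that], of n] by simp
    qed
    show cg: "continuous_on (ball 0 1) (\<lambda>z. exp (- (of_real a * cayley z)))"
      by (intro continuous_intros holomorphic_on_imp_continuous_on holomorphic_on_cayley)
    show "(\<lambda>n. N (\<lambda>z. exp (\<Psi> n (cayley z)) * atomic_inner z - exp (- (of_real a * cayley z)))) \<longlonglongrightarrow> 0"
    proof (rule N_dominated_convergence[OF _ cg, where C = 1])
      show "continuous_on (ball 0 1) (\<lambda>z. exp (\<Psi> n (cayley z)) * atomic_inner z)" for n
        by (intro continuous_on_mult atomic_inner_continuous holomorphic_on_imp_continuous_on hol)
    next
      fix z :: complex assume z: "z \<in> ball 0 1"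
      define u where "u = cayley z"
      have u: "0 < Re u" unfolding u_def by (rule Re_cayley_pos[OF z])
      have Mlim: "filterlim M at_top sequentially"
        unfolding M_def by (intro filterlim_tendsto_add_at_top[OF tendsto_const] filterlim_real_sequentially)
      have lim0: "(\<lambda>n. 4 * (norm u)\<^sup>2 / M n) \<longlonglongrightarrow> 0"
        by (rule real_tendsto_divide_at_top[OF tendsto_const Mlim])
      have "\<forall>\<^sub>F n in sequentially. 2 * norm u \<le> M n"
        using Mlim by (simp only: filterlim_at_top)
      then have "\<forall>\<^sub>F n in sequentially. norm (\<Psi> n u - of_real (1 - a) * u) \<le> 4 * (norm u)\<^sup>2 / M n"
        by (rule eventually_mono) (rule \<Psi>(4)[OF u], linarith)
      from Lim_null_comparison[OF this lim0] have "(\<lambda>n. \<Psi> n u - of_real (1 - a) * u) \<longlonglongrightarrow> 0" .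
      then have "(\<lambda>n. (\<Psi> n u - of_real (1 - a) * u) + (of_real (1 - a) * u - u)) \<longlonglongrightarrow> 0 + (of_real (1 - a) * u - u)"
        by (intro tendsto_add tendsto_const)
      then have "(\<lambda>n. exp (\<Psi> n u - u)) \<longlonglongrightarrow> exp (- (of_real a * u))"
        by (intro tendsto_exp) (simp add: algebra_simps)
      then show "(\<lambda>n. exp (\<Psi> n (cayley z)) * atomic_inner z) \<longlonglongrightarrow> exp (- (of_real a * cayley z))"
        by (simp add: u_def atomic_inner_eq flip: exp_add)
      fix n
      have "norm (exp (\<Psi> n (cayley z)) * atomic_inner z) = exp (Re (\<Psi> n (cayley z)) - Re (cayley z))"
        by (simp add: atomic_inner_eq norm_mult flip: exp_add)
      also have "\<dots> \<le> exp (\<Lambda> (\<delta> z))" using key[OF z, of n] by simp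
      finally have "norm (exp (\<Psi> n (cayley z)) * atomic_inner z) powr p \<le> exp (\<Lambda> (\<delta> z)) powr p"
        using p by (intro powr_mono2) auto
      also have "\<dots> = exp (p * \<Lambda> (\<delta> z))" by (simp add: powr_def)
      finally have "norm (exp (\<Psi> n (cayley z)) * atomic_inner z) powr p * wt z \<le> exp (p * \<Lambda> (\<delta> z)) * wt z"
        using w_pos[OF z] by (intro mult_right_mono) auto
      also have "\<dots> = 1" by (simp add: wt_def flip: exp_add)
      finally show "norm (exp (\<Psi> n (cayley z)) * atomic_inner z) powr p * wt z \<le> 1" .
    qed
  qed
qed

text \<open>The functions exp (-a u) are bounded by 1 and tend to 1 pointwise as a tends to
  0.\<close>

lemma one_in_cyc_hull:
  assumes div: "\<not> summable (\<lambda>k. sqrt (\<Lambda> (1 / 4 ^ k)) / 2 ^ k)"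
  shows "(\<lambda>_. 1) \<in> cyc_hull atomic_inner"
proof -
  let ?e = "\<lambda>n z. exp (- (of_real (1 / (real n + 2)) * cayley z))"
  show ?thesis
  proof (rule cyc_hull_closed[OF atomic_inner_continuous, where f = ?e])
    show "?e n \<in> cyc_hull atomic_inner" for n
      by (rule exp_cayley_in_cyc_hull[OF div]) auto
    show "(\<lambda>n. N (\<lambda>z. ?e n z - 1)) \<longlonglongrightarrow> 0"
    proof (rule N_dominated_convergence[where C = 1])
      show "continuous_on (ball 0 1) (?e n)" for n
        by (intro continuous_intros holomorphic_on_imp_continuous_on holomorphic_on_cayley)
      fix z :: complex assume z: "z \<in> ball 0 1"
      have "(\<lambda>n. 1 / (real n + 2)) \<longlonglongrightarrow> 0" by real_asymp
      then have "(\<lambda>n. ?e n z) \<longlonglongrightarrow> exp (- (of_real 0 * cayley z))"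
        by (intro tendsto_intros)
      then show "(\<lambda>n. ?e n z) \<longlonglongrightarrow> 1" by simp
      fix n
      have "norm (?e n z) \<le> 1"
        using norm_exp_minus_cayley_le[OF z, of "1 / (real n + 2)"] by simp
      then have "norm (?e n z) powr p \<le> 1 powr p"
        using p by (intro powr_mono2) auto
      then have "norm (?e n z) powr p * wt z \<le> 1 * 1"
        using w_pos[OF z] w_le_1[OF z] by (intro mult_mono) auto
      then show "norm (?e n z) powr p * wt z \<le> 1" by simp
    qed auto
  qed auto
qed

lemma atomic_inner_in_B_space: "atomic_inner \<in> B_space \<Lambda> E p"
  unfolding B_space_def B_norm_pow_eq_N
proof (intro CollectI conjI)
  show "atomic_inner holomorphic_on ball 0 1"
    unfolding atomic_inner_eq[abs_def] by (intro holomorphic_intros holomorphic_on_cayley)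
  show "N atomic_inner < \<infinity>" by (rule N_bounded_finite[OF norm_atomic_inner_le])
qed

lemma B_norm_less:
  assumes "N f < ennreal (\<epsilon> powr p)" "0 < \<epsilon>"
  shows "B_norm \<Lambda> E p f < \<epsilon>"
proof -
  have "enn2real (N f) < \<epsilon> powr p" using assms by (cases "N f") (auto simp: ennreal_less_iff)
  then have "enn2real (N f) powr (1 / p) < (\<epsilon> powr p) powr (1 / p)" using p by (intro powr_less_mono2) auto
  also have "\<dots> = \<epsilon>" using p assms by (simp add: powr_powr)
  finally show ?thesis by (simp add: B_norm_def B_norm_pow_eq_N)
qed

lemma cyclic_if_not_summable:
  assumes div: "\<not> summable (\<lambda>k. sqrt (\<Lambda> (1 / 4 ^ k)) / 2 ^ k)"
  shows "cyclic_in (B_space \<Lambda> E p) (B_norm \<Lambda> E p) atomic_inner"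
  unfolding cyclic_in_def
proof (intro conjI atomic_inner_in_B_space equalityI subsetI)
  fix f assume f: "f \<in> B_space \<Lambda> E p"
  then have "f \<in> cyc_hull (\<lambda>_. 1)"
    by (intro holomorphic_in_cyc_hull_one) (auto simp: B_space_def B_norm_pow_eq_N)
  then have hull: "f \<in> cyc_hull atomic_inner"
    by (rule cyc_hull_trans[OF atomic_inner_continuous one_in_cyc_hull[OF div]])
  have "\<exists>h\<in>poly_multiples atomic_inner. B_norm \<Lambda> E p (\<lambda>z. f z - h z) < \<epsilon>"
    if \<epsilon>: "\<epsilon> > 0" for \<epsilon>
  proof -
    have "\<epsilon> powr p > 0" using \<epsilon> by simp
    then obtain q :: "complex poly" where "N (\<lambda>z. f z - poly q z * atomic_inner z) < ennreal (\<epsilon> powr p)"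
      using hull unfolding cyc_hull_def by blast
    from B_norm_less[OF this \<epsilon>] show ?thesis
      by (intro bexI[of _ "\<lambda>z. poly q z * atomic_inner z"]) auto
  qed
  then show "f \<in> norm_closure (B_space \<Lambda> E p) (B_norm \<Lambda> E p) (poly_multiples atomic_inner)"
    using f by (simp add: norm_closure_def)
qed (simp add: norm_closure_def)

end

section \<open>Non-cyclicity when the integral converges\<close>

text \<open>The real part is at least 1 / |1 + Y w|^2, and with s = Y |w| the denominator is at most
  (1 + s)^2 <= 2 + 2 s^2; multiplied by r this is at most 4. The case r = 0 yields
  nonnegativity.\<close>

lemma Re_inverse_one_plus_ge:
  fixes w :: complex
  assumes "0 \<le> Re w" "0 \<le> Y" "0 \<le> r" "r \<le> 1" "r * (Y * norm w)\<^sup>2 \<le> 1"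
  shows "r / 4 \<le> Re (1 / (1 + of_real Y * w))"
proof -
  define s where "s = Y * norm w"
  define D where "D = (norm (1 + of_real Y * w))\<^sup>2"
  have num: "1 \<le> 1 + Y * Re w" using assms by simp
  have s0: "0 \<le> s" using assms by (simp add: s_def)
  have "1 \<le> norm (1 + of_real Y * w)"
    using num complex_Re_le_cmod[of "1 + of_real Y * w"] by simp
  then have D1: "1 \<le> D" by (simp add: D_def)
  have "norm (1 + of_real Y * w) \<le> 1 + s"
    using norm_triangle_ineq[of 1 "of_real Y * w"] assms by (simp add: s_def norm_mult)
  then have "D \<le> (1 + s)\<^sup>2" unfolding D_def by (intro power_mono) auto
  also have "\<dots> \<le> 2 + 2 * s\<^sup>2" 
    using zero_le_power2[of "1 - s"] by (simp add: power2_eq_square algebra_simps)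
  finally have "r * D \<le> r * (2 + 2 * s\<^sup>2)" using assms by (intro mult_left_mono) auto
  also have "\<dots> \<le> 4" using assms by (simp add: s_def algebra_simps)
  finally have "r / 4 \<le> 1 / D" using D1 by (simp add: field_simps)
  also have "\<dots> \<le> (1 + Y * Re w) / D" using num D1 by (intro divide_right_mono) auto
  also have "\<dots> = Re (1 / (1 + of_real Y * w))"
    by (simp add: Re_divide D_def cmod_power2)
  finally show ?thesis .
qed

lemma one_plus_mult_nonzero:
  fixes w :: complex
  assumes "0 \<le> Re w" "0 \<le> Y"
  shows "1 + of_real Y * w \<noteq> 0"
proof
  assume "1 + of_real Y * w = 0"
  then have "1 + Y * Re w = 0" by (simp add: complex_eq_iff)
  then show False using assms by (smt (verit) mult_nonneg_nonneg)
qed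

lemma shell_exists:
  assumes "t \<in> {0<..1::real}"
  obtains k where "1 / 4 ^ Suc k \<le> t" "t \<le> 1 / 4 ^ k"
proof (cases "t = 1")
  case True
  then show ?thesis using that[of 0] by simp
next
  case False
  then have "t \<in> (\<Union>k. {1 / 4 ^ Suc k..<1 / 4 ^ k})" unfolding shell_union using assms by auto
  then obtain k where "t \<in> {1 / 4 ^ Suc k..<1 / 4 ^ k}" by blast
  then show ?thesis using that[of k] by (simp del: power_Suc)
qed

section \<open>A Phragmen-Lindelof bound beyond the level curve of a radial exponent\<close>

locale radial_bound =
  fixes ell :: "real \<Rightarrow> real"
  assumes ell_pos: "\<And>t. t \<in> {0<..1} \<Longrightarrow> 0 < ell t"
    and ell_antimono: "antimono_on {0<..1} ell"
    and ell_cont: "continuous_on {0<..1} ell"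
    and ell_summable: "summable (\<lambda>k. sqrt (ell (1 / 4 ^ k)) / 2 ^ k)"
begin

text \<open>The shift by one takes the value at the smallest t of the k-th shell, which is the
  maximum of \<open>ell\<close> there.\<close>

definition lv :: "nat \<Rightarrow> real" where "lv k = ell (1 / 4 ^ Suc k)"
definition ht :: "nat \<Rightarrow> real" where "ht k = sqrt (lv k) * 2 ^ k"

text \<open>The logarithm of a holomorphic function without zeros whose modulus is at least 1 and at least
  \<open>exp (2 * ell)\<close> on the level curve \<open>Re (cayley z) = ell (1 - |z|)\<close>.\<close>

definition logh :: "nat \<Rightarrow> complex \<Rightarrow> complex" where
  "logh K z = (\<Sum>k<K. of_real (16 * lv k) * (1 / (1 + of_real (ht k) * (1 - z))))"

text \<open>The side of the level curve near 1. As \<open>ell\<close> is at least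
  \<open>ell 1 > 0\<close>, it lies in a horodisc at 1.\<close>

definition region :: "complex set" where
  "region = {z \<in> ball 0 1. ell (1 - norm z) < Re (cayley z)}"

lemma lv_pos: "0 < lv k"
  unfolding lv_def by (rule ell_pos) (simp del: power_Suc)

lemma ht_pos: "0 < ht k"
  using lv_pos by (simp add: ht_def)

lemma lv_div_ht: "lv k / ht k = sqrt (lv k) / 2 ^ k"
proof -
  have "r * r / (r * 2 ^ k) = r / 2 ^ k" if "0 < r" for r :: real using that by simp
  moreover have "lv k = sqrt (lv k) * sqrt (lv k)" using lv_pos[of k] by simp
  moreover have "0 < sqrt (lv k)" using lv_pos by simp
  ultimately show ?thesis unfolding ht_def by metis
qed

lemma lv_summable: "summable (\<lambda>k. lv k / ht k)"
proof -
  have "summable (\<lambda>k. sqrt (ell (1 / 4 ^ Suc k)) / 2 ^ Suc k)" using ell_summable by (subst summable_Suc_iff)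
  then have "summable (\<lambda>k. 2 * (sqrt (ell (1 / 4 ^ Suc k)) / 2 ^ Suc k))" by (rule summable_mult)
  moreover have "(\<lambda>k. lv k / ht k) = (\<lambda>k. 2 * (sqrt (ell (1 / 4 ^ Suc k)) / 2 ^ Suc k))"
    by (rule ext, subst lv_div_ht) (simp add: lv_def)
  ultimately show ?thesis by simp
qed

lemma ell_antimonoD: "0 < s \<Longrightarrow> s \<le> t \<Longrightarrow> t \<le> 1 \<Longrightarrow> ell t \<le> ell s"
  using monotone_onD[OF ell_antimono, of s t] by simp

text \<open>All summands have nonnegative real part for Re z <= 1, so a single one bounds the sum
  from below.\<close>

lemma Re_logh_ge:
  assumes "Re z \<le> 1" "k < K"
  shows "16 * lv k * Re (1 / (1 + of_real (ht k) * (1 - z))) \<le> Re (logh K z)"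
proof -
  have "0 \<le> Re (1 / (1 + of_real (ht j) * (1 - z)))" for j
    using Re_inverse_one_plus_ge[of "1 - z" "ht j" 0] assms less_imp_le[OF ht_pos[of j]] by simp
  then have nn: "0 \<le> 16 * lv j * Re (1 / (1 + of_real (ht j) * (1 - z)))" for j
    using lv_pos[of j] by (intro mult_nonneg_nonneg) auto
  have "Re (logh K z) = (\<Sum>j<K. 16 * lv j * Re (1 / (1 + of_real (ht j) * (1 - z))))"
    unfolding logh_def by (simp only: Re_sum times_complex.sel Re_complex_of_real Im_complex_of_real) simp
  moreover have "16 * lv k * Re (1 / (1 + of_real (ht k) * (1 - z)))
      \<le> (\<Sum>j<K. 16 * lv j * Re (1 / (1 + of_real (ht j) * (1 - z))))"
    using assms(2) nn by (intro member_le_sum) auto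
  ultimately show ?thesis by simp
qed

lemma Re_logh_nonneg:
  assumes "Re z \<le> 1"
  shows "0 \<le> Re (logh K z)"
proof (cases "K = 0")
  case False
  have "0 \<le> Re (1 / (1 + of_real (ht 0) * (1 - z)))"
    using Re_inverse_one_plus_ge[of "1 - z" "ht 0" 0] assms less_imp_le[OF ht_pos[of 0]] by simp
  then have "0 \<le> 16 * lv 0 * Re (1 / (1 + of_real (ht 0) * (1 - z)))"
    using lv_pos[of 0] by (intro mult_nonneg_nonneg) auto
  also have "\<dots> \<le> Re (logh K z)" using False assms by (intro Re_logh_ge) auto
  finally show ?thesis .
qed (simp add: logh_def)

lemma norm_one_minus_sq:
  assumes "z \<in> ball 0 1"
  shows "(norm (1 - z))\<^sup>2 \<le> 2 * (1 - norm z) / Re (cayley z)"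
proof -
  have z: "z \<noteq> 1" "norm z < 1" using assms by auto
  have pos: "0 < Re (cayley z)" by (rule Re_cayley_pos[OF assms])
  have "Re (cayley z) * (norm (1 - z))\<^sup>2 = 1 - (norm z)\<^sup>2" using z by (simp add: Re_cayley)
  also have "\<dots> = (1 - norm z) * (1 + norm z)" by (simp add: power2_eq_square algebra_simps)
  also have "\<dots> \<le> (1 - norm z) * 2" using z by (intro mult_left_mono) auto
  finally show ?thesis using pos by (simp add: field_simps)
qed

text \<open>The summand of the shell containing z suffices. With x = Re (cayley z) one has |1 - z|^2
  <= 2 * 4^-k / x, hence (ht k * |1 - z|)^2 <= 2 * lv k / x, and r = x / (2 * lv k) is admissible.
  The summand is then at least 16 * lv k * r / 4 = 2 x, which is the origin of the constant
  16.\<close>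

lemma Re_logh_level:
  assumes z: "z \<in> ball 0 1" "ell (1 - norm z) = Re (cayley z)"
    and k: "1 / 4 ^ Suc k \<le> 1 - norm z" "1 - norm z \<le> 1 / 4 ^ k" "k < K"
  shows "2 * Re (cayley z) \<le> Re (logh K z)"
proof -
  define \<xi> where "\<xi> = Re (cayley z)"
  have \<xi>: "0 < \<xi>" unfolding \<xi>_def by (rule Re_cayley_pos[OF z(1)])
  have "\<xi> = ell (1 - norm z)" using z(2) by (simp add: \<xi>_def)
  also have "\<dots> \<le> lv k" unfolding lv_def using k by (intro ell_antimonoD) auto
  finally have le: "\<xi> \<le> lv k" .
  have Re1: "Re z \<le> 1" using z(1) complex_Re_le_cmod[of z] by simp
  define r where "r = \<xi> / (2 * lv k)"
  have "r / 4 \<le> Re (1 / (1 + of_real (ht k) * (1 - z)))"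
  proof (rule Re_inverse_one_plus_ge)
    show "0 \<le> r" "r \<le> 1" using \<xi> le lv_pos[of k] by (auto simp: r_def divide_le_eq)
    have four: "(2 ^ k)\<^sup>2 = (4 ^ k :: real)" by (simp add: power2_eq_square flip: power_mult_distrib)
    have "(norm (1 - z))\<^sup>2 \<le> 2 * (1 - norm z) / \<xi>" unfolding \<xi>_def by (rule norm_one_minus_sq[OF z(1)])
    also have "\<dots> \<le> 2 * (1 / 4 ^ k) / \<xi>" using k \<xi> by (intro divide_right_mono mult_left_mono) auto
    finally have "lv k * 4 ^ k * (norm (1 - z))\<^sup>2 \<le> lv k * 4 ^ k * (2 * (1 / 4 ^ k) / \<xi>)"
      using lv_pos[of k] by (intro mult_left_mono) auto
    also have "\<dots> = 2 * lv k / \<xi>" by simp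
    finally have "r * (lv k * 4 ^ k * (norm (1 - z))\<^sup>2) \<le> r * (2 * lv k / \<xi>)"
      using \<open>0 \<le> r\<close> by (intro mult_left_mono)
    also have "\<dots> = 1" using \<xi> lv_pos[of k] by (simp add: r_def)
    finally show "r * (ht k * norm (1 - z))\<^sup>2 \<le> 1"
      using lv_pos[of k] by (simp add: ht_def power_mult_distrib four)
  qed (use Re1 ht_pos[of k] in auto)
  then have "16 * lv k * (r / 4) \<le> 16 * lv k * Re (1 / (1 + of_real (ht k) * (1 - z)))"
    using lv_pos[of k] by (intro mult_left_mono) auto
  also have "\<dots> \<le> Re (logh K z)" by (rule Re_logh_ge[OF Re1 k(3)])
  also have "16 * lv k * (r / 4) = 2 * \<xi>" using lv_pos[of k] by (simp add: r_def)
  finally show ?thesis by (simp add: \<xi>_def)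
qed

lemma continuous_on_level: "continuous_on (ball 0 1) (\<lambda>z. Re (cayley z) - ell (1 - norm z))"
proof (intro continuous_intros holomorphic_on_imp_continuous_on holomorphic_on_cayley)
  show "continuous_on (ball 0 1) (\<lambda>z::complex. ell (1 - norm z))"
    by (rule continuous_on_compose2[OF ell_cont]) (auto intro!: continuous_intros)
qed

lemma open_region: "open region"
proof -
  have "open {z \<in> ball 0 1. (Re (cayley z) - ell (1 - norm z)) \<in> {0<..}}"
    using continuous_open_preimage[OF continuous_on_level open_ball open_greaterThan[of 0]]
    by (simp add: vimage_def Int_def)
  then show ?thesis by (simp add: region_def)
qed

text \<open>At a circle point other than 1 the Poisson kernel Re (cayley z) tends to 0, whereas on
  the region it stays above \<open>ell 1\<close>. Inside the disc, continuity puts frontier points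
  on the level curve.\<close>

lemma frontier_region:
  assumes "z \<in> frontier region"
  shows "z = 1 \<or> z \<in> ball 0 1 \<and> ell (1 - norm z) = Re (cayley z)"
proof -
  have cl: "z \<in> closure region" and nin: "z \<notin> region"
    using assms open_region by (auto simp: frontier_def interior_open)
  obtain x where x: "\<And>n. x n \<in> region" "x \<longlonglongrightarrow> z" using cl by (auto simp: closure_sequential)
  have x1: "x n \<in> ball 0 1" "ell (1 - norm (x n)) < Re (cayley (x n))" for n using x(1)[of n] by (auto simp: region_def)
  have "norm z \<le> 1" using x(2) x1(1) by (intro LIMSEQ_le_const2[OF tendsto_norm[OF x(2)]]) (auto intro: less_imp_le)
  then consider "z = 1" | "norm z < 1" | "norm z = 1" "z \<noteq> 1" by fastforce
  then show ?thesis
  proof cases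
    case 2
    then have z: "z \<in> ball 0 1" by simp
    then have "isCont (\<lambda>z. Re (cayley z) - ell (1 - norm z)) z"
      using continuous_on_level by (simp add: continuous_on_eq_continuous_at)
    then have "(\<lambda>n. Re (cayley (x n)) - ell (1 - norm (x n))) \<longlonglongrightarrow> Re (cayley z) - ell (1 - norm z)"
      using x(2) isCont_tendsto_compose[of z "\<lambda>z. Re (cayley z) - ell (1 - norm z)"] by blast
    then have "0 \<le> Re (cayley z) - ell (1 - norm z)"
      by (rule LIMSEQ_le_const) (use x1(2) in \<open>auto intro: less_imp_le\<close>)
    then show ?thesis using z nin by (auto simp: region_def)
  next
    case 3
    have "(\<lambda>n. (1 - (norm (x n))\<^sup>2) / (norm (1 - x n))\<^sup>2) \<longlonglongrightarrow> (1 - (norm z)\<^sup>2) / (norm (1 - z))\<^sup>2"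
      using 3 by (intro tendsto_intros x(2)) auto
    then have "(\<lambda>n. (1 - (norm (x n))\<^sup>2) / (norm (1 - x n))\<^sup>2) \<longlonglongrightarrow> 0" using 3 by simp
    moreover have "ell 1 \<le> (1 - (norm (x n))\<^sup>2) / (norm (1 - x n))\<^sup>2" for n
    proof -
      have "x n \<noteq> 1" using x1(1)[of n] by auto
      then have "ell (1 - norm (x n)) < (1 - (norm (x n))\<^sup>2) / (norm (1 - x n))\<^sup>2" using x1(2)[of n] by (simp add: Re_cayley)
      moreover have "ell 1 \<le> ell (1 - norm (x n))" using x1(1)[of n] by (intro ell_antimonoD) auto
      ultimately show ?thesis by simp
    qed
    ultimately have "ell 1 \<le> 0" by (intro LIMSEQ_le_const) auto
    then show ?thesis using ell_pos[of 1] by simp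
  qed simp
qed

text \<open>Maximum principle for (1 - z) (q / exp (logh K))^m. With finitely many summands this
  function is continuous up to 1. On the curve |q| is at most exp (2 Re u), which the first K shells
  compensate; closer to 1 the factor 1 - z must do so.\<close>

lemma poly_bound_in_region:
  fixes q :: "complex poly"
  assumes q: "\<And>z. z \<in> ball 0 1 \<Longrightarrow> norm (poly q z) \<le> exp (Re (cayley z) + ell (1 - norm z))"
    and z0: "z0 \<in> region" and B: "\<And>K. Re (logh K z0) \<le> B"
  shows "norm (poly q z0) \<le> exp B"
proof (rule ccontr)
  assume "\<not> norm (poly q z0) \<le> exp B"
  then have "1 < norm (poly q z0) / exp B" by simp
  moreover have z0b: "z0 \<in> ball 0 1" using z0 by (simp add: region_def)
  then have z01: "0 < norm (1 - z0)" by auto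
  \<comment> \<open>A high power of the ratio, supposed larger than 1, outweighs the fixed cost 2 /
    |1 - z0| of the factor 1 - z.\<close>
  ultimately obtain m where m: "2 / norm (1 - z0) < (norm (poly q z0) / exp B) ^ m"
    using real_arch_pow by blast
  obtain Cq where Cq: "\<And>z. z \<in> cball 0 1 \<Longrightarrow> norm (poly q z) \<le> Cq" "Cq > 0"
    using poly_bounded_on_disc[of q] by blast
  have l1: "0 < ell 1" by (rule ell_pos) simp
  \<comment> \<open>Frontier points outside the first K shells satisfy |1 - z| <= sqrt (2 / ell 1) /
    2^K, since Re u is at least \<open>ell 1\<close> there; this now outweighs the trivial bound
    Cq^m. Hence K is chosen after m.\<close>
  obtain K where K: "Cq ^ m * sqrt (2 / ell 1) < 2 ^ K"
    using real_arch_pow[of 2 "Cq ^ m * sqrt (2 / ell 1)"] by auto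
  define F where "F z = (1 - z) * (poly q z / exp (logh K z)) ^ m" for z
  have cbRe: "Re z \<le> 1" if "z \<in> cball 0 1" for z using that complex_Re_le_cmod[of z] by simp
  have sub: "region \<subseteq> ball 0 1" by (auto simp: region_def)
  then have csub: "closure region \<subseteq> cball 0 1"
    using closure_mono[OF sub] by simp
  have nz: "1 + of_real (ht k) * (1 - z) \<noteq> 0" if "z \<in> cball 0 1" for k and z :: complex
    using cbRe[OF that] ht_pos[of k] by (intro one_plus_mult_nonzero) auto
  have normF: "norm (F z) = norm (1 - z) * (norm (poly q z) / exp (Re (logh K z))) ^ m" for z
    by (simp add: F_def norm_mult norm_power norm_divide)
  have "norm (F z0) \<le> 2"
  proof (rule maximum_modulus_frontier[of F region])
    show "F holomorphic_on interior region"
      unfolding F_def logh_def using nz sub by (intro holomorphic_intros) (auto dest!: interior_subset[THEN subsetD])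
    show "continuous_on (closure region) F"
      unfolding F_def logh_def using nz csub by (intro continuous_intros) auto
    show "bounded region" using sub bounded_ball bounded_subset by blast
    show "z0 \<in> region" by (rule z0)
    fix z assume "z \<in> frontier region"
    from frontier_region[OF this] show "norm (F z) \<le> 2"
    proof
      assume z: "z \<in> ball 0 1 \<and> ell (1 - norm z) = Re (cayley z)"
      then have zc: "z \<in> cball 0 1" and zb: "z \<in> ball 0 1" by auto
      have n2: "norm (1 - z) \<le> 2" using norm_triangle_ineq4[of 1 z] zc by simp
      have t: "1 - norm z \<in> {0<..1}" using zb by auto
      obtain k where k: "1 / 4 ^ Suc k \<le> 1 - norm z" "1 - norm z \<le> 1 / 4 ^ k" by (rule shell_exists[OF t])
      show ?thesis
      proof (cases "k < K")
        case True
        have "norm (poly q z) \<le> exp (2 * Re (cayley z))" using q[OF zb] z by simp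
        also have "\<dots> \<le> exp (Re (logh K z))" using Re_logh_level[OF _ _ k True] z by simp
        finally have "norm (poly q z) / exp (Re (logh K z)) \<le> 1" by simp
        then have "(norm (poly q z) / exp (Re (logh K z))) ^ m \<le> 1" by (intro power_le_one) auto
        then have "norm (F z) \<le> norm (1 - z) * 1" unfolding normF by (intro mult_left_mono) auto
        then show ?thesis using n2 by simp
      next
        case False
        have "(norm (1 - z))\<^sup>2 \<le> 2 * (1 - norm z) / Re (cayley z)" by (rule norm_one_minus_sq[OF zb])
        also have "\<dots> \<le> 2 * (1 / 4 ^ K) / ell 1"
        proof (intro frac_le mult_left_mono)
          have "(1::real) / 4 ^ k \<le> 1 / 4 ^ K" using False by (intro divide_left_mono power_increasing) auto
          then show "1 - norm z \<le> 1 / 4 ^ K" using k by simp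
          have "ell 1 \<le> ell (1 - norm z)" using t by (intro ell_antimonoD) auto
          then show "ell 1 \<le> Re (cayley z)" using z by simp
        qed (use t l1 in auto)
        also have "\<dots> = (sqrt (2 / ell 1) / 2 ^ K)\<^sup>2"
        proof -
          have "(2 ^ K)\<^sup>2 = (4 ^ K :: real)" by (simp add: power2_eq_square flip: power_mult_distrib)
          then show ?thesis using l1 by (simp add: power_divide)
        qed
        finally have n1: "norm (1 - z) \<le> sqrt (2 / ell 1) / 2 ^ K"
          by (rule power2_le_imp_le) (use l1 in simp)
        have "1 \<le> exp (Re (logh K z))" using Re_logh_nonneg[OF cbRe[OF zc]] by simp
        then have "norm (poly q z) / exp (Re (logh K z)) \<le> Cq / 1" using Cq(1)[OF zc] Cq(2) by (intro frac_le) auto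
        then have "(norm (poly q z) / exp (Re (logh K z))) ^ m \<le> Cq ^ m" by (intro power_mono) auto
        then have "norm (F z) \<le> sqrt (2 / ell 1) / 2 ^ K * Cq ^ m" unfolding normF using n1 l1 by (intro mult_mono) auto
        also have "\<dots> \<le> 1" using K by (simp add: field_simps)
        finally show ?thesis by simp
      qed
    qed (simp add: F_def)
  qed
  then have "norm (1 - z0) * (norm (poly q z0) / exp (Re (logh K z0))) ^ m \<le> 2" by (simp only: normF)
  moreover have "(norm (poly q z0) / exp B) ^ m \<le> (norm (poly q z0) / exp (Re (logh K z0))) ^ m"
    using B[of K] by (intro power_mono divide_left_mono) auto
  then have "norm (1 - z0) * (norm (poly q z0) / exp B) ^ m \<le> norm (1 - z0) * (norm (poly q z0) / exp (Re (logh K z0))) ^ m"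
    by (intro mult_left_mono) auto
  moreover have "2 < norm (1 - z0) * (norm (poly q z0) / exp B) ^ m"
    using m z01 by (simp add: divide_less_eq mult.commute)
  ultimately show False by linarith
qed

text \<open>At z = 1 - 1/v with v = 4^n each summand is at most 16 * lv k and at most 16 * v * lv k
  / ht k. A tail of the convergent series below 1/64 contributes at most v/4, and the finitely many
  other terms at most v/4 once v is large. The point lies in the region because the terms of the
  series tend to 0, so that ell (4^-n) < 4^n eventually.\<close>

lemma logh_small:
  obtains n where "\<forall>K. Re (logh K (of_real (1 - 1 / 4 ^ n))) \<le> 4 ^ n / 2"
    "of_real (1 - 1 / 4 ^ n) \<in> region" "n \<ge> 1"
proof -
  have "eventually (\<lambda>N. norm (suminf (\<lambda>k. lv (k + N) / ht (k + N))) < 1/64) sequentially"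
    using suminf_exist_split[of "1/64" "\<lambda>k. lv k / ht k"] lv_summable by (auto simp: eventually_sequentially)
  then obtain J where J: "suminf (\<lambda>k. lv (k + J) / ht (k + J)) < 1/64"
    by (metis (no_types, lifting) abs_ge_self eventually_happens' order_le_less_trans real_norm_def sequentially_bot)
  have sumJ: "summable (\<lambda>k. lv (k + J) / ht (k + J))" using lv_summable by (subst summable_iff_shift)
  have four_top: "filterlim (\<lambda>n. 4 ^ n :: real) at_top sequentially"
    by real_asymp
  have "(\<lambda>n. sqrt (ell (1 / 4 ^ n)) / 2 ^ n) \<longlonglongrightarrow> 0" by (rule summable_LIMSEQ_zero[OF ell_summable])
  then have "\<forall>\<^sub>F n in sequentially. sqrt (ell (1 / 4 ^ n)) / 2 ^ n < 1" by (rule order_tendstoD) simp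
  moreover have "\<forall>\<^sub>F n in sequentially. 64 * (\<Sum>k<J. lv k) \<le> 4 ^ n" using four_top by (simp add: filterlim_at_top)
  moreover have "\<forall>\<^sub>F n in sequentially. 1 \<le> n" by (rule eventually_ge_at_top)
  ultimately have "\<forall>\<^sub>F n in sequentially. sqrt (ell (1 / 4 ^ n)) / 2 ^ n < 1 \<and> 64 * (\<Sum>k<J. lv k) \<le> 4 ^ n \<and> 1 \<le> n"
    by eventually_elim simp
  then obtain n where n: "sqrt (ell (1 / 4 ^ n)) / 2 ^ n < 1" "64 * (\<Sum>k<J. lv k) \<le> 4 ^ n" "1 \<le> n"
    using eventually_happens'[OF sequentially_bot] by blast
  define v where "v = (4::real) ^ n"
  have v: "v \<ge> 4" using n(3) power_increasing[of 1 n "4::real"] by (simp add: v_def)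
  have z: "1 - complex_of_real (1 - 1 / v) = of_real (1 / v)" by simp
  show ?thesis
  proof (rule that[of n, folded v_def])
    show "n \<ge> 1" by (rule n(3))
    show "of_real (1 - 1 / v) \<in> region"
    proof -
      have nm: "norm (complex_of_real (1 - 1 / v)) = 1 - 1 / v" using v by (simp only: norm_of_real) simp
      have "cayley (of_real (1 - 1 / v)) = of_real (2 * v - 1)"
        unfolding cayley_def z using v by (simp add: field_simps)
      then have "Re (cayley (of_real (1 - 1 / v))) = 2 * v - 1" by simp
      moreover have "ell (1 / v) < v"
      proof -
        have "sqrt (ell (1 / v)) < 2 ^ n" using n(1) by (simp add: v_def)
        then have "(sqrt (ell (1 / v)))\<^sup>2 < (2 ^ n)\<^sup>2" using ell_pos[of "1 / v"] v by (intro power_strict_mono) auto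
        moreover have "(2 ^ n)\<^sup>2 = v" by (simp add: v_def power2_eq_square flip: power_mult_distrib)
        ultimately show ?thesis using ell_pos[of "1 / v"] v by simp
      qed
      ultimately show ?thesis unfolding region_def using v nm by simp
    qed
    show "\<forall>K. Re (logh K (of_real (1 - 1 / v))) \<le> v / 2"
    proof
      fix K
      let ?c = "\<lambda>k. 16 * lv k * (1 / (1 + ht k * (1 / v)))" and ?d = "\<lambda>k. lv (k + J) / ht (k + J)"
      have "Re (logh K (of_real (1 - 1 / v))) = (\<Sum>k<K. ?c k)"
      proof -
        have "logh K (of_real (1 - 1 / v)) = of_real (\<Sum>k<K. ?c k)"
          unfolding logh_def z by simp
        then show ?thesis by simp
      qed
      also have "\<dots> \<le> (\<Sum>k<J + K. ?c k)"
      proof (rule sum_mono2)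
        fix k
        have "0 \<le> ht k * (1 / v)" using ht_pos[of k] v by simp
        then have "0 \<le> 1 / (1 + ht k * (1 / v))" by simp
        then show "0 \<le> ?c k"
          using lv_pos[of k] by (intro mult_nonneg_nonneg) auto
      qed auto
      also have "\<dots> = (\<Sum>k<J. ?c k) + (\<Sum>k<K. ?c (k + J))"
      proof -
        have "{..<J + K} = {..<J} \<union> {J..<J + K}" "{..<J} \<inter> {J..<J + K} = {}" by auto
        moreover have "sum f {J..<J + K} = (\<Sum>k<K. f (k + J))" for f :: "nat \<Rightarrow> real"
          using sum.shift_bounds_nat_ivl[of f 0 J K] by (simp add: atLeast0LessThan add.commute)
        ultimately show ?thesis by (simp only: sum.union_disjoint finite_lessThan finite_atLeastLessThan)
      qed
      also have "(\<Sum>k<J. ?c k) \<le> (\<Sum>k<J. 16 * lv k)"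
      proof (rule sum_mono)
        fix k
        have "0 \<le> ht k * (1 / v)" using ht_pos[of k] v by simp
        then have "1 / (1 + ht k * (1 / v)) \<le> 1" by (simp only: divide_le_eq_1) linarith
        then have "?c k \<le> 16 * lv k * 1" using lv_pos[of k] by (intro mult_left_mono) auto
        then show "?c k \<le> 16 * lv k" by simp
      qed
      also have "(\<Sum>k<J. 16 * lv k) \<le> v / 4" using n(2) by (simp add: v_def flip: sum_distrib_left)
      also have "(\<Sum>k<K. ?c (k + J)) \<le> (\<Sum>k<K. 16 * v * ?d k)"
      proof (rule sum_mono)
        fix k
        have "1 / (1 + ht (k + J) * (1 / v)) \<le> 1 / (ht (k + J) * (1 / v))"
          using ht_pos[of "k + J"] v by (intro divide_left_mono mult_pos_pos) (auto intro: add_pos_pos)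
        then have "?c (k + J) \<le> 16 * lv (k + J) * (1 / (ht (k + J) * (1 / v)))"
          using lv_pos[of "k + J"] by (intro mult_left_mono) auto
        then show "?c (k + J) \<le> 16 * v * ?d k" by (simp add: mult_ac)
      qed
      also have "(\<Sum>k<K. 16 * v * ?d k) = 16 * v * (\<Sum>k<K. ?d k)"
        by (simp only: sum_distrib_left)
      also have "\<dots> \<le> 16 * v * suminf (\<lambda>k. ?d k)"
        using v lv_pos ht_pos by (intro mult_left_mono sum_le_suminf sumJ) (auto intro: less_imp_le)
      also have "\<dots> \<le> 16 * v * (1/64)" using J v by (intro mult_left_mono) auto
      also have "v / 4 + 16 * v * (1/64) = v / 2" by simp
      finally show "Re (logh K (of_real (1 - 1 / v))) \<le> v / 2" by simp
    qed
  qed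
qed

end

section \<open>Point evaluations in the weighted space and failure of cyclicity\<close>

context arc_weight
begin

text \<open>On a small square about z the distance to E is at least (1 - |z|) / 2, so the weight can
  be inserted at the cost of a factor taken at that distance.\<close>

lemma point_evaluation_bound:
  assumes g: "g holomorphic_on ball 0 1" and z: "z \<in> ball 0 1" and d: "0 < d"
  shows "ennreal (norm (g z)) \<le> ennreal (16 * d)
    + ennreal (64 * d powr (1 - p) * exp (p * \<Lambda> ((1 - norm z) / 2)) / (1 - norm z)\<^sup>2) * N g"
proof -
  define t where "t = 1 - norm z"
  \<comment> \<open>The square has half-side 2 \<rho>, so its points are within 4 \<rho> = t/2 of z;
    this choice also produces the factor 64 / t^2.\<close>
  define \<rho> where "\<rho> = t / 8"
  define Q where "Q = cbox (z - Complex (2 * \<rho>) (2 * \<rho>)) (z + Complex (2 * \<rho>) (2 * \<rho>))"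
  have t: "0 < t" "t \<le> 1" using z by (auto simp: t_def)
  have \<rho>: "0 < \<rho>" using t by (simp add: \<rho>_def)
  have Q: "t / 2 \<le> 1 - norm w" if "w \<in> Q" for w
  proof -
    have "\<bar>Re (w - z)\<bar> \<le> 2 * \<rho>" "\<bar>Im (w - z)\<bar> \<le> 2 * \<rho>"
      using that by (auto simp: Q_def in_cbox_complex_iff)
    then have "norm (w - z) \<le> 4 * \<rho>" using cmod_le[of "w - z"] by linarith
    then show ?thesis using norm_triangle_sub[of w z] by (simp add: \<rho>_def t_def)
  qed
  have Qsub: "Q \<subseteq> ball 0 1" using Q t by fastforce
  have wQ: "1 \<le> exp (p * \<Lambda> (t / 2)) * wt w" if "w \<in> Q" for w
  proof -
    have w: "w \<in> ball 0 1" using Qsub that by auto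
    have "t / 2 \<le> \<delta> w" using Q[OF that] infdist_E_ge[of w] t by (auto simp: \<delta>_def)
    then have "\<Lambda> (\<delta> w) \<le> \<Lambda> (t / 2)" using \<delta>_in[OF w] t by (intro \<Lambda>_antimonoD) auto
    then have "p * \<Lambda> (\<delta> w) \<le> p * \<Lambda> (t / 2)" using p by (intro mult_left_mono) auto
    then show ?thesis by (simp add: wt_def flip: exp_add)
  qed
  have cg: "continuous_on (ball 0 1) g" using g holomorphic_on_imp_continuous_on by blast
  have "(\<integral>\<^sup>+w\<in>Q. ennreal (norm (g w) powr p) \<partial>lborel)
      \<le> (\<integral>\<^sup>+w. ennreal (exp (p * \<Lambda> (t / 2))) * (ennreal (norm (g w) powr p * wt w) * indicator (ball 0 1) w) \<partial>lborel)"
  proof (rule nn_integral_mono)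
    fix w
    show "ennreal (norm (g w) powr p) * indicator Q w
      \<le> ennreal (exp (p * \<Lambda> (t / 2))) * (ennreal (norm (g w) powr p * wt w) * indicator (ball 0 1) w)"
    proof (cases "w \<in> Q")
      case True
      have "norm (g w) powr p * 1 \<le> norm (g w) powr p * (exp (p * \<Lambda> (t / 2)) * wt w)"
        using wQ[OF True] by (intro mult_left_mono) auto
      then have "ennreal (norm (g w) powr p) \<le> ennreal (exp (p * \<Lambda> (t / 2)) * (norm (g w) powr p * wt w))"
        by (intro ennreal_leI) (simp add: mult_ac)
      also have "\<dots> = ennreal (exp (p * \<Lambda> (t / 2))) * ennreal (norm (g w) powr p * wt w)"
        by (rule ennreal_mult') simp
      finally show ?thesis using True Qsub by (auto simp: indicator_def)
    qed simp
  qed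
  also have "\<dots> = ennreal (exp (p * \<Lambda> (t / 2))) * N g"
    unfolding N_def using measurable_N[OF cg] by (intro nn_integral_cmult) simp
  finally have 1: "ennreal (16 * d) + ennreal (d powr (1 - p) / \<rho>\<^sup>2) * (\<integral>\<^sup>+w\<in>Q. ennreal (norm (g w) powr p) \<partial>lborel)
     \<le> ennreal (16 * d) + ennreal (d powr (1 - p) / \<rho>\<^sup>2) * (ennreal (exp (p * \<Lambda> (t / 2))) * N g)"
    by (intro add_left_mono mult_left_mono) auto
  have 2: "ennreal (norm (g z)) \<le> ennreal (16 * d) + ennreal (d powr (1 - p) / \<rho>\<^sup>2) * (\<integral>\<^sup>+w\<in>Q. ennreal (norm (g w) powr p) \<partial>lborel)"
    unfolding Q_def
  proof (rule norm_le_area_integral_powr_square)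
    show "g holomorphic_on cbox (z - Complex (2 * \<rho>) (2 * \<rho>)) (z + Complex (2 * \<rho>) (2 * \<rho>))"
      using holomorphic_on_subset[OF g Qsub] by (simp add: Q_def)
  qed (use p d \<rho> in auto)
  have 3: "ennreal (d powr (1 - p) / \<rho>\<^sup>2) * (ennreal (exp (p * \<Lambda> (t / 2))) * N g)
      = ennreal (64 * d powr (1 - p) * exp (p * \<Lambda> (t / 2)) / t\<^sup>2) * N g"
  proof -
    have "ennreal (d powr (1 - p) / \<rho>\<^sup>2) * ennreal (exp (p * \<Lambda> (t / 2))) = ennreal (d powr (1 - p) / \<rho>\<^sup>2 * exp (p * \<Lambda> (t / 2)))"
      by (rule ennreal_mult''[symmetric]) simp
    also have "d powr (1 - p) / \<rho>\<^sup>2 * exp (p * \<Lambda> (t / 2)) = 64 * d powr (1 - p) * exp (p * \<Lambda> (t / 2)) / t\<^sup>2"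
      by (simp add: \<rho>_def power_divide)
    finally show ?thesis by (simp only: mult.assoc[symmetric])
  qed
  show ?thesis using order_trans[OF 2 1] unfolding 3 unfolding t_def .
qed

text \<open>Belongs to the error parameter 1/16, for which 16 \<delta> = 1. The 2 collects this 1
  and the one in 1 + |g z|.\<close>

definition ev_const :: real where "ev_const = ln (2 + 64 * (1/16) powr (1 - p))"

text \<open>The logarithm of the point evaluation bound on the unit ball: the middle term comes from
  the area of the square, the argument t/2 from its extent.\<close>

definition ev :: "real \<Rightarrow> real" where "ev t = ev_const + 2 * ln (1 / t) + p * \<Lambda> (t / 2)"

lemma ev_const_pos: "0 < ev_const"
  unfolding ev_const_def by (rule ln_gt_zero) (simp add: add_pos_nonneg add_strict_increasing2)

lemma norm_le_exp_ev:
  assumes g: "g holomorphic_on ball 0 1" and z: "z \<in> ball 0 1" and N: "N g \<le> 1"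
  shows "1 + norm (g z) \<le> exp (ev (1 - norm z))"
proof -
  define t where "t = 1 - norm z"
  have t: "0 < t" "t \<le> 1" using z by (auto simp: t_def)
  define X where "X = exp (p * \<Lambda> (t / 2)) / t\<^sup>2"
  have "t\<^sup>2 \<le> 1" using t by (intro power_le_one) auto
  also have "1 \<le> exp (p * \<Lambda> (t / 2))" using \<Lambda>_pos[of "t / 2"] t p by simp
  finally have X: "1 \<le> X" using t by (simp add: X_def)
  have "ennreal (norm (g z)) \<le> ennreal (16 * (1/16)) + ennreal (64 * (1/16) powr (1 - p) * exp (p * \<Lambda> (t / 2)) / t\<^sup>2) * N g"
    unfolding t_def by (rule point_evaluation_bound[OF g z]) simp
  also have "\<dots> \<le> ennreal (16 * (1/16)) + ennreal (64 * (1/16) powr (1 - p) * exp (p * \<Lambda> (t / 2)) / t\<^sup>2) * 1"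
    using N by (intro add_left_mono mult_left_mono) auto
  also have "\<dots> = ennreal (1 + 64 * (1/16) powr (1 - p) * X)"
    by (simp add: X_def)
  finally have "norm (g z) \<le> 1 + 64 * (1/16) powr (1 - p) * X"
    using X by (subst (asm) ennreal_le_iff) auto
  also have "1 + \<dots> \<le> (2 + 64 * (1/16) powr (1 - p)) * X" using X by (simp add: algebra_simps)
  also have "\<dots> = exp (ev t)"
  proof -
    have "exp ev_const = 2 + 64 * (1/16) powr (1 - p)"
      unfolding ev_const_def by (rule exp_ln) (simp add: add_pos_nonneg)
    moreover have "exp (2 * ln (1 / t)) = 1 / t\<^sup>2"
    proof -
      have "exp (2 * ln (1 / t)) = exp (ln (1 / t)) ^ 2" by (simp add: exp_double)
      also have "\<dots> = 1 / t\<^sup>2" using t by (simp add: power_divide)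
      finally show ?thesis .
    qed
    ultimately show ?thesis by (simp add: ev_def X_def exp_add)
  qed
  finally show ?thesis by (simp add: t_def)
qed

text \<open>The square root is subadditive, so the series splits into a geometric one, one dominated
  by k / 2^k, and the given one. Evaluation of \<Lambda> at half the argument is covered by passing
  to the next index.\<close>

lemma radial_bound_ev:
  assumes sm: "summable (\<lambda>k. sqrt (\<Lambda> (1 / 4 ^ k)) / 2 ^ k)"
  shows "radial_bound ev"
proof
  show pos: "0 < ev t" if "t \<in> {0<..1}" for t
  proof -
    have "0 < p * \<Lambda> (t / 2)" using \<Lambda>_pos[of "t / 2"] that p by simp
    moreover have "0 \<le> ln (1 / t)" using that by simp
    ultimately show ?thesis using ev_const_pos by (simp add: ev_def)
  qed
  show "antimono_on {0<..1} ev"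
  proof (rule monotone_onI)
    fix s t :: real assume st: "s \<in> {0<..1}" "t \<in> {0<..1}" "s \<le> t"
    have "p * \<Lambda> (t / 2) \<le> p * \<Lambda> (s / 2)" using st p by (intro mult_left_mono \<Lambda>_antimonoD) auto
    moreover have "ln (1 / t) \<le> ln (1 / s)" using st by (simp add: ln_div)
    ultimately show "ev t \<le> ev s" by (simp add: ev_def)
  qed
  show "continuous_on {0<..1} ev" unfolding ev_def
    by (intro continuous_intros continuous_on_compose2[OF \<Lambda>_cont]) auto
  have bound: "sqrt (ev (1 / 4 ^ k)) / 2 ^ k \<le> sqrt ev_const * (1/2) ^ k + 2 * (real k * (1/2) ^ k) + 2 * sqrt p * (sqrt (\<Lambda> (1 / 4 ^ Suc k)) / 2 ^ Suc k)" for k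
  proof -
    have \<Lambda>0: "0 < \<Lambda> (1 / 4 ^ Suc k)" by (rule \<Lambda>_pos) (simp del: power_Suc)
    have "\<Lambda> (x / 2) \<le> \<Lambda> (x / 4)" if "0 < x" "x \<le> 1" for x using that by (intro \<Lambda>_antimonoD) auto
    from this[of "1 / 4 ^ k"] have "\<Lambda> (1 / 4 ^ k / 2) \<le> \<Lambda> (1 / 4 ^ Suc k)" by (simp add: mult.commute)
    then have 1: "p * \<Lambda> (1 / 4 ^ k / 2) \<le> p * \<Lambda> (1 / 4 ^ Suc k)" using p by (intro mult_left_mono) auto
    have "ln (1 / (1 / 4 ^ k)) = real k * ln (4::real)" by (simp add: ln_realpow)
    moreover have "ln (4::real) \<le> 2"
    proof -
      have "(2::real) \<le> exp 1" using exp_ge_add_one_self[of 1] by simp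
      then have "(2::real) * 2 \<le> exp 1 * exp 1" by (intro mult_mono) auto
      then have "4 \<le> exp (2::real)" by (simp flip: exp_add)
      then have "ln 4 \<le> ln (exp (2::real))" by (intro ln_mono) auto
      then show ?thesis by simp
    qed
    ultimately have "ln (1 / (1 / 4 ^ k)) \<le> real k * (2::real)" by (simp only:) (intro mult_left_mono, auto)
    then have 2: "2 * ln (1 / (1 / 4 ^ k)) \<le> 4 * real k" by simp
    have "ev (1 / 4 ^ k) \<le> ev_const + 4 * real k + p * \<Lambda> (1 / 4 ^ Suc k)"
      unfolding ev_def using 1 2 by linarith
    then have "sqrt (ev (1 / 4 ^ k)) \<le> sqrt (ev_const + 4 * real k + p * \<Lambda> (1 / 4 ^ Suc k))" by simp
    also have "\<dots> \<le> sqrt (ev_const + 4 * real k) + sqrt (p * \<Lambda> (1 / 4 ^ Suc k))"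
      using ev_const_pos \<Lambda>0 p by (intro sqrt_add_le_add_sqrt) auto
    also have "sqrt (ev_const + 4 * real k) \<le> sqrt ev_const + sqrt (4 * real k)"
      using ev_const_pos by (intro sqrt_add_le_add_sqrt) auto
    also have "sqrt (4 * real k) \<le> 2 * real k"
    proof (rule real_le_lsqrt)
      show "4 * real k \<le> (2 * real k)\<^sup>2"
        using of_nat_mono[OF le_square[of k], where 'a = real] by (simp add: power2_eq_square)
    qed auto
    finally have "sqrt (ev (1 / 4 ^ k)) \<le> sqrt ev_const + 2 * real k + sqrt p * sqrt (\<Lambda> (1 / 4 ^ Suc k))"
      by (simp add: real_sqrt_mult)
    then have "sqrt (ev (1 / 4 ^ k)) / 2 ^ k \<le> (sqrt ev_const + 2 * real k + sqrt p * sqrt (\<Lambda> (1 / 4 ^ Suc k))) / 2 ^ k"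
      by (intro divide_right_mono) auto
    then show ?thesis by (simp add: add_divide_distrib power_one_over)
  qed
  show "summable (\<lambda>k. sqrt (ev (1 / 4 ^ k)) / 2 ^ k)"
  proof (rule summable_comparison_test')
    \<comment> \<open>Bernoulli's inequality bounds k by a multiple of (3/2)^k, leaving a geometric
      series of ratio 3/4.\<close>
    have "summable (\<lambda>k. real k * (1/2) ^ k)"
    proof (rule summable_comparison_test'[of "\<lambda>k. 4 * (3/4::real) ^ k" 0])
      show "summable (\<lambda>k. 4 * (3/4::real) ^ k)" by (intro summable_mult summable_geometric) simp
      fix k :: nat
      have "1 + real k * (1/2) \<le> (1 + 1/2) ^ k" by (rule Bernoulli_inequality) simp
      then have "real k \<le> 4 * (3/2) ^ k" by simp
      then have "real k * (1/2) ^ k \<le> 4 * (3/2) ^ k * (1/2) ^ k" by (intro mult_right_mono) auto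
      also have "\<dots> = 4 * (3/4) ^ k" by (simp add: mult.assoc flip: power_mult_distrib)
      finally show "norm (real k * (1/2) ^ k) \<le> 4 * (3/4) ^ k" by simp
    qed
    moreover have "summable (\<lambda>k. sqrt (\<Lambda> (1 / 4 ^ Suc k)) / 2 ^ Suc k)" using sm by (subst summable_Suc_iff)
    ultimately show "summable (\<lambda>k. sqrt ev_const * (1/2) ^ k + 2 * (real k * (1/2) ^ k) + 2 * sqrt p * (sqrt (\<Lambda> (1 / 4 ^ Suc k)) / 2 ^ Suc k))"
      by (intro summable_add summable_mult summable_geometric) auto
    fix k :: nat
    have "0 < ev (1 / 4 ^ k)" by (rule pos) simp
    then show "norm (sqrt (ev (1 / 4 ^ k)) / 2 ^ k) \<le> sqrt ev_const * (1/2) ^ k + 2 * (real k * (1/2) ^ k) + 2 * sqrt p * (sqrt (\<Lambda> (1 / 4 ^ Suc k)) / 2 ^ Suc k)"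
      using bound[of k] by simp
  qed
qed

text \<open>If q S is close to 1 in norm, point evaluations bound q everywhere, and the bound beyond
  the curve gives |q z0| <= exp (v/2). But |S z0| = exp (-(2 v - 1)), so q S is small at z0 instead
  of close to 1. The point z0 does not depend on q, hence its evaluation constant can be fixed
  before q is chosen.\<close>

lemma not_cyclic_if_summable:
  assumes sm: "summable (\<lambda>k. sqrt (\<Lambda> (1 / 4 ^ k)) / 2 ^ k)"
  shows "\<not> cyclic_in (B_space \<Lambda> E p) (B_norm \<Lambda> E p) atomic_inner"
proof
  assume cyc: "cyclic_in (B_space \<Lambda> E p) (B_norm \<Lambda> E p) atomic_inner"
  interpret radial_bound ev by (rule radial_bound_ev[OF sm])
  have "(\<lambda>_. 1) \<in> B_space \<Lambda> E p"
    unfolding B_space_def B_norm_pow_eq_N using N_bounded_finite[of "\<lambda>_. 1" 1] by auto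
  then have one: "(\<lambda>_. 1) \<in> norm_closure (B_space \<Lambda> E p) (B_norm \<Lambda> E p) (poly_multiples atomic_inner)"
    using cyc by (simp add: cyclic_in_def)
  let ?g = "\<lambda>q z. 1 - poly q z * atomic_inner z"
  have hol: "?g q holomorphic_on ball 0 1" for q
    unfolding atomic_inner_eq by (intro holomorphic_intros holomorphic_on_cayley)
  have approx: "\<exists>q :: complex poly. N (?g q) < ennreal e" if e: "0 < e" for e
  proof -
    have "0 < e powr (1 / p)" using e by simp
    then obtain q :: "complex poly" where q: "B_norm \<Lambda> E p (?g q) < e powr (1 / p)"
      using one unfolding norm_closure_def by blast
    obtain b where b: "\<And>z. z \<in> cball 0 1 \<Longrightarrow> norm (poly q z) \<le> b"
      using poly_bounded_on_disc[of q] by blast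
    \<comment> \<open>Needed before \<open>B_norm\<close> can be read back: \<open>enn2real\<close>
      sends an infinite integral to 0, so a small \<open>B_norm\<close> alone would prove
      nothing.\<close>
    have "N (?g q) < \<infinity>"
    proof (rule N_bounded_finite[of _ "1 + b * 1"])
      fix z :: complex assume z: "z \<in> ball 0 1"
      have bz: "norm (poly q z) \<le> b" using z by (intro b) auto
      then have "norm (poly q z * atomic_inner z) \<le> b * 1"
        unfolding norm_mult using norm_atomic_inner_le[OF z] order_trans[OF norm_ge_zero bz] by (intro mult_mono) auto
      then show "norm (1 - poly q z * atomic_inner z) \<le> 1 + b * 1"
        using norm_triangle_ineq4[of 1 "poly q z * atomic_inner z"] by simp
    qed
    then obtain r where r: "0 \<le> r" "N (?g q) = ennreal r"
      by (cases "N (?g q)") auto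
    have "r powr (1 / p) < e powr (1 / p)" using q r by (simp add: B_norm_def B_norm_pow_eq_N)
    moreover have "e powr (1 / p) \<le> r powr (1 / p)" if "e \<le> r" using that e p by (intro powr_mono2) auto
    ultimately have "r < e" by (meson not_le)
    then have "N (?g q) < ennreal e" using r by (simp only: ennreal_less_iff)
    then show ?thesis by blast
  qed
  obtain n where n: "\<forall>K. Re (logh K (of_real (1 - 1 / 4 ^ n))) \<le> 4 ^ n / 2" "of_real (1 - 1 / 4 ^ n) \<in> region" "n \<ge> 1"
    using logh_small by blast
  define v where "v = (4::real) ^ n"
  define z0 where "z0 = complex_of_real (1 - 1 / v)"
  have v: "v \<ge> 4" using n(3) power_increasing[of 1 n "4::real"] by (simp add: v_def)
  have z0: "z0 \<in> region" "\<And>K. Re (logh K z0) \<le> v / 2" using n by (auto simp: z0_def v_def)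
  then have z0b: "z0 \<in> ball 0 1" by (simp add: region_def)
  have cay: "Re (cayley z0) = 2 * v - 1"
  proof -
    have "1 - z0 = of_real (1 / v)" by (simp add: z0_def)
    then have "cayley z0 = of_real (2 * v - 1)" unfolding cayley_def using v by (simp add: z0_def field_simps)
    then show ?thesis by simp
  qed
  \<comment> \<open>The evaluation constant at \<open>z0\<close> for the error parameter 1/64: the
    additive term is then 1/4, and \<open>e\<close> is chosen to make the other one at most
    1/4.\<close>
  define C where "C = 64 * (1/64) powr (1 - p) * exp (p * \<Lambda> ((1 - norm z0) / 2)) / (1 - norm z0)\<^sup>2"
  have C: "0 \<le> C" by (simp add: C_def)
  define e where "e = min 1 (1 / (4 * (C + 1)))"
  have e: "0 < e" "e \<le> 1" "C * e \<le> 1/4"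
  proof -
    show "0 < e" "e \<le> 1" using C by (auto simp: e_def)
    have "C * e \<le> C * (1 / (4 * (C + 1)))" using C by (intro mult_left_mono) (auto simp: e_def)
    also have "\<dots> \<le> 1/4" using C by (simp add: field_simps)
    finally show "C * e \<le> 1/4" .
  qed
  obtain q :: "complex poly" where q: "N (?g q) < ennreal e" using approx[OF e(1)] by blast
  define g where "g z = 1 - poly q z * atomic_inner z" for z
  have Ng: "N g \<le> ennreal e" "N g \<le> 1"
  proof -
    show "N g \<le> ennreal e" using q by (simp add: g_def[abs_def])
    also have "\<dots> \<le> ennreal 1" using e by (intro ennreal_leI) auto
    finally show "N g \<le> 1" by simp
  qed
  have gh: "g holomorphic_on ball 0 1" unfolding g_def by (rule hol)
  have nS: "norm (atomic_inner z) = exp (- Re (cayley z))" for z by (simp add: atomic_inner_eq)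
  have "norm (poly q z0) \<le> exp (v / 2)"
  proof (rule poly_bound_in_region[OF _ z0])
    fix z :: complex assume z: "z \<in> ball 0 1"
    have "poly q z * atomic_inner z = 1 - g z" by (simp add: g_def)
    then have "norm (poly q z * atomic_inner z) \<le> 1 + norm (g z)" using norm_triangle_ineq4[of 1 "g z"] by simp
    also have "\<dots> \<le> exp (ev (1 - norm z))" by (rule norm_le_exp_ev[OF gh z Ng(2)])
    finally have "norm (poly q z) * exp (- Re (cayley z)) \<le> exp (ev (1 - norm z))" by (simp add: norm_mult nS)
    then show "norm (poly q z) \<le> exp (Re (cayley z) + ev (1 - norm z))"
      by (simp add: exp_add exp_minus field_simps)
  qed
  then have "norm (poly q z0 * atomic_inner z0) \<le> exp (v / 2) * exp (- (2 * v - 1))"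
    unfolding norm_mult nS cay by (intro mult_right_mono) auto
  also have "\<dots> = exp (- (3 * v / 2 - 1))" by (simp flip: exp_add)
  also have "\<dots> < 1/2"
  proof -
    have "1 + (3 * v / 2 - 1) \<le> exp (3 * v / 2 - 1)" by (rule exp_ge_add_one_self)
    then have "2 < exp (3 * v / 2 - 1)" using v by linarith
    then show ?thesis by (simp add: exp_minus field_simps)
  qed
  finally have small: "norm (poly q z0 * atomic_inner z0) < 1/2" .
  have "1 \<le> norm (g z0) + norm (poly q z0 * atomic_inner z0)"
    using norm_triangle_ineq[of "g z0" "poly q z0 * atomic_inner z0"] by (simp add: g_def)
  then have big: "1/2 < norm (g z0)" using small by linarith
  have "ennreal (norm (g z0)) \<le> ennreal (16 * (1/64)) + ennreal C * N g"
    unfolding C_def by (rule point_evaluation_bound[OF gh z0b]) simp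
  also have "\<dots> \<le> ennreal (16 * (1/64)) + ennreal C * ennreal e"
    using Ng(1) by (intro add_left_mono mult_left_mono) auto
  also have "\<dots> = ennreal (16 * (1/64) + C * e)"
    using C e by (simp add: ennreal_mult ennreal_plus del: divide_const_simps)
  also have "\<dots> \<le> ennreal (1/2)" using e by (intro ennreal_leI) simp
  finally have "ennreal (norm (g z0)) \<le> ennreal (1/2)" .
  then have "norm (g z0) \<le> 1/2" by (subst (asm) ennreal_le_iff) simp
  then show False using big by simp
qed

end

theorem mainTheorem7:
  fixes E :: "complex set" and p :: real and \<Lambda> :: "real \<Rightarrow> real"
  assumes "nontrivial_closed_arc E"
    and "1 \<in> E"
    and "1 \<le> p"
    and "\<And>t. t \<in> {0<..1} \<Longrightarrow> 0 < \<Lambda> t"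
    and "antimono_on {0<..1} \<Lambda>"
    and "continuous_on {0<..1} \<Lambda>"
  shows "cyclic_in (B_space \<Lambda> E p) (B_norm \<Lambda> E p) atomic_inner \<longleftrightarrow>
         (\<integral>\<^sup>+t\<in>{0<..<1}. ennreal (sqrt (\<Lambda> t / t)) \<partial>lborel) = \<infinity>"
proof -
  interpret arc_weight E p \<Lambda> using assms by unfold_locales
  show ?thesis
    using integral_sqrt_infinite_iff[OF assms(4-6)] cyclic_if_not_summable not_cyclic_if_summable by blast
qed

end
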